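(* Let $N=2n$ be even. There is a grading-preserving unitary isomorphism of $\mathfrak{sl}_2$-modules between the fusion product $V_N^*$ (with the grading $\widetilde{\deg}$) and the space $\mathcal X_N$ (with the grading $\operatorname{maj}$) such that, for each $k=0,\dots,n$, the multiplicity space $\mathcal M_k$ is spanned by the standard Young tableaux $\tau$ of shape $(n+k,n-k)$ (and hence $\mathcal M_k[i]$ is spanned by those $\tau$ of this shape with $\operatorname{maj}(\tau)=i$).
   Context: All spaces are over $\mathbb C$. $M_d$ denotes the $d$-dimensional irreducible representation of $\mathfrak{sl}_2$, and $e=\begin{pmatrix}0&1\\0&0\end{pmatrix}$ is the raising operator. Fusion product. Let $v_0$ be the lowest weight vector of $M_2=\mathbb C^2$ and let $z_1,\dots,z_N$ be pairwise distinct complex numbers. For $z\in\mathbb C$, let $M_2(z)$ be the evaluation representation of the current algebra $\mathfrak{sl}_2\otimes\mathbb C[t]$, $(x\otimes t^i)v=z^i\cdot xv$, and let $V_N=M_2(z_1)\otimes\cdots\otimes M_2(z_N)$. Put $e_j=e\otimes t^j$. Let $V_N^{(m)}\subset V_N$ be the span of the vectors $e_{i_1}\cdots e_{i_l}(v_0\otimes\cdots\otimes v_0)$ with $i_1+\dots+i_l=m$ ($l\ge0$, $i_s\ge0$), and let $V_N^{(\le m)}=\sum_{k\le m}V_N^{(k)}$. The fusion product is the associated graded space $V_N^*=\bigoplus_{m\ge0}V_N^*[m]$, $V_N^*[m]=V_N^{(\le m)}/V_N^{(\le m-1)}$ (with $V_N^{(\le -1)}=0$); $V_N^*[m]$ is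 the subspace of elements of degree $m$, and the degree is denoted by $\widetilde{\deg}$. Elements $x\otimes t^l$ send $V_N^*[m]$ to $V_N^*[m+l]$. It is known that $V_N^*$ does not depend on the pairwise distinct numbers $z_1,\dots,z_N$ and that $V_N^*\simeq(\mathbb C^2)^{\otimes N}$ as an $\mathfrak{sl}_2$-module. $V_N^*$ is equipped with an inner product such that the corresponding representation of $\mathfrak{sl}_2$ is unitary. Decompose $V_N^*$ into irreducible $\mathfrak{sl}_2$-modules: $V_N^*=\bigoplus_{k=0}^nM_{2k+1}\otimes\mathcal M_k$. The multiplicity space $\mathcal M_k$ inherits the grading from $V_N^*$: $\mathcal M_k=\bigoplus_{i\ge0}\mathcal M_k[i]$, where $\mathcal M_k[i]=\mathcal M_k\cap V_N^*[i]$ is its part of degree $i$. Tableaux. For a standard Young tableau $\tau$ with $N$ cells and at most two rows, the major index is $\operatorname{maj}(\tau)=\sum_{i\in\operatorname{des}(\tau)}i$, where $\operatorname{des}(\tau)$ is the set of $i\le N-1$ such that the element $i+1$ lies lower than $i$ in $\tau$. $\mathcal X_N$ denotes the space $(\mathbb C^2)^{\otimes N}=\bigoplus_{k=0}^nM_{2k+1}\otimes\pi_k$ (Schur–Weyl duality), where $\pi_k$ is the irreducible representation of the symmetric group $\mathfrak S_N$ corresponding to the Young diagram $(n+k,n-k)$, realized in the space spanned by the standard Young tableaux of shape $(n+k,n-k)$, equipped with the standard inner product under which the representation is unitary. $\mathcal X_N$ is an $\mathfrak{sl}_2$-module endowed additionally with the grading $\operatorname{maj}$ ($x\otimes\tau$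 has degree $\operatorname{maj}(\tau)$).
   Formalization: The inner product on the fusion product is additionally assumed to make different degrees orthogonal; this is necessary, since for N=4, k=0 (degrees 2 and 4) a unitary inner product with non-orthogonal degrees admits no grading-preserving unitary isomorphism. *)

theory Defs
  imports
    "HOL-Analysis.Analysis"
    "HOL-Library.Function_Algebras"
    "HOL-Combinatorics.Transposition"
begin

section \<open>Complex-valued functions as a complex vector space\<close>

definition cscale :: "complex \<Rightarrow> ('a \<Rightarrow> complex) \<Rightarrow> 'a \<Rightarrow> complex" where
  "cscale c f = (\<lambda>a. c * f a)"

interpretation cfun: vector_space "cscale :: complex \<Rightarrow> ('a \<Rightarrow> complex) \<Rightarrow> 'a \<Rightarrow> complex"
  by unfold_locales (auto simp: cscale_def plus_fun_def algebra_simps)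


section \<open>Representations of the Lie algebra sl2\<close>

definition sl2 :: "(complex^2^2) set" where
  "sl2 = {x. trace x = 0}"

definition sl2_e :: "complex^2^2" where
  "sl2_e = vector [vector [0, 1], vector [0, 0]]"

definition conj_transpose :: "complex^2^2 \<Rightarrow> complex^2^2" where
  "conj_transpose x = (\<chi> i j. cnj (x $ j $ i))"

record 'v sl2_rep =
  carr :: "'v set"
  vadd :: "'v \<Rightarrow> 'v \<Rightarrow> 'v"
  vzero :: 'v
  vscale :: "complex \<Rightarrow> 'v \<Rightarrow> 'v"
  vact :: "complex^2^2 \<Rightarrow> 'v \<Rightarrow> 'v"

record 'v graded_rep = "'v sl2_rep" +
  ip :: "'v \<Rightarrow> 'v \<Rightarrow> complex"
  deg :: "nat \<Rightarrow> 'v set"  \<comment> \<open>the homogeneous subspaces\<close>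

definition rep_hom :: "('v, 'p) sl2_rep_scheme \<Rightarrow> ('w, 'q) sl2_rep_scheme \<Rightarrow> ('v \<Rightarrow> 'w) \<Rightarrow> bool" where
  "rep_hom V W T \<longleftrightarrow>
     T \<in> carr V \<rightarrow> carr W \<and>
     (\<forall>v\<in>carr V. \<forall>w\<in>carr V. T (vadd V v w) = vadd W (T v) (T w)) \<and>
     (\<forall>c. \<forall>v\<in>carr V. T (vscale V c v) = vscale W c (T v)) \<and>
     (\<forall>x\<in>sl2. \<forall>v\<in>carr V. T (vact V x v) = vact W x (T v))"

text \<open>
  The form is linear in the first argument.  Unitarity is unitarity for the compact real form
  \<open>su(2)\<close>, i.e. the adjoint of the action of \<open>x\<close> is the action of its conjugate transpose.
\<close>

definition unitary_rep :: "('v, 'p) graded_rep_scheme \<Rightarrow> bool" where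
  "unitary_rep V \<longleftrightarrow>
     (\<forall>u\<in>carr V. \<forall>v\<in>carr V. \<forall>w\<in>carr V. ip V (vadd V u v) w = ip V u w + ip V v w) \<and>
     (\<forall>c. \<forall>v\<in>carr V. \<forall>w\<in>carr V. ip V (vscale V c v) w = c * ip V v w) \<and>
     (\<forall>v\<in>carr V. \<forall>w\<in>carr V. ip V w v = cnj (ip V v w)) \<and>
     (\<forall>v\<in>carr V. v \<noteq> vzero V \<longrightarrow> 0 < Re (ip V v v)) \<and>
     (\<forall>x\<in>sl2. \<forall>v\<in>carr V. \<forall>w\<in>carr V. ip V (vact V x v) w = ip V v (vact V (conj_transpose x) w))"

definition orthogonal_grading :: "('v, 'p) graded_rep_scheme \<Rightarrow> bool" where
  "orthogonal_grading V \<longleftrightarrow>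
     (\<forall>i j. i \<noteq> j \<longrightarrow> (\<forall>v\<in>deg V i. \<forall>w\<in>deg V j. ip V v w = 0))"

definition unitary_iso :: "('v, 'p) graded_rep_scheme \<Rightarrow> ('w, 'q) graded_rep_scheme \<Rightarrow> ('v \<Rightarrow> 'w) \<Rightarrow> bool" where
  "unitary_iso V W T \<longleftrightarrow>
     rep_hom V W T \<and> bij_betw T (carr V) (carr W) \<and>
     (\<forall>v\<in>carr V. \<forall>w\<in>carr V. ip W (T v) (T w) = ip V v w)"

definition grading_preserving :: "('v, 'p) graded_rep_scheme \<Rightarrow> ('w, 'q) graded_rep_scheme \<Rightarrow> ('v \<Rightarrow> 'w) \<Rightarrow> bool" where
  "grading_preserving V W T \<longleftrightarrow> (\<forall>m. T ` deg V m = deg W m)"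

text \<open>
  The irreducible representation \<open>M_d\<close> in an orthonormal weight basis \<open>w_0, ..., w_(d-1)\<close>,
  \<open>w_j\<close> having weight \<open>2j - (d-1)\<close>:
  \<open>e w_j = sqrt ((j+1)(d-1-j)) w_(j+1)\<close> and \<open>f w_j = sqrt (j(d-j)) w_(j-1)\<close>.
  The vector with coordinates \<open>u j\<close> is represented by \<open>u\<close>.
\<close>

definition irrep_act :: "nat \<Rightarrow> complex^2^2 \<Rightarrow> (nat \<Rightarrow> complex) \<Rightarrow> nat \<Rightarrow> complex" where
  "irrep_act d x u = (\<lambda>j. if j < d then
       x $ 1 $ 1 * (2 * of_nat j - (of_nat d - 1)) * u j
     + x $ 1 $ 2 * of_real (sqrt (real j * (real d - real j))) * u (j - 1)
     + x $ 2 $ 1 * of_real (sqrt ((real j + 1) * (real d - 1 - real j))) * u (j + 1)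
     else 0)"

definition irrep :: "nat \<Rightarrow> (nat \<Rightarrow> complex) sl2_rep" where
  "irrep d = \<lparr>carr = {u. \<forall>j\<ge>d. u j = 0}, vadd = (+), vzero = 0, vscale = cscale,
     vact = irrep_act d\<rparr>"

text \<open>
  The multiplicity space of \<open>M_d\<close> in \<open>V\<close> is the space of intertwining operators \<open>M_d \<rightarrow> V\<close>, so that
  \<open>u \<otimes> \<phi> \<mapsto> \<phi> u\<close> embeds \<open>M_d \<otimes> Hom(M_d, V)\<close> into \<open>V\<close> as the isotypic component;
  \<open>\<phi>\<close> has degree \<open>i\<close> if all vectors \<open>u \<otimes> \<phi>\<close> have degree \<open>i\<close> in \<open>V\<close>.
\<close>

definition mult_space :: "('v, 'p) sl2_rep_scheme \<Rightarrow> nat \<Rightarrow> ((nat \<Rightarrow> complex) \<Rightarrow> 'v) set" where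
  "mult_space V d = {\<phi> \<in> extensional (carr (irrep d)). rep_hom (irrep d) V \<phi>}"

definition mult_space_deg :: "('v, 'p) graded_rep_scheme \<Rightarrow> nat \<Rightarrow> nat \<Rightarrow> ((nat \<Rightarrow> complex) \<Rightarrow> 'v) set" where
  "mult_space_deg V d i = {\<phi> \<in> mult_space V d. \<forall>u\<in>carr (irrep d). \<phi> u \<in> deg V i}"


section \<open>The tensor power of the two-dimensional representation\<close>

text \<open>
  A tensor is given by its coordinates in the basis \<open>\<epsilon>_(s_1) \<otimes> ... \<otimes> \<epsilon>_(s_N)\<close>,
  where \<open>s\<close> ranges over the lists of length \<open>N\<close> over the two-element index type of \<open>complex^2\<close>.
  Since \<open>e \<epsilon>_2 = \<epsilon>_1\<close>, the lowest weight vector is \<open>\<epsilon>_2\<close>.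
  Positions in the list, and accordingly the points \<open>z\<close>, are numbered from 0.
\<close>

type_synonym tensor = "2 list \<Rightarrow> complex"

definition tensors :: "nat \<Rightarrow> tensor set" where
  "tensors N = {f. \<forall>s. length s \<noteq> N \<longrightarrow> f s = 0}"

text \<open>The sum over \<open>j\<close> of \<open>a j\<close> times the operator applying \<open>x\<close> to the \<open>j\<close>-th tensor factor.\<close>

definition tensor_act :: "nat \<Rightarrow> (nat \<Rightarrow> complex) \<Rightarrow> complex^2^2 \<Rightarrow> tensor \<Rightarrow> tensor" where
  "tensor_act N a x f = (\<lambda>s. if length s = N
     then \<Sum>j<N. a j * (\<Sum>b\<in>UNIV. x $ (s ! j) $ b * f (s[j := b])) else 0)"

definition tensor_ip :: "nat \<Rightarrow> tensor \<Rightarrow> tensor \<Rightarrow> complex" where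
  "tensor_ip N f g = (\<Sum>s | length s = N. f s * cnj (g s))"

text \<open>The adjacent transposition exchanging the tensor factors number \<open>i\<close> and \<open>i+1\<close> (counted from 1).\<close>

definition tensor_swap :: "nat \<Rightarrow> tensor \<Rightarrow> tensor" where
  "tensor_swap i f = (\<lambda>s. f (s[i - 1 := s ! i, i := s ! (i - 1)]))"


section \<open>The fusion product for sl2\<close>

text \<open>The action of \<open>x \<otimes> t^i\<close> on \<open>V_N\<close>.\<close>

definition current_act :: "nat \<Rightarrow> (nat \<Rightarrow> complex) \<Rightarrow> complex^2^2 \<Rightarrow> nat \<Rightarrow> tensor \<Rightarrow> tensor" where
  "current_act N z x i = tensor_act N (\<lambda>j. z j ^ i) x"

definition lowest :: "nat \<Rightarrow> tensor" where
  "lowest N = (\<lambda>s. if s = replicate N 2 then 1 else 0)"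

definition V_deg :: "nat \<Rightarrow> (nat \<Rightarrow> complex) \<Rightarrow> nat \<Rightarrow> tensor set" where
  "V_deg N z m = cfun.span {foldr (current_act N z sl2_e) is (lowest N) | is. sum_list is = m}"

definition V_le :: "nat \<Rightarrow> (nat \<Rightarrow> complex) \<Rightarrow> nat \<Rightarrow> tensor set" where
  "V_le N z m = cfun.span (\<Union>k\<in>{..m}. V_deg N z k)"

definition V_lt :: "nat \<Rightarrow> (nat \<Rightarrow> complex) \<Rightarrow> nat \<Rightarrow> tensor set" where
  "V_lt N z m = cfun.span (\<Union>k\<in>{..<m}. V_deg N z k)"

text \<open>
  Elements of the quotient \<open>V_le N z m / V_lt N z m\<close> are cosets.  An element of the associated graded
  space is the finitely supported family of its homogeneous components.
\<close>

definition quot :: "nat \<Rightarrow> (nat \<Rightarrow> complex) \<Rightarrow> nat \<Rightarrow> tensor set set" where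
  "quot N z m = {{v + u | u. u \<in> V_lt N z m} | v. v \<in> V_le N z m}"

definition fusion_carr :: "nat \<Rightarrow> (nat \<Rightarrow> complex) \<Rightarrow> (nat \<Rightarrow> tensor set) set" where
  "fusion_carr N z = {w. (\<forall>m. w m \<in> quot N z m) \<and> finite {m. w m \<noteq> V_lt N z m}}"

definition fusion :: "nat \<Rightarrow> (nat \<Rightarrow> complex) \<Rightarrow>
    ((nat \<Rightarrow> tensor set) \<Rightarrow> (nat \<Rightarrow> tensor set) \<Rightarrow> complex) \<Rightarrow> (nat \<Rightarrow> tensor set) graded_rep" where
  "fusion N z B = \<lparr>
     carr = fusion_carr N z,
     vadd = (\<lambda>v w m. {a + b | a b. a \<in> v m \<and> b \<in> w m}),
     vzero = (\<lambda>m. V_lt N z m),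
     vscale = (\<lambda>c v m. {cscale c a + u | a u. a \<in> v m \<and> u \<in> V_lt N z m}),
     vact = (\<lambda>x v m. {current_act N z x 0 a + u | a u. a \<in> v m \<and> u \<in> V_lt N z m}),
     ip = B,
     deg = (\<lambda>m. {v \<in> fusion_carr N z. \<forall>k. k \<noteq> m \<longrightarrow> v k = V_lt N z k})\<rparr>"


section \<open>Standard Young tableaux\<close>

text \<open>A tableau is the list of its rows, from top to bottom (English convention).\<close>

type_synonym tableau = "nat list list"

definition syt :: "nat list \<Rightarrow> tableau set" where
  "syt sh = {\<tau>. map length \<tau> = sh \<and>
     distinct (concat \<tau>) \<and> set (concat \<tau>) = {1..sum_list sh} \<and>
     (\<forall>row\<in>set \<tau>. sorted_wrt (<) row) \<and>
     (\<forall>r c. Suc r < length \<tau> \<and> c < length (\<tau> ! Suc r) \<longrightarrow> \<tau> ! r ! c < \<tau> ! Suc r ! c)}"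

text \<open>The cell (row, column) containing the entry \<open>i\<close>.\<close>

definition cell :: "tableau \<Rightarrow> nat \<Rightarrow> nat \<times> nat" where
  "cell \<tau> i = (THE p. fst p < length \<tau> \<and> snd p < length (\<tau> ! fst p) \<and> \<tau> ! fst p ! snd p = i)"

definition descents :: "tableau \<Rightarrow> nat set" where
  "descents \<tau> = {i \<in> {1..<length (concat \<tau>)}. fst (cell \<tau> (i + 1)) > fst (cell \<tau> i)}"

definition maj :: "tableau \<Rightarrow> nat" where
  "maj \<tau> = \<Sum>(descents \<tau>)"

text \<open>The shape \<open>(n+k, n-k)\<close>; for \<open>k = n\<close> the second row is present but empty.\<close>

abbreviation syt2 :: "nat \<Rightarrow> nat \<Rightarrow> tableau set" where
  "syt2 n k \<equiv> syt [n + k, n - k]"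

definition tab :: "tableau \<Rightarrow> tableau \<Rightarrow> complex" where
  "tab \<tau> = (\<lambda>\<sigma>. if \<sigma> = \<tau> then 1 else 0)"

text \<open>The difference of the contents (column minus row) of the cells containing \<open>i+1\<close> and \<open>i\<close>.\<close>

definition axial :: "tableau \<Rightarrow> nat \<Rightarrow> int" where
  "axial \<tau> i = (int (snd (cell \<tau> (i + 1))) - int (fst (cell \<tau> (i + 1))))
             - (int (snd (cell \<tau> i)) - int (fst (cell \<tau> i)))"

text \<open>
  Young's orthogonal form: the adjacent transposition \<open>s_i\<close> maps the basis vector \<open>\<tau>\<close> to
  \<open>(1/r) \<tau> + sqrt (1 - 1/r^2) (s_i \<tau>)\<close> with \<open>r = axial \<tau> i\<close>.
  If \<open>s_i \<tau>\<close> is not standard then \<open>r\<close> is \<open>1\<close> or \<open>-1\<close> and the second term vanishes.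
  The formula below gives the coefficient of the image of \<open>w\<close> at \<open>\<tau>\<close>, using
  \<open>axial (s_i \<tau>) i = - axial \<tau> i\<close>.
\<close>

definition young :: "nat \<Rightarrow> (tableau \<Rightarrow> complex) \<Rightarrow> tableau \<Rightarrow> complex" where
  "young i w = (\<lambda>\<tau>. of_real (1 / real_of_int (axial \<tau> i)) * w \<tau>
     + of_real (sqrt (1 - 1 / (real_of_int (axial \<tau> i))\<^sup>2))
         * w (map (map (Transposition.transpose i (i + 1))) \<tau>))"


section \<open>The space \<open>\<X>\<close>\<close>

text \<open>
  The direct sum over \<open>k \<le> n\<close> of \<open>M_(2k+1) \<otimes> \<pi>_k\<close>: the value of \<open>g\<close> at \<open>(k, j, \<tau>)\<close> is the
  coordinate at \<open>w_j \<otimes> \<tau>\<close> in the summand number \<open>k\<close>.  Both \<open>(w_j)\<close> and the tableaux are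
  orthonormal bases.
\<close>

type_synonym xvec = "nat \<times> nat \<times> tableau \<Rightarrow> complex"

definition X_index :: "nat \<Rightarrow> (nat \<times> nat \<times> tableau) set" where
  "X_index n = {(k, j, \<tau>). k \<le> n \<and> j < 2 * k + 1 \<and> \<tau> \<in> syt2 n k}"

definition pure :: "nat \<Rightarrow> (nat \<Rightarrow> complex) \<Rightarrow> (tableau \<Rightarrow> complex) \<Rightarrow> xvec" where
  "pure k u w = (\<lambda>(k', j, \<tau>). if k' = k then u j * w \<tau> else 0)"

definition X_space :: "nat \<Rightarrow> xvec graded_rep" where
  "X_space n = \<lparr>
     carr = {g. \<forall>p. p \<notin> X_index n \<longrightarrow> g p = 0},
     vadd = (+), vzero = 0, vscale = cscale,
     vact = (\<lambda>x g (k, j, \<tau>). irrep_act (2 * k + 1) x (\<lambda>j'. g (k, j', \<tau>)) j),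
     ip = (\<lambda>g h. \<Sum>p\<in>X_index n. g p * cnj (h p)),
     deg = (\<lambda>m. cfun.span {pure k u (tab \<tau>) | k u \<tau>.
              k \<le> n \<and> u \<in> carr (irrep (2 * k + 1)) \<and> \<tau> \<in> syt2 n k \<and> maj \<tau> = m})\<rparr>"

definition X_perm :: "nat \<Rightarrow> xvec \<Rightarrow> xvec" where
  "X_perm i g = (\<lambda>(k, j, \<tau>). young i (\<lambda>\<sigma>. g (k, j, \<sigma>)) \<tau>)"

text \<open>
  The tensor power of order \<open>2n\<close>, with the grading transported along a linear map \<open>\<Phi>\<close> from the
  direct sum.  A Schur--Weyl identification is such a \<open>\<Phi>\<close> which is a unitary isomorphism of
  representations of sl2 and of the symmetric group.
\<close>

definition X_tensor :: "nat \<Rightarrow> (xvec \<Rightarrow> tensor) \<Rightarrow> tensor graded_rep" where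
  "X_tensor n \<Phi> = \<lparr>
     carr = tensors (2 * n), vadd = (+), vzero = 0, vscale = cscale,
     vact = tensor_act (2 * n) (\<lambda>_. 1),
     ip = tensor_ip (2 * n),
     deg = (\<lambda>m. \<Phi> ` deg (X_space n) m)\<rparr>"

definition schur_weyl :: "nat \<Rightarrow> (xvec \<Rightarrow> tensor) \<Rightarrow> bool" where
  "schur_weyl n \<Phi> \<longleftrightarrow>
     unitary_iso (X_space n) (X_tensor n \<Phi>) \<Phi> \<and>
     (\<forall>i\<in>{1..<2 * n}. \<forall>g\<in>carr (X_space n). \<Phi> (X_perm i g) = tensor_swap i (\<Phi> g))"

end

theory Submission
  imports Defs "HOL-Computational_Algebra.Polynomial"
begin

text \<open>
  The theorem is a comparison of graded dimensions.  Each homogeneous part of the fusion product is a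
  representation of sl2, unitary for the given form, and different degrees are orthogonal.  A
  finite-dimensional unitary representation has an orthonormal basis on which sl2 acts by the formulas
  that define the irreducible representations, and the number of irreducible summands of each
  dimension is a difference of dimensions of neighbouring weight spaces.  Therefore a graded unitary
  isomorphism exists as soon as, for all \<open>k\<close> and \<open>m\<close>, the multiplicity of \<open>M_(2k+1)\<close> in degree \<open>m\<close>
  is the number of standard tableaux of shape \<open>(n+k, n-k)\<close> with major index \<open>m\<close>.

  \<^bold>\<open>Weight spaces.\<close>  Let \<open>N = 2n\<close>.  In coordinates, \<open>e_(i_1) \<dots> e_(i_l)\<close> applied to the lowest weight
  vector is a function on the \<open>l\<close>-element subsets \<open>S\<close> of \<open>{0, \<dots>, N-1}\<close>, namely the symmetrization of
  the monomial with exponents \<open>i_1, \<dots>, i_l\<close>, evaluated at the \<open>z_j\<close> with \<open>j \<in> S\<close> (\<open>fvec_eq_tens\<close>).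
  So the weight spaces of the filtration consist of the functions on \<open>l\<close>-subsets that come from symmetric
  polynomials of bounded degree.  Their dimensions are bounded from below by an explicit family
  of symmetric polynomials, built by induction on \<open>N\<close> along the q-Pascal recursion
  (\<open>sympoly_spanning_family\<close>).  They are bounded from above by multiplying with the Vandermonde
  determinant: this embeds symmetric polynomials into alternating ones, and the exponents of an alternating
  monomial can be reduced below \<open>N\<close>, sorted and assumed distinct (\<open>sympoly_on_level_upper\<close>).  Both bounds
  count the \<open>l\<close>-subsets of \<open>{0, \<dots>, N-1}\<close> by their sum, so the graded dimension of the weight space is
  the Gaussian binomial coefficient of \<open>N\<close> over \<open>l\<close> (\<open>level_space_basis\<close>).

  \<^bold>\<open>Representations.\<close>  The form on a homogeneous part is studied through the semi-inner product that it induces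
  on representatives; the radical is the previous step of the filtration.  Vectors killed by \<open>f\<close>
  modulo the radical are exactly those orthogonal to the image of \<open>e\<close>.  Raising an orthonormal basis of these
  primitive vectors by \<open>e\<close> gives an adapted orthonormal basis (\<open>adapted_basis\<close>); its
  completeness rests only on positivity and on \<open>[e, f] = h\<close>.

  \<^bold>\<open>Tableaux.\<close>  Removing the largest entry of a tableau with two rows gives recursions for the generating
  function of the major index, which therefore is the difference of two neighbouring Gaussian binomial
  coefficients (\<open>gen_maj_two_rows\<close>).

  The isomorphism takes a vector to its coordinates in the adapted basis.  Schur's lemma
  (\<open>schur_X_space\<close>) then describes the multiplicity spaces, and a Schur--Weyl identification is applied
  by composition.
\<close>

section \<open>Two-rowed tableaux and Gaussian binomial coefficients\<close>

abbreviation xpow :: "nat \<Rightarrow> int poly" where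
  "xpow i \<equiv> monom 1 i"

lemma xpow_add: "xpow (i + j) = xpow i * xpow j"
  by (simp add: mult_monom)

text \<open>
  The Gaussian binomial coefficient of \<open>a + b\<close> over \<open>b\<close>.  Arranging it by \<open>a\<close> and \<open>b\<close> makes the
  symmetry visible and fits shapes \<open>(a, b)\<close> of tableaux.
\<close>

fun qbin :: "nat \<Rightarrow> nat \<Rightarrow> int poly" where
  "qbin 0 b = 1"
| "qbin (Suc a) 0 = 1"
| "qbin (Suc a) (Suc b) = qbin a (Suc b) + xpow (Suc a) * qbin (Suc a) b"

lemma qbin_0 [simp]: "qbin a 0 = 1"
  by (cases a) auto

lemma xpow_0 [simp]: "xpow 0 = 1"
  by (simp add: monom_0)

lemma qbin_Suc_0_pascal: "qbin (Suc 0) (Suc b) = xpow (Suc b) + qbin (Suc 0) b"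
proof (induction b)
  case (Suc b)
  have "qbin (Suc 0) (Suc (Suc b)) = 1 + xpow (Suc 0) * qbin (Suc 0) (Suc b)"
    by (simp only: qbin.simps)
  also have "\<dots> = xpow (Suc 0) * xpow (Suc b) + (1 + xpow (Suc 0) * qbin (Suc 0) b)"
    unfolding Suc by (simp only: algebra_simps)
  also have "\<dots> = xpow (Suc (Suc b)) + qbin (Suc 0) (Suc b)"
    by (simp add: mult_monom)
  finally show ?case .
qed simp

lemma qbin_1_pascal: "qbin (Suc a) (Suc 0) = xpow (Suc 0) * qbin a (Suc 0) + 1"
proof (induction a)
  case (Suc a)
  have "qbin (Suc (Suc a)) (Suc 0) = qbin (Suc a) (Suc 0) + xpow (Suc (Suc a))"
    by (simp only: qbin.simps mult_1_right)
  also have "\<dots> = xpow (Suc 0) * (qbin a (Suc 0) + xpow (Suc a)) + 1"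
    unfolding Suc by (simp add: mult_monom distrib_left)
  also have "qbin a (Suc 0) + xpow (Suc a) = qbin (Suc a) (Suc 0)"
    by (simp only: qbin.simps mult_1_right)
  finally show ?case .
qed simp

text \<open>
  The definition splits off the largest element of a subset, this recursion the smallest one.  The
  two together give the symmetry and the recursion for tableaux.  In the induction both terms of
  the definition are expanded once more, and their expansions share \<open>qbin a b\<close>.
\<close>

lemma qbin_pascal':
  "qbin (Suc a) (Suc b) = xpow (Suc b) * qbin a (Suc b) + qbin (Suc a) b"
proof (induction "a + b" arbitrary: a b rule: less_induct)
  case less
  show ?case
  proof (cases a)
    case 0
    then show ?thesis using qbin_Suc_0_pascal[of b] by simp
  next
    case (Suc a')
    show ?thesis
    proof (cases b)
      case 0
      then show ?thesis using qbin_1_pascal[of a] by (simp only: qbin_0)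
    next
      case (Suc b')
      have 1: "qbin a (Suc b) = xpow (Suc b) * qbin a' (Suc b) + qbin a b"
        unfolding \<open>a = Suc a'\<close> by (rule less) (simp add: \<open>a = Suc a'\<close>)
      have 2: "qbin (Suc a) b = xpow b * qbin a b + qbin (Suc a) b'"
        unfolding \<open>b = Suc b'\<close> by (rule less) (simp add: \<open>b = Suc b'\<close>)
      have 3: "qbin (Suc a) (Suc b) = qbin a (Suc b) + xpow (Suc a) * qbin (Suc a) b"
        by (rule qbin.simps)
      have 4: "qbin a (Suc b) = qbin a' (Suc b) + xpow a * qbin a b"
        unfolding \<open>a = Suc a'\<close> by (rule qbin.simps)
      have 5: "qbin (Suc a) b = qbin a b + xpow (Suc a) * qbin (Suc a) b'"
        unfolding \<open>b = Suc b'\<close> by (rule qbin.simps)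
      have 6: "xpow (Suc a) * xpow b = xpow (Suc b) * xpow a"
        unfolding xpow_add[symmetric] by (simp add: add.commute)
      have alg: "A + x * B = y * D + B" if "D = E + u * F" "B = F + x * C"
          "A = y * E + F" "B = v * F + C" "x * v = y * u"
        for A B C D E F x y u v :: "int poly"
      proof -
        have "A + x * B = (y * E + F) + x * (v * F + C)"
          using that(3,4) by argo
        also have "\<dots> = y * E + F + (x * v) * F + x * C"
          by (simp add: algebra_simps)
        also have "\<dots> = y * (E + u * F) + (F + x * C)"
          unfolding that(5) by (simp add: algebra_simps)
        also have "\<dots> = y * D + B"
          unfolding that(1) using that(2) by argo
        finally show ?thesis .
      qed
      show ?thesis
        unfolding 3 by (rule alg[OF 4 5 1 2 6])
    qed
  qed
qed

lemma qbin_sym: "qbin a b = qbin b a"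
proof (induction "a + b" arbitrary: a b rule: less_induct)
  case less
  show ?case
  proof (cases a; cases b)
    fix a' b' assume *: "a = Suc a'" "b = Suc b'"
    have "qbin b a = xpow (Suc a') * qbin b' (Suc a') + qbin (Suc b') a'"
      using qbin_pascal'[of b' a'] * by simp
    also have "\<dots> = xpow (Suc a') * qbin (Suc a') b' + qbin a' (Suc b')"
      using less[of b' "Suc a'"] less[of "Suc b'" a'] * by simp
    finally show ?thesis using * by simp
  qed auto
qed

definition nsubsets :: "nat \<Rightarrow> nat \<Rightarrow> nat set set" where
  "nsubsets N l = {\<mu>. \<mu> \<subseteq> {..<N} \<and> card \<mu> = l}"

lemma finite_nsubsets [simp, intro]: "finite (nsubsets N l)"
  by (rule finite_subset[of _ "Pow {..<N}"]) (auto simp: nsubsets_def)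

lemma nsubsets_finite: "\<mu> \<in> nsubsets N l \<Longrightarrow> finite \<mu>"
  by (auto simp: nsubsets_def intro: finite_subset)

lemma nsubsets_0 [simp]: "nsubsets N 0 = {{}}"
  by (auto simp: nsubsets_def dest: finite_subset)

lemma nsubsets_Suc:
  "nsubsets (Suc N) (Suc l) = nsubsets N (Suc l) \<union> insert N ` nsubsets N l"
proof (intro equalityI subsetI)
  fix \<mu> assume "\<mu> \<in> nsubsets (Suc N) (Suc l)"
  then have \<mu>: "\<mu> \<subseteq> {..<Suc N}" "card \<mu> = Suc l" by (auto simp: nsubsets_def)
  then have fin: "finite \<mu>" using finite_subset by blast
  show "\<mu> \<in> nsubsets N (Suc l) \<union> insert N ` nsubsets N l"
  proof (cases "N \<in> \<mu>")
    case True
    then have "\<mu> - {N} \<in> nsubsets N l" using \<mu> fin by (auto simp: nsubsets_def less_Suc_eq)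
    moreover have "\<mu> = insert N (\<mu> - {N})" using True by auto
    ultimately show ?thesis by blast
  next
    case False
    then show ?thesis using \<mu> by (auto simp: nsubsets_def less_Suc_eq)
  qed
next
  fix \<mu> assume "\<mu> \<in> nsubsets N (Suc l) \<union> insert N ` nsubsets N l"
  then show "\<mu> \<in> nsubsets (Suc N) (Suc l)"
  proof
    assume "\<mu> \<in> insert N ` nsubsets N l"
    then obtain \<nu> where \<nu>: "\<mu> = insert N \<nu>" "\<nu> \<in> nsubsets N l" by auto
    then have "N \<notin> \<nu>" "finite \<nu>" by (auto simp: nsubsets_def intro: finite_subset)
    then show ?thesis using \<nu> by (auto simp: nsubsets_def)
  qed (auto simp: nsubsets_def)
qed

lemma nsubsets_gt [simp]: "N < l \<Longrightarrow> nsubsets N l = {}"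
  by (auto simp: nsubsets_def) (metis card_lessThan card_mono finite_lessThan leD)

lemma nsubsets_self: "nsubsets N N = {{..<N}}"
  using card_subset_eq[of "{..<N}"] by (auto simp: nsubsets_def)

text \<open>
  The least possible sum of \<open>b\<close> distinct numbers is \<open>b choose 2\<close>, which accounts for the factor in
  front of the Gaussian binomial coefficient.
\<close>

lemma sum_xpow_nsubsets:
  "(\<Sum>\<mu>\<in>nsubsets (a + b) b. xpow (\<Sum>\<mu>)) = xpow (b choose 2) * qbin a b"
proof (induction a b rule: qbin.induct)
  case (1 b)
  have "\<Sum>{..<b} = b choose 2"
    by (induction b) (simp_all add: numeral_2_eq_2 lessThan_Suc)
  then show ?case by (simp add: nsubsets_self)
next
  case (2 a)
  then show ?case by (simp add: numeral_2_eq_2)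
next
  case (3 a b)
  let ?N = "a + Suc b"
  have *: "(\<Sum>\<mu>\<in>insert ?N ` nsubsets ?N b. xpow (\<Sum>\<mu>))
      = (\<Sum>\<mu>\<in>nsubsets ?N b. xpow ?N * xpow (\<Sum>\<mu>))"
  proof (subst sum.reindex)
    show "inj_on (insert ?N) (nsubsets ?N b)"
    proof (rule inj_onI)
      fix \<mu> \<nu> assume "\<mu> \<in> nsubsets ?N b" "\<nu> \<in> nsubsets ?N b" "insert ?N \<mu> = insert ?N \<nu>"
      moreover from this have "?N \<notin> \<mu>" "?N \<notin> \<nu>" by (auto simp: nsubsets_def)
      ultimately show "\<mu> = \<nu>" by (metis insert_ident)
    qed
    show "sum ((\<lambda>\<mu>. xpow (\<Sum> \<mu>)) \<circ> insert ?N) (nsubsets ?N b) = (\<Sum>\<mu>\<in>nsubsets ?N b. xpow ?N * xpow (\<Sum>\<mu>))"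
    proof (intro sum.cong refl, simp only: o_def)
      fix \<mu> assume \<mu>: "\<mu> \<in> nsubsets ?N b"
      then have "?N \<notin> \<mu>" "finite \<mu>" by (auto simp: nsubsets_def intro: finite_subset)
      then show "xpow (\<Sum> (insert ?N \<mu>)) = xpow ?N * xpow (\<Sum> \<mu>)"
        by (simp add: mult_monom)
    qed
  qed
  have "(\<Sum>\<mu>\<in>nsubsets (Suc a + Suc b) (Suc b). xpow (\<Sum>\<mu>))
     = (\<Sum>\<mu>\<in>nsubsets ?N (Suc b). xpow (\<Sum>\<mu>)) + (\<Sum>\<mu>\<in>insert ?N ` nsubsets ?N b. xpow (\<Sum>\<mu>))"
  proof -
    have "nsubsets (Suc a + Suc b) (Suc b) = nsubsets ?N (Suc b) \<union> insert ?N ` nsubsets ?N b"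
      using nsubsets_Suc[of ?N b] by simp
    moreover have "nsubsets ?N (Suc b) \<inter> insert ?N ` nsubsets ?N b = {}"
      by (auto simp: nsubsets_def)
    ultimately show ?thesis by (simp add: sum.union_disjoint)
  qed
  also have "\<dots> = xpow (Suc b choose 2) * qbin a (Suc b) + xpow ?N * (xpow (b choose 2) * qbin (Suc a) b)"
    using 3 unfolding * by (simp flip: sum_distrib_left)
  also have "xpow ?N * (xpow (b choose 2) * qbin (Suc a) b)
      = xpow (Suc b choose 2) * (xpow (Suc a) * qbin (Suc a) b)"
  proof -
    have "?N + (b choose 2) = (Suc b choose 2) + Suc a" by (simp add: numeral_2_eq_2)
    then show ?thesis by (metis xpow_add mult.assoc)
  qed
  finally show ?case by (simp add: algebra_simps)
qed

lemma coeff_sum_xpow: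
  assumes "finite A"
  shows "coeff (\<Sum>x\<in>A. xpow (h x)) m = int (card {x \<in> A. h x = m})"
proof -
  have "coeff (\<Sum>x\<in>A. xpow (h x)) m = (\<Sum>x\<in>A. if h x = m then 1 else 0)"
    by (simp add: coeff_sum)
  also have "\<dots> = int (card {x \<in> A. h x = m})"
    using assms by (simp add: sum.If_cases Int_def)
  finally show ?thesis .
qed

lemma card_nsubsets_qbin:
  "int (card {\<mu> \<in> nsubsets (a + b) b. \<Sum>\<mu> = m + (b choose 2)}) = coeff (qbin a b) m"
proof -
  have "int (card {\<mu> \<in> nsubsets (a + b) b. \<Sum>\<mu> = m + (b choose 2)})
      = coeff (xpow (b choose 2) * qbin a b) (m + (b choose 2))"
    unfolding sum_xpow_nsubsets[symmetric] by (subst coeff_sum_xpow) auto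
  then show ?thesis by (simp add: coeff_monom_mult)
qed


lemma syt_pair_iff:
  "[r, s] \<in> syt [a, b] \<longleftrightarrow> length r = a \<and> length s = b \<and> distinct (r @ s) \<and>
     set r \<union> set s = {1..a + b} \<and> sorted_wrt (<) r \<and> sorted_wrt (<) s \<and> (\<forall>c<b. r ! c < s ! c)"
  by (auto simp: syt_def)

lemma syt_pairE:
  assumes "\<tau> \<in> syt [a, b]"
  obtains r s where "\<tau> = [r, s]" "[r, s] \<in> syt [a, b]"
proof -
  have "map length \<tau> = [a, b]" using assms by (simp add: syt_def)
  then obtain r s where "\<tau> = [r, s]" by (auto simp: map_eq_Cons_conv)
  then show thesis using that assms by blast
qed

lemma syt_pair_eq: "\<tau> \<in> syt [a, b] \<Longrightarrow> [\<tau> ! 0, \<tau> ! 1] = \<tau>"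
  by (erule syt_pairE) simp

lemma finite_syt_pair [simp, intro]: "finite (syt [a, b])"
proof (rule finite_subset)
  let ?L = "{xs. set xs \<subseteq> {1..a + b} \<and> length xs \<le> a + b}"
  show "syt [a, b] \<subseteq> (\<lambda>(r, s). [r, s]) ` (?L \<times> ?L)"
  proof
    fix \<tau> assume "\<tau> \<in> syt [a, b]"
    then obtain r s where \<tau>: "\<tau> = [r, s]" and rs: "[r, s] \<in> syt [a, b]" by (rule syt_pairE)
    have "set r \<union> set s = {1..a + b}" "length r = a" "length s = b"
      using rs unfolding syt_pair_iff by auto
    then have "(r, s) \<in> ?L \<times> ?L" by auto
    then show "\<tau> \<in> (\<lambda>(r, s). [r, s]) ` (?L \<times> ?L)" unfolding \<tau> by force
  qed
  show "finite ((\<lambda>(r, s). [r, s]) ` (?L \<times> ?L))"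
    by (intro finite_imageI finite_cartesian_product finite_lists_length_le) auto
qed

text \<open>
  The unique description behind the choice in \<open>cell\<close> is met as the entries are distinct.
\<close>

lemma fst_cell_pair:
  assumes "distinct (r @ s)" "x \<in> set r \<union> set s"
  shows "fst (cell [r, s] x) = (if x \<in> set s then 1 else 0)"
proof -
  define i :: nat where ic1: "i = (if x \<in> set s then 1 else 0)"
  have "x \<in> set ([r, s] ! i)" using assms(2) by (auto simp: ic1)
  then obtain c where "c < length ([r, s] ! i)" "[r, s] ! i ! c = x"
    by (metis in_set_conv_nth)
  note ic = ic1 this
  have "cell [r, s] x = (i, c)"
    unfolding cell_def
  proof (rule the_equality)
    show "fst (i, c) < length [r, s] \<and> snd (i, c) < length ([r, s] ! fst (i, c))
        \<and> [r, s] ! fst (i, c) ! snd (i, c) = x"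
      using ic by auto
  next
    fix p assume p: "fst p < length [r, s] \<and> snd p < length ([r, s] ! fst p) \<and> [r, s] ! fst p ! snd p = x"
    then have "x \<in> set ([r, s] ! fst p)" by auto
    moreover have "fst p = 0 \<or> fst p = 1" using p by auto
    ultimately have "fst p = i" using ic(1) assms(1) by auto
    moreover have "distinct ([r, s] ! i)" using assms(1) ic(1) by auto
    ultimately show "p = (i, c)"
      using p ic(2,3) by (metis nth_eq_iff_index_eq prod.collapse)
  qed
  then show ?thesis using ic by simp
qed

text \<open>
  With two rows, \<open>i + 1\<close> lies lower than \<open>i\<close> only if \<open>i\<close> is on top and \<open>i + 1\<close> below.
\<close>

lemma descents_pair:
  assumes "[r, s] \<in> syt [a, b]"
  shows "descents [r, s] = {i. i \<in> set r \<and> Suc i \<in> set s}"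
proof -
  have *: "distinct (r @ s)" "set r \<union> set s = {1..a + b}" "length r + length s = a + b"
    using assms by (auto simp: syt_pair_iff)
  show ?thesis
  proof (intro equalityI subsetI)
    fix i assume "i \<in> descents [r, s]"
    then have i: "i \<in> {1..<a + b}" "fst (cell [r, s] (i + 1)) > fst (cell [r, s] i)"
      using * by (auto simp: descents_def)
    then have "i \<in> set r \<union> set s" "i + 1 \<in> set r \<union> set s" using *(2) by auto
    then show "i \<in> {i. i \<in> set r \<and> Suc i \<in> set s}"
      using i(2) fst_cell_pair[OF *(1)] by (auto split: if_splits)
  next
    fix i assume "i \<in> {i. i \<in> set r \<and> Suc i \<in> set s}"
    then have i: "i \<in> set r" "Suc i \<in> set s" by auto
    then have "i \<in> {1..a+b}" "Suc i \<in> {1..a+b}" using *(2) by blast+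
    moreover have "i \<notin> set s" using i *(1) by auto
    ultimately show "i \<in> descents [r, s]"
      using i fst_cell_pair[OF *(1), of i] fst_cell_pair[OF *(1), of "i + 1"] *(3)
      by (auto simp: descents_def)
  qed
qed

lemma sorted_wrt_less_last:
  assumes "sorted_wrt (<) (xs :: nat list)" "m \<in> set xs" "\<forall>x\<in>set xs. x \<le> m"
  shows "\<exists>ys. xs = ys @ [m]"
proof -
  obtain ys y where xs: "xs = ys @ [y]" using assms(2) by (cases xs rule: rev_cases) auto
  then have "y = m" using assms by (auto simp: sorted_wrt_append)
  then show ?thesis using xs by blast
qed

text \<open>
  The tableaux are sorted by the row of their largest entry \<open>a + b\<close>.  In the empty shape there is no
  such entry, so both sets are empty for it.
\<close>

definition top_row :: "nat \<Rightarrow> nat \<Rightarrow> tableau set" where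
  "top_row a b = {\<tau> \<in> syt [a, b]. a + b \<in> set (\<tau> ! 0)}"

definition bot_row :: "nat \<Rightarrow> nat \<Rightarrow> tableau set" where
  "bot_row a b = {\<tau> \<in> syt [a, b]. a + b \<in> set (\<tau> ! 1)}"

lemma syt_split:
  assumes "a + b > 0"
  shows "syt [a, b] = top_row a b \<union> bot_row a b" "top_row a b \<inter> bot_row a b = {}"
proof -
  have "(a + b \<in> set (\<tau> ! 0)) \<noteq> (a + b \<in> set (\<tau> ! 1))" if \<tau>': "\<tau> \<in> syt [a, b]" for \<tau>
  proof -
    obtain r s where \<tau>: "\<tau> = [r, s]" and rs: "[r, s] \<in> syt [a, b]" using \<tau>' by (rule syt_pairE)
    have "set r \<union> set s = {1..a + b}" "set r \<inter> set s = {}" using rs by (auto simp: syt_pair_iff)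
    moreover have "a + b \<in> {1..a + b}" using assms by auto
    ultimately show ?thesis unfolding \<tau> by auto
  qed
  then show "syt [a, b] = top_row a b \<union> bot_row a b" "top_row a b \<inter> bot_row a b = {}"
    by (auto simp: top_row_def bot_row_def)
qed

definition add_top :: "nat \<Rightarrow> tableau \<Rightarrow> tableau" where
  "add_top m \<tau> = [\<tau> ! 0 @ [m], \<tau> ! 1]"

definition add_bot :: "nat \<Rightarrow> tableau \<Rightarrow> tableau" where
  "add_bot m \<tau> = [\<tau> ! 0, \<tau> ! 1 @ [m]]"

lemma insert_eq_iff_fresh:
  assumes "x \<notin> B"
  shows "insert x A = insert x B \<and> x \<notin> A \<longleftrightarrow> A = B"
  using assms by (metis insert_ident)

text \<open>
  The largest entry can be put at the end of the upper row: as \<open>b \<le> a\<close>, no cell lies below the new one.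
\<close>

lemma add_top_syt_iff:
  assumes "b \<le> a"
  shows "[r @ [Suc (a + b)], s] \<in> syt [Suc a, b] \<longleftrightarrow> [r, s] \<in> syt [a, b]"
proof (cases "length r = a \<and> length s = b \<and> set r \<union> set s = {1..a + b}")
  let ?m = "Suc (a + b)"
  case False
  have "set r \<union> set s = {1..a + b}" if "distinct (r @ [?m] @ s)" "set (r @ [?m]) \<union> set (s) = {1..?m}"
  proof -
    have "insert ?m (set r \<union> set s) = set (r @ [?m]) \<union> set (s)" by auto
    then have "insert ?m (set r \<union> set s) = insert ?m {1..a + b}"
      unfolding that(2) by (simp add: atLeastAtMostSuc_conv)
    moreover have "?m \<notin> set r \<union> set s" using that(1) by auto
    ultimately show ?thesis using insert_eq_iff_fresh[of ?m "{1..a + b}" "set r \<union> set s"] by simp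
  qed
  then show ?thesis using False unfolding syt_pair_iff by auto
next
  let ?m = "Suc (a + b)"
  case True
  then have len: "length r = a" "length s = b" and un: "set r \<union> set s = {1..a + b}" by auto
  have le: "x < ?m" if "x \<in> set r \<union> set s" for x
    using that unfolding un by simp
  then have fresh: "?m \<notin> set r" "?m \<notin> set s" by blast+
  have sorted: "sorted_wrt (<) (r @ [?m]) \<longleftrightarrow> sorted_wrt (<) r"
    using le by (simp add: sorted_wrt_append)
  have un': "set (r @ [?m]) \<union> set (s) = {1..Suc a + b}"
  proof -
    have "set (r @ [?m]) \<union> set (s) = insert ?m {1..a + b}" unfolding un[symmetric] by auto
    then show ?thesis by (simp add: atLeastAtMostSuc_conv)
  qed
  have dist: "distinct ((r @ [?m]) @ (s)) \<longleftrightarrow> distinct (r @ s)"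
    using fresh by auto
  have "(r @ [?m]) ! c < s ! c \<longleftrightarrow> r ! c < s ! c" if "c < b" for c
    using that assms len by (simp add: nth_append)
  then have col: "(\<forall>c<b. (r @ [?m]) ! c < s ! c) \<longleftrightarrow> (\<forall>c<b. r ! c < s ! c)" by simp
  show ?thesis
    unfolding syt_pair_iff sorted un' dist col using len un by simp
qed

text \<open>
  The lower row can be prolonged only as long as it stays at most as long as the upper one; the entry
  above the new cell is automatically smaller.
\<close>

lemma add_bot_syt_iff:
  assumes "Suc b \<le> a"
  shows "[r, s @ [Suc (a + b)]] \<in> syt [a, Suc b] \<longleftrightarrow> [r, s] \<in> syt [a, b]"
proof (cases "length r = a \<and> length s = b \<and> set r \<union> set s = {1..a + b}")
  let ?m = "Suc (a + b)"
  case False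
  have "set r \<union> set s = {1..a + b}" if "distinct (r @ s @ [?m])" "set (r) \<union> set (s @ [?m]) = {1..?m}"
  proof -
    have "insert ?m (set r \<union> set s) = set (r) \<union> set (s @ [?m])" by auto
    then have "insert ?m (set r \<union> set s) = insert ?m {1..a + b}"
      unfolding that(2) by (simp add: atLeastAtMostSuc_conv)
    moreover have "?m \<notin> set r \<union> set s" using that(1) by auto
    ultimately show ?thesis using insert_eq_iff_fresh[of ?m "{1..a + b}" "set r \<union> set s"] by simp
  qed
  then show ?thesis using False unfolding syt_pair_iff by auto
next
  let ?m = "Suc (a + b)"
  case True
  then have len: "length r = a" "length s = b" and un: "set r \<union> set s = {1..a + b}" by auto
  have le: "x < ?m" if "x \<in> set r \<union> set s" for x
    using that unfolding un by simp
  then have fresh: "?m \<notin> set r" "?m \<notin> set s" by blast+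
  have sorted: "sorted_wrt (<) (s @ [?m]) \<longleftrightarrow> sorted_wrt (<) s"
    using le by (simp add: sorted_wrt_append)
  have un': "set (r) \<union> set (s @ [?m]) = {1..a + Suc b}"
  proof -
    have "set (r) \<union> set (s @ [?m]) = insert ?m {1..a + b}" unfolding un[symmetric] by auto
    then show ?thesis by (simp add: atLeastAtMostSuc_conv)
  qed
  have dist: "distinct ((r) @ (s @ [?m])) \<longleftrightarrow> distinct (r @ s)"
    using fresh by auto
  have "r ! b \<in> {1..a + b}" using len assms un nth_mem[of b r] by auto
  then have "r ! c < (s @ [?m]) ! c \<longleftrightarrow> (c < b \<longrightarrow> r ! c < s ! c)" if "c < Suc b" for c
    using that len by (auto simp: nth_append less_Suc_eq)
  then have col: "(\<forall>c<Suc b. r ! c < (s @ [?m]) ! c) \<longleftrightarrow> (\<forall>c<b. r ! c < s ! c)"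
    using less_SucI by blast
  show ?thesis
    unfolding syt_pair_iff sorted un' dist col using len un by simp
qed

lemma top_row_Suc:
  assumes "b \<le> a"
  shows "top_row (Suc a) b = add_top (Suc (a + b)) ` syt [a, b]"
proof (intro equalityI subsetI)
  fix \<tau> assume \<tau>': "\<tau> \<in> top_row (Suc a) b"
  then have "\<tau> \<in> syt [Suc a, b]" by (simp add: top_row_def)
  then obtain r s where \<tau>: "\<tau> = [r, s]" and rs: "[r, s] \<in> syt [Suc a, b]" by (rule syt_pairE)
  have "Suc (a + b) \<in> set r" using \<tau>' \<tau> by (simp add: top_row_def)
  moreover have "sorted_wrt (<) r" "\<forall>x\<in>set r. x \<le> Suc (a + b)"
    using rs by (auto simp: syt_pair_iff)
  ultimately obtain r' where r: "r = r' @ [Suc (a + b)]"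
    using sorted_wrt_less_last[of r "Suc (a + b)"] by blast
  then have "[r', s] \<in> syt [a, b]" using rs add_top_syt_iff[OF assms] by simp
  then show "\<tau> \<in> add_top (Suc (a + b)) ` syt [a, b]"
    unfolding \<tau> r by (force simp: add_top_def)
next
  fix \<tau> assume "\<tau> \<in> add_top (Suc (a + b)) ` syt [a, b]"
  then obtain r s where "\<tau> = [r @ [Suc (a + b)], s]" and rs: "[r, s] \<in> syt [a, b]"
    using syt_pair_eq unfolding add_top_def by fastforce
  then show "\<tau> \<in> top_row (Suc a) b" using add_top_syt_iff[OF assms] by (auto simp: top_row_def)
qed

lemma bot_row_Suc:
  assumes "Suc b \<le> a"
  shows "bot_row a (Suc b) = add_bot (Suc (a + b)) ` syt [a, b]"
proof (intro equalityI subsetI)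
  fix \<tau> assume \<tau>': "\<tau> \<in> bot_row a (Suc b)"
  then have "\<tau> \<in> syt [a, Suc b]" by (simp add: bot_row_def)
  then obtain r s where \<tau>: "\<tau> = [r, s]" and rs: "[r, s] \<in> syt [a, Suc b]" by (rule syt_pairE)
  have "Suc (a + b) \<in> set s" using \<tau>' \<tau> by (simp add: bot_row_def)
  moreover have "sorted_wrt (<) s" "\<forall>x\<in>set s. x \<le> Suc (a + b)"
    using rs by (auto simp: syt_pair_iff)
  ultimately obtain s' where s: "s = s' @ [Suc (a + b)]"
    using sorted_wrt_less_last[of s "Suc (a + b)"] by blast
  then have "[r, s'] \<in> syt [a, b]" using rs add_bot_syt_iff[OF assms] by simp
  then show "\<tau> \<in> add_bot (Suc (a + b)) ` syt [a, b]"
    unfolding \<tau> s by (force simp: add_bot_def)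
next
  fix \<tau> assume "\<tau> \<in> add_bot (Suc (a + b)) ` syt [a, b]"
  then obtain r s where "\<tau> = [r, s @ [Suc (a + b)]]" and rs: "[r, s] \<in> syt [a, b]"
    using syt_pair_eq unfolding add_bot_def by fastforce
  then show "\<tau> \<in> bot_row a (Suc b)" using add_bot_syt_iff[OF assms] by (auto simp: bot_row_def)
qed

text \<open>
  In a rectangle the largest entry cannot have an entry below it.
\<close>

lemma top_row_eq_empty: "top_row a a = {}"
proof -
  have False if "\<tau> \<in> top_row a a" for \<tau>
  proof -
    have "\<tau> \<in> syt [a, a]" using that by (simp add: top_row_def)
    then obtain r s where \<tau>: "\<tau> = [r, s]" and rs: "[r, s] \<in> syt [a, a]" by (rule syt_pairE)
    have "a + a \<in> set r" using that \<tau> by (simp add: top_row_def)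
    then obtain c where c: "c < a" "r ! c = a + a"
      using rs by (auto simp: in_set_conv_nth syt_pair_iff)
    then have "r ! c < s ! c" "s ! c \<in> set s" using rs by (auto simp: syt_pair_iff)
    moreover have "set s \<subseteq> {1..a + a}" using rs by (auto simp: syt_pair_iff)
    ultimately show False using c by auto
  qed
  then show ?thesis by auto
qed

lemma bot_row_0: "bot_row a 0 = {}"
proof -
  have "\<tau> ! 1 = []" if "\<tau> \<in> syt [a, 0]" for \<tau>
    using that syt_pair_eq[OF that] syt_pair_iff[of "\<tau> ! 0" "\<tau> ! 1" a 0] by simp
  then show ?thesis by (auto simp: bot_row_def)
qed

lemma maj_add_top:
  assumes "b \<le> a" "\<tau> \<in> syt [a, b]"
  shows "maj (add_top (Suc (a + b)) \<tau>) = maj \<tau>"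
proof -
  obtain r s where \<tau>: "\<tau> = [r, s]" and rs: "[r, s] \<in> syt [a, b]" using assms(2) by (rule syt_pairE)
  have rs': "[r @ [Suc (a + b)], s] \<in> syt [Suc a, b]" using rs add_top_syt_iff[OF assms(1)] by simp
  have "set s \<subseteq> {1..a + b}" using rs by (auto simp: syt_pair_iff)
  then have "Suc (Suc (a + b)) \<notin> set s" by auto
  then have "descents [r @ [Suc (a + b)], s] = descents [r, s]"
    unfolding descents_pair[OF rs] descents_pair[OF rs'] by auto
  then show ?thesis by (simp add: \<tau> add_top_def maj_def)
qed

text \<open>
  A new largest entry in the lower row creates the descent \<open>a + b\<close>, provided that \<open>a + b\<close> is on top.
\<close>

lemma maj_add_bot:
  assumes "Suc b \<le> a" "\<tau> \<in> syt [a, b]"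
  shows "maj (add_bot (Suc (a + b)) \<tau>) = (if a + b \<in> set (\<tau> ! 0) then a + b else 0) + maj \<tau>"
proof -
  obtain r s where \<tau>: "\<tau> = [r, s]" and rs: "[r, s] \<in> syt [a, b]" using assms(2) by (rule syt_pairE)
  have rs': "[r, s @ [Suc (a + b)]] \<in> syt [a, Suc b]" using rs add_bot_syt_iff[OF assms(1)] by simp
  have s: "set s \<subseteq> {1..a + b}" using rs by (auto simp: syt_pair_iff)
  have "descents [r, s @ [Suc (a + b)]] = (if a + b \<in> set r then {a + b} else {}) \<union> descents [r, s]"
    unfolding descents_pair[OF rs] descents_pair[OF rs'] by auto
  moreover have "finite (descents [r, s])" by (simp add: descents_def)
  moreover have "a + b \<notin> descents [r, s]"
    unfolding descents_pair[OF rs] using s by auto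
  ultimately show ?thesis by (simp add: \<tau> add_bot_def maj_def)
qed

definition gen_maj :: "tableau set \<Rightarrow> int poly" where
  "gen_maj A = (\<Sum>\<tau>\<in>A. xpow (maj \<tau>))"

lemma gen_maj_top_row:
  assumes "b \<le> a"
  shows "gen_maj (top_row (Suc a) b) = gen_maj (syt [a, b])"
proof -
  have "inj_on (add_top (Suc (a + b))) (syt [a, b])"
  proof (rule inj_onI)
    fix \<sigma> \<tau> assume "\<sigma> \<in> syt [a, b]" "\<tau> \<in> syt [a, b]"
      and "add_top (Suc (a + b)) \<sigma> = add_top (Suc (a + b)) \<tau>"
    moreover from this have "\<sigma> ! 0 = \<tau> ! 0" "\<sigma> ! 1 = \<tau> ! 1" by (auto simp: add_top_def)
    ultimately show "\<sigma> = \<tau>" using syt_pair_eq by metis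
  qed
  then show ?thesis
    unfolding gen_maj_def top_row_Suc[OF assms]
    by (simp add: sum.reindex maj_add_top[OF assms])
qed

lemma gen_maj_bot_row:
  assumes "Suc b \<le> a"
  shows "gen_maj (bot_row a (Suc b)) = gen_maj (bot_row a b) + xpow (a + b) * gen_maj (top_row a b)"
proof -
  have fin: "finite (top_row a b)" "finite (bot_row a b)"
    by (auto simp: top_row_def bot_row_def)
  have ab: "a + b > 0" using assms by simp
  have "inj_on (add_bot (Suc (a + b))) (syt [a, b])"
  proof (rule inj_onI)
    fix \<sigma> \<tau> assume "\<sigma> \<in> syt [a, b]" "\<tau> \<in> syt [a, b]"
      and "add_bot (Suc (a + b)) \<sigma> = add_bot (Suc (a + b)) \<tau>"
    moreover from this have "\<sigma> ! 0 = \<tau> ! 0" "\<sigma> ! 1 = \<tau> ! 1" by (auto simp: add_bot_def)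
    ultimately show "\<sigma> = \<tau>" using syt_pair_eq by metis
  qed
  then have "gen_maj (bot_row a (Suc b)) = (\<Sum>\<tau>\<in>syt [a, b]. xpow (maj (add_bot (Suc (a + b)) \<tau>)))"
    unfolding gen_maj_def bot_row_Suc[OF assms] by (simp add: sum.reindex)
  also have "\<dots> = (\<Sum>\<tau>\<in>top_row a b. xpow (maj (add_bot (Suc (a + b)) \<tau>)))
      + (\<Sum>\<tau>\<in>bot_row a b. xpow (maj (add_bot (Suc (a + b)) \<tau>)))"
    unfolding syt_split(1)[OF ab] using syt_split(2)[OF ab] fin by (simp add: sum.union_disjoint)
  also have "(\<Sum>\<tau>\<in>top_row a b. xpow (maj (add_bot (Suc (a + b)) \<tau>)))
      = xpow (a + b) * gen_maj (top_row a b)"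
    unfolding gen_maj_def sum_distrib_left
    by (intro sum.cong refl) (auto simp: top_row_def maj_add_bot[OF assms] xpow_add)
  also have "(\<Sum>\<tau>\<in>bot_row a b. xpow (maj (add_bot (Suc (a + b)) \<tau>))) = gen_maj (bot_row a b)"
    unfolding gen_maj_def
  proof (intro sum.cong refl)
    fix \<tau> assume "\<tau> \<in> bot_row a b"
    then have "\<tau> \<in> syt [a, b]" "\<tau> \<notin> top_row a b" using syt_split[OF ab] by auto
    then show "xpow (maj (add_bot (Suc (a + b)) \<tau>)) = xpow (maj \<tau>)"
      using maj_add_bot[OF assms] by (auto simp: top_row_def)
  qed
  finally show ?thesis by simp
qed

text \<open>
  The claim is proved together with the formulas for the tableaux whose largest entry is in the
  upper row (fact \<open>top\<close>) and in the lower row (fact \<open>bot\<close>).  In the rectangular case the upper formula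
  asserts that a difference vanishes, which is the symmetry of the Gaussian binomial coefficients.
\<close>

theorem gen_maj_two_rows:
  assumes "b \<le> a"
  shows "gen_maj (syt [a, b]) = qbin a b - (if b = 0 then 0 else qbin (Suc a) (b - 1))"
  using assms
proof (induction "a + b" arbitrary: a b rule: less_induct)
  case less
  show ?case
  proof (cases "a + b = 0")
    case True
    have "syt [0, 0] = {[[], []]}"
    proof -
      have "\<tau> = [[], []]" if "\<tau> \<in> syt [0, 0]" for \<tau>
        using that syt_pair_eq[OF that] syt_pair_iff[of "\<tau> ! 0" "\<tau> ! 1" 0 0] by simp
      moreover have "[[], []] \<in> syt [0, 0]" by (simp add: syt_pair_iff)
      ultimately show ?thesis by blast
    qed
    moreover have "maj [[], []] = 0"
      using descents_pair[of "[]" "[]" 0 0] by (simp add: maj_def syt_pair_iff)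
    ultimately show ?thesis using True by (simp add: gen_maj_def)
  next
    case False
    have top: "gen_maj (top_row a c) = qbin (a - 1) c - (if c = 0 then 0 else qbin a (c - 1))"
      if "c \<le> b" "a + c > 0" for c
    proof (cases "c = a")
      case True
      have "qbin (a - 1) a = qbin a (a - 1)" by (rule qbin_sym)
      then show ?thesis using True that by (simp add: top_row_eq_empty gen_maj_def)
    next
      case False
      then have "c < a" using that less.prems by linarith
      then obtain a' where a: "a = Suc a'" "c \<le> a'" by (metis less_Suc_eq_le lessE)
      then show ?thesis
        using less.hyps[of a' c] that by (simp add: gen_maj_top_row)
    qed
    have bot: "gen_maj (bot_row a (Suc c)) = xpow a * qbin a c
        - (if c = 0 then 0 else xpow (Suc a) * qbin (Suc a) (c - 1))" if "Suc c \<le> b" for c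
      using that
    proof (induction c)
      case 0
      then show ?case
        using less.prems gen_maj_bot_row[of 0 a] top[of 0] by (simp add: bot_row_0 gen_maj_def)
    next
      case (Suc c)
      obtain a' where a: "a = Suc a'" using Suc.prems less.prems by (cases a) auto
      have "gen_maj (bot_row a (Suc (Suc c)))
          = xpow a * qbin a c - (if c = 0 then 0 else xpow (Suc a) * qbin (Suc a) (c - 1))
            + xpow (a + Suc c) * (qbin a' (Suc c) - qbin a c)"
        using Suc less.prems gen_maj_bot_row[of "Suc c" a] top[of "Suc c"] by (simp add: a)
      also have "xpow (a + Suc c) * (qbin a' (Suc c) - qbin a c)
          = xpow a * (qbin a (Suc c) - qbin a c) - xpow (Suc a) * (xpow c * qbin a c)"
        using qbin_pascal'[of a' c] xpow_add[of a "Suc c"] xpow_add[of "Suc a" c]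
        by (simp add: a algebra_simps)
      also have "xpow c * qbin a c = qbin (Suc a) c - (if c = 0 then 0 else qbin (Suc a) (c - 1))"
        using qbin_pascal'[of a "c - 1"] by (cases c) auto
      finally show ?case by (cases "c = 0") (simp_all add: algebra_simps)
    qed
    have fin: "finite (top_row a b)" "finite (bot_row a b)"
      by (auto simp: top_row_def bot_row_def)
    have "gen_maj (syt [a, b]) = gen_maj (top_row a b) + gen_maj (bot_row a b)"
      using syt_split[of a b] False fin by (simp add: gen_maj_def sum.union_disjoint)
    moreover obtain a' where a: "a = Suc a'" using False less.prems by (cases a) auto
    ultimately show ?thesis
    proof (cases b)
      case 0
      then show ?thesis
        using \<open>gen_maj (syt [a, b]) = _\<close> top[of 0] by (simp add: a bot_row_0 gen_maj_def)
    next
      case (Suc b')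
      have "gen_maj (syt [a, b]) = qbin a' (Suc b') - qbin a b' + (xpow a * qbin a b'
        - (if b' = 0 then 0 else xpow (Suc a) * qbin (Suc a) (b' - 1)))"
        using \<open>gen_maj (syt [a, b]) = _\<close> top[of b] bot[of b'] by (simp add: a Suc)
      also have "\<dots> = qbin a (Suc b') - qbin (Suc a) b'"
        using a by (cases b') (auto simp: algebra_simps)
      finally show ?thesis using Suc by simp
    qed
  qed
qed

text \<open>
  The additive form avoids subtraction of natural numbers; it is matched with the telescoping dimension
  count for representations of sl2.
\<close>

lemma card_syt_maj:
  assumes "b \<le> a"
  shows "card {\<tau> \<in> syt [a, b]. maj \<tau> = m}
      + (if b = 0 then 0 else card {\<mu> \<in> nsubsets (a + b) (b - 1). \<Sum>\<mu> = m + ((b - 1) choose 2)})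
    = card {\<mu> \<in> nsubsets (a + b) b. \<Sum>\<mu> = m + (b choose 2)}"
proof -
  have "int (card {\<tau> \<in> syt [a, b]. maj \<tau> = m}) = coeff (gen_maj (syt [a, b])) m"
    by (simp add: gen_maj_def coeff_sum_xpow)
  moreover have "int (card {\<mu> \<in> nsubsets (a + b) b. \<Sum>\<mu> = m + (b choose 2)}) = coeff (qbin a b) m"
    by (rule card_nsubsets_qbin)
  moreover have "int (card {\<mu> \<in> nsubsets (a + b) (b - 1). \<Sum>\<mu> = m + ((b - 1) choose 2)})
      = coeff (qbin (Suc a) (b - 1)) m" if "b \<noteq> 0"
    using card_nsubsets_qbin[of "Suc a" "b - 1" m] that by (cases b) auto
  ultimately show ?thesis
    unfolding gen_maj_two_rows[OF assms] by (auto split: if_splits)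
qed


section \<open>Linear algebra of complex-valued functions\<close>

text \<open>
  Linearity as a bare predicate: it is established by unfolding for the many operators given by lambda-terms.
\<close>

definition linmap :: "(('a \<Rightarrow> complex) \<Rightarrow> ('b \<Rightarrow> complex)) \<Rightarrow> bool" where
  "linmap F \<longleftrightarrow> (\<forall>u v. F (u + v) = F u + F v) \<and> (\<forall>c u. F (cscale c u) = cscale c (F u))"

lemma sum_fun_apply: "(\<Sum>i\<in>A. f i) x = (\<Sum>i\<in>A. f i x :: complex)"
  by (induction A rule: infinite_finite_induct) auto

lemma linmap_scale: "linmap F \<Longrightarrow> F (cscale c u) = cscale c (F u)"
  by (simp add: linmap_def)

lemma linmap_add: "linmap F \<Longrightarrow> F (u + v) = F u + F v"
  by (simp add: linmap_def)

lemma linmap_0: "linmap F \<Longrightarrow> F 0 = 0"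
  by (metis linmap_scale cfun.scale_zero_left)

lemma linmap_sum:
  assumes "linmap F"
  shows "F (\<Sum>i\<in>A. f i) = (\<Sum>i\<in>A. F (f i))"
proof (induction A rule: infinite_finite_induct)
  case (infinite A)
  show ?case unfolding sum.infinite[OF infinite] by (rule linmap_0[OF assms])
next
  case empty
  show ?case unfolding sum.empty by (rule linmap_0[OF assms])
next
  case (insert i A)
  show ?case unfolding sum.insert[OF insert.hyps] linmap_add[OF assms] insert.IH ..
qed

lemma linmap_comp: "linmap F \<Longrightarrow> linmap G \<Longrightarrow> linmap (\<lambda>u. F (G u))"
  by (simp add: linmap_def)

text \<open>
  Used throughout to check a statement about a span on its generators.
\<close>

lemma span_linmap_in:
  assumes "linmap F" "u \<in> cfun.span G" "cfun.subspace Z" "\<And>g. g \<in> G \<Longrightarrow> F g \<in> Z"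
  shows "F u \<in> Z"
proof -
  have "F 0 = 0" using assms(1) by (rule linmap_0)
  then have "cfun.subspace {u. F u \<in> Z}"
    using assms(1,3) by (auto simp: linmap_def cfun.subspace_def)
  then have "cfun.span G \<subseteq> {u. F u \<in> Z}"
    using assms(4) by (intro cfun.span_minimal) auto
  then show ?thesis using assms(2) by blast
qed

lemma linmap_image_span:
  assumes "linmap F"
  shows "F ` cfun.span G = cfun.span (F ` G)"
proof (intro equalityI subsetI)
  fix v assume "v \<in> F ` cfun.span G"
  then obtain u where u: "v = F u" "u \<in> cfun.span G" by blast
  then show "v \<in> cfun.span (F ` G)"
    using span_linmap_in[OF assms u(2) cfun.subspace_span, of "F ` G"] by (auto intro: cfun.span_base)
next
  have 0: "F 0 = 0" using assms by (rule linmap_0)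
  have "cfun.subspace (F ` cfun.span G)"
    unfolding cfun.subspace_def
  proof (intro conjI allI ballI)
    show "0 \<in> F ` cfun.span G" using 0 cfun.span_zero by (metis imageI)
    show "x + y \<in> F ` cfun.span G" if xy: "x \<in> F ` cfun.span G" "y \<in> F ` cfun.span G" for x y
    proof -
      obtain u v where "x = F u" "y = F v" "u \<in> cfun.span G" "v \<in> cfun.span G" using xy by blast
      then have "x + y = F (u + v)" "u + v \<in> cfun.span G"
        using assms by (auto simp: linmap_def cfun.span_add)
      then show ?thesis by blast
    qed
    show "cscale c x \<in> F ` cfun.span G" if x: "x \<in> F ` cfun.span G" for c x
    proof -
      obtain u where "x = F u" "u \<in> cfun.span G" using x by blast
      then have "cscale c x = F (cscale c u)" "cscale c u \<in> cfun.span G"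
        using assms by (auto simp: linmap_def cfun.span_scale)
      then show ?thesis by blast
    qed
  qed
  moreover have "F ` G \<subseteq> F ` cfun.span G" using cfun.span_base by blast
  ultimately have "cfun.span (F ` G) \<subseteq> F ` cfun.span G" by (rule cfun.span_minimal[rotated])
  then show "\<And>v. v \<in> cfun.span (F ` G) \<Longrightarrow> v \<in> F ` cfun.span G" by blast
qed

text \<open>
  A family that spans an independent set of the same size is itself independent.
\<close>

lemma independent_family_if_card:
  fixes f :: "'i \<Rightarrow> 'a \<Rightarrow> complex"
  assumes "finite I" "cfun.independent B" "B \<subseteq> cfun.span (f ` I)" "card B = card I"
  shows "inj_on f I" "cfun.independent (f ` I)"
proof -
  obtain C where C: "C \<subseteq> f ` I" "cfun.independent C" "f ` I \<subseteq> cfun.span C"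
    using cfun.maximal_independent_subset by blast
  have fin: "finite C" using C(1) assms(1) finite_subset by blast
  have "cfun.span (f ` I) \<subseteq> cfun.span C"
    using C(3) by (rule cfun.span_minimal) (rule cfun.subspace_span)
  then have "card B \<le> card C" using cfun.independent_span_bound[OF fin assms(2)] assms(3) by blast
  moreover have "card C \<le> card (f ` I)" using C(1) assms(1) by (simp add: card_mono)
  moreover have "card (f ` I) \<le> card I" using assms(1) by (rule card_image_le)
  ultimately have "card C = card (f ` I)" "card (f ` I) = card I" using assms(4) by auto
  moreover from this have "C = f ` I" using C(1) assms(1) by (simp add: card_subset_eq)
  ultimately show "inj_on f I" "cfun.independent (f ` I)"
    using C(2) assms(1) by (simp_all add: eq_card_imp_inj_on)
qed

text \<open>
  This turns matching lower and upper bounds for a dimension into equality of spaces.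
\<close>

lemma independent_spans_if_card:
  assumes "cfun.independent B" "B \<subseteq> W" "W \<subseteq> cfun.span T" "finite T" "card T \<le> card B"
  shows "W \<subseteq> cfun.span B"
proof (rule ccontr)
  assume "\<not> W \<subseteq> cfun.span B"
  then obtain w where w: "w \<in> W" "w \<notin> cfun.span B" by blast
  then have ind: "cfun.independent (insert w B)" using assms(1) by (simp add: cfun.independent_insertI)
  have "insert w B \<subseteq> cfun.span T" using w assms by blast
  then have "finite (insert w B)" "card (insert w B) \<le> card T"
    using cfun.independent_span_bound[OF assms(4) ind] by auto
  moreover have "w \<notin> B" using w cfun.span_base by blast
  ultimately show False using assms(5) by simp
qed

definition delta :: "'a \<Rightarrow> 'a \<Rightarrow> complex" where
  "delta a = (\<lambda>x. if x = a then 1 else 0)"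

lemma independent_delta: "finite A \<Longrightarrow> cfun.independent (delta ` A)"
proof (induction A rule: finite_induct)
  case (insert a A)
  have "cfun.span (delta ` A) \<subseteq> {u. u a = 0}"
    using insert.hyps by (intro cfun.span_minimal) (auto simp: delta_def cfun.subspace_def cscale_def)
  then have "delta a \<notin> cfun.span (delta ` A)" by (auto simp: delta_def)
  then show ?case using insert.IH by (simp add: cfun.independent_insertI)
qed (simp add: cfun.independent_empty)

lemma inj_delta: "inj delta"
  by (rule injI) (metis delta_def zero_neq_one)

section \<open>Symmetric functions of the points in a finite set\<close>

text \<open>
  The action of \<open>e\<close> in the language of subsets: \<open>create \<phi>\<close> adds one point \<open>j\<close> with weight \<open>\<phi> j\<close>.
\<close>

definition create :: "(nat \<Rightarrow> complex) \<Rightarrow> (nat set \<Rightarrow> complex) \<Rightarrow> nat set \<Rightarrow> complex" where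
  "create \<phi> u = (\<lambda>S. \<Sum>j\<in>S. \<phi> j * u (S - {j}))"

lemma linmap_create: "linmap (create \<phi>)"
  by (auto simp: linmap_def create_def cscale_def algebra_simps sum.distrib sum_distrib_left)

lemma sum_distinct_pairs_swap:
  assumes "finite S"
  shows "(\<Sum>j\<in>S. \<Sum>k\<in>S - {j}. g j k) = (\<Sum>k\<in>S. \<Sum>j\<in>S - {k}. g j k)"
proof -
  have "(\<Sum>j\<in>S. sum (g j) {k. k \<in> S \<and> j \<noteq> k}) = (\<Sum>k\<in>S. \<Sum>j | j \<in> S \<and> j \<noteq> k. g j k)"
    by (rule sum.swap_restrict[OF assms assms])
  moreover have "{k. k \<in> S \<and> j \<noteq> k} = S - {j}" "{k. k \<in> S \<and> k \<noteq> j} = S - {j}" for j by auto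
  ultimately show ?thesis by simp
qed

lemma create_commute: "create \<phi> (create \<psi> u) = create \<psi> (create \<phi> u)"
proof
  fix S
  show "create \<phi> (create \<psi> u) S = create \<psi> (create \<phi> u) S"
  proof (cases "finite S")
    case True
    show ?thesis
      unfolding create_def sum_distrib_left
      by (subst sum_distinct_pairs_swap[OF True])
         (intro sum.cong refl, simp add: mult.left_commute Diff_insert2[symmetric] insert_commute)
  qed (simp add: create_def)
qed

text \<open>
  The sum, over all injective choices of points \<open>j_1, \<dots>, j_l\<close> in \<open>S\<close>, of the products
  \<open>z_(j_1)^(i_1) \<dots> z_(j_l)^(i_l)\<close>.  For \<open>l = card S\<close> this is a symmetrized monomial; allowing larger \<open>S\<close>
  makes the recursion \<open>psum_inj_sum\<close> possible.
\<close>

definition inj_sum :: "(nat \<Rightarrow> complex) \<Rightarrow> nat list \<Rightarrow> nat set \<Rightarrow> complex" where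
  "inj_sum z is = foldr (\<lambda>i. create (\<lambda>j. z j ^ i)) is (\<lambda>_. 1)"

lemma inj_sum_Nil [simp]: "inj_sum z [] = (\<lambda>_. 1)"
  and inj_sum_Cons: "inj_sum z (i # is) = create (\<lambda>j. z j ^ i) (inj_sum z is)"
  by (simp_all add: inj_sum_def)

lemma inj_sum_eq_0: "finite S \<Longrightarrow> card S < length is \<Longrightarrow> inj_sum z is S = 0"
proof (induction "is" arbitrary: S)
  case (Cons i "is")
  have "inj_sum z is (S - {j}) = 0" if "j \<in> S" for j
    using card_Diff1_less[OF Cons.prems(1) that] Cons.prems by (intro Cons.IH) auto
  then show ?case by (simp add: inj_sum_Cons create_def)
qed simp

definition psum :: "(nat \<Rightarrow> complex) \<Rightarrow> nat \<Rightarrow> nat set \<Rightarrow> complex" where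
  "psum z r S = (\<Sum>j\<in>S. z j ^ r)"

lemma psum_remove: "finite S \<Longrightarrow> j \<in> S \<Longrightarrow> psum z r S = z j ^ r + psum z r (S - {j})"
  by (simp add: psum_def sum.remove)

lemma inj_sum_infinite: "infinite S \<Longrightarrow> is \<noteq> [] \<Longrightarrow> inj_sum z is S = 0"
  by (cases "is") (simp_all add: inj_sum_Cons create_def)

text \<open>
  The point of the power sum is either different from the points chosen by \<open>is\<close>, or equal to one of
  them.
\<close>

lemma psum_inj_sum:
  "psum z r S * inj_sum z is S
    = inj_sum z (r # is) S + (\<Sum>t<length is. inj_sum z (is[t := is ! t + r]) S)"
proof (induction "is" arbitrary: S)
  case Nil
  then show ?case by (simp add: psum_def inj_sum_Cons create_def)
next
  case (Cons k "is")
  show ?case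
  proof (cases "finite S")
    case False
    then have "(\<Sum>t<length (k # is). inj_sum z ((k # is)[t := (k # is) ! t + r]) S) = 0"
      by (intro sum.neutral ballI inj_sum_infinite) (simp_all split: nat.split)
    moreover have "inj_sum z (r # k # is) S = 0" using False by (intro inj_sum_infinite) simp_all
    moreover have "psum z r S = 0" using False by (simp add: psum_def)
    ultimately show ?thesis by (simp only:) simp
  next
    case True
    have "psum z r S * inj_sum z (k # is) S
        = (\<Sum>j\<in>S. z j ^ k * (psum z r S * inj_sum z is (S - {j})))"
      by (simp add: inj_sum_Cons create_def sum_distrib_left mult.left_commute)
    also have "\<dots> = (\<Sum>j\<in>S. z j ^ (k + r) * inj_sum z is (S - {j})
        + z j ^ k * inj_sum z (r # is) (S - {j})
        + (\<Sum>t<length is. z j ^ k * inj_sum z (is[t := is ! t + r]) (S - {j})))"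
    proof (rule sum.cong[OF refl])
      fix j assume j: "j \<in> S"
      show "z j ^ k * (psum z r S * inj_sum z is (S - {j}))
        = z j ^ (k + r) * inj_sum z is (S - {j}) + z j ^ k * inj_sum z (r # is) (S - {j})
        + (\<Sum>t<length is. z j ^ k * inj_sum z (is[t := is ! t + r]) (S - {j}))"
        unfolding psum_remove[OF True j] distrib_right Cons.IH
        by (simp add: algebra_simps power_add sum_distrib_left)
    qed
    also have "\<dots> = inj_sum z ((k + r) # is) S + inj_sum z (k # r # is) S
        + (\<Sum>t<length is. inj_sum z (k # is[t := is ! t + r]) S)"
      unfolding sum.distrib
      by (subst sum.swap) (simp add: inj_sum_Cons create_def)
    also have "inj_sum z (k # r # is) = inj_sum z (r # k # is)"
      unfolding inj_sum_Cons by (rule create_commute)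
    finally show ?thesis by (simp add: sum.lessThan_Suc_shift del: sum.lessThan_Suc)
  qed
qed

lemma sum_list_update_add:
  "t < length is \<Longrightarrow> sum_list (is[t := is ! t + r]) = sum_list is + (r :: nat)"
  using elem_le_sum_list[of t "is"] by (simp add: sum_list_update)

text \<open>
  By \<open>psum_inj_sum\<close>, a symmetrized monomial is a combination of a power sum times a shorter one and of
  further shorter ones, so closure under power sums is enough.
\<close>

lemma inj_sum_mult_in:
  assumes sub: "\<And>d. cfun.subspace (Z d)"
    and psum: "\<And>r d v. v \<in> Z d \<Longrightarrow> (\<lambda>S. psum z r S * v S) \<in> Z (d + r)"
    and v: "v \<in> Z a"
  shows "(\<lambda>S. inj_sum z is S * v S) \<in> Z (a + sum_list is)"
proof (induction "length is" arbitrary: "is" rule: less_induct)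
  case less
  show ?case
  proof (cases "is")
    case Nil
    then show ?thesis using v by simp
  next
    case (Cons r js)
    have 1: "(\<lambda>S. psum z r S * (inj_sum z js S * v S)) \<in> Z (a + sum_list is)"
      using psum[OF less[of js], of r] Cons by (simp add: ac_simps)
    have 2: "(\<lambda>S. inj_sum z (js[t := js ! t + r]) S * v S) \<in> Z (a + sum_list is)" if "t < length js" for t
    proof -
      have "(\<lambda>S. inj_sum z (js[t := js ! t + r]) S * v S) \<in> Z (a + sum_list (js[t := js ! t + r]))"
        by (rule less) (simp add: Cons)
      moreover have "sum_list (js[t := js ! t + r]) = sum_list is"
        using sum_list_update_add[OF that, of r] Cons by simp
      ultimately show ?thesis by (simp only:)
    qed
    have "(\<lambda>S. inj_sum z is S * v S) = (\<lambda>S. psum z r S * (inj_sum z js S * v S))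
        - (\<Sum>t<length js. (\<lambda>S. inj_sum z (js[t := js ! t + r]) S * v S))"
    proof
      fix S
      have "inj_sum z is S = psum z r S * inj_sum z js S - (\<Sum>t<length js. inj_sum z (js[t := js ! t + r]) S)"
        unfolding psum_inj_sum Cons by simp
      then show "inj_sum z is S * v S = ((\<lambda>S. psum z r S * (inj_sum z js S * v S))
        - (\<Sum>t<length js. (\<lambda>S. inj_sum z (js[t := js ! t + r]) S * v S))) S"
        by (simp only: minus_apply sum_fun_apply left_diff_distrib sum_distrib_right mult.assoc)
    qed
    also have "\<dots> \<in> Z (a + sum_list is)"
      using 1 2 sub by (intro cfun.subspace_diff cfun.subspace_sum) auto
    finally show ?thesis .
  qed
qed

definition pprod :: "(nat \<Rightarrow> complex) \<Rightarrow> nat list \<Rightarrow> nat set \<Rightarrow> complex" where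
  "pprod z rs = (\<lambda>S. prod_list (map (\<lambda>r. psum z r S) rs))"

text \<open>
  Symmetric polynomials of degree at most \<open>d\<close>, as functions on finite sets of points with any
  number of elements.  Power sums as generators make the closure properties immediate.
\<close>

definition sympoly :: "(nat \<Rightarrow> complex) \<Rightarrow> nat \<Rightarrow> (nat set \<Rightarrow> complex) set" where
  "sympoly z d = cfun.span {pprod z rs | rs. sum_list rs \<le> d}"

lemma subspace_sympoly: "cfun.subspace (sympoly z d)"
  by (simp add: sympoly_def cfun.subspace_span)

lemma pprod_in_sympoly: "sum_list rs \<le> d \<Longrightarrow> pprod z rs \<in> sympoly z d"
  by (auto simp: sympoly_def intro: cfun.span_base)

lemma sympoly_mono: "d \<le> d' \<Longrightarrow> sympoly z d \<subseteq> sympoly z d'"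
  unfolding sympoly_def by (intro cfun.span_mono) auto

lemma one_in_sympoly: "(\<lambda>_. 1) \<in> sympoly z d"
  using pprod_in_sympoly[of "[]" d z] by (simp add: pprod_def)

lemma psum_in_sympoly: "psum z r \<in> sympoly z r"
  using pprod_in_sympoly[of "[r]" r z] by (simp add: pprod_def)

lemma linmap_mult: "linmap (\<lambda>u S. v S * u S)"
  by (auto simp: linmap_def cscale_def algebra_simps)

lemma sympoly_mult:
  assumes "u \<in> sympoly z a" "v \<in> sympoly z b"
  shows "(\<lambda>S. u S * v S) \<in> sympoly z (a + b)"
proof -
  have 1: "(\<lambda>S. pprod z rs S * v S) \<in> sympoly z (a + b)" if "sum_list rs \<le> a" for rs
    using linmap_mult[of "pprod z rs"] assms(2)[unfolded sympoly_def] subspace_sympoly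
  proof (rule span_linmap_in)
    fix g assume "g \<in> {pprod z rs |rs. sum_list rs \<le> b}"
    then obtain qs where "g = pprod z qs" "sum_list qs \<le> b" by auto
    then show "(\<lambda>S. pprod z rs S * g S) \<in> sympoly z (a + b)"
      using that pprod_in_sympoly[of "rs @ qs" "a + b" z] by (simp add: pprod_def)
  qed
  have "(\<lambda>S. v S * u S) \<in> sympoly z (a + b)"
    using linmap_mult[of v] assms(1)[unfolded sympoly_def] subspace_sympoly
  proof (rule span_linmap_in)
    fix g assume "g \<in> {pprod z rs |rs. sum_list rs \<le> a}"
    then show "(\<lambda>S. v S * g S) \<in> sympoly z (a + b)" using 1 by (auto simp: mult.commute)
  qed
  then show ?thesis by (simp add: mult.commute)
qed

lemma inj_sum_in_sympoly: "inj_sum z is \<in> sympoly z (sum_list is)"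
proof -
  have "(\<lambda>S. inj_sum z is S * (\<lambda>_. 1) S) \<in> sympoly z (0 + sum_list is)"
    using subspace_sympoly
  proof (rule inj_sum_mult_in)
    fix r d v assume "v \<in> sympoly z d"
    then show "(\<lambda>S. psum z r S * v S) \<in> sympoly z (d + r)"
      using sympoly_mult[OF psum_in_sympoly] by (metis add.commute)
  qed (rule one_in_sympoly)
  then show ?thesis by simp
qed

text \<open>
  Omitting the point \<open>c\<close> changes a power sum only by the constant \<open>z_c^r\<close>, so a symmetric polynomial in the
  other points is a symmetric polynomial in all of them, of the same degree.
\<close>

lemma sympoly_delete:
  assumes "u \<in> sympoly z d"
  shows "\<exists>v\<in>sympoly z d. \<forall>S. finite S \<longrightarrow> c \<in> S \<longrightarrow> v S = u (S - {c})"
proof -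
  let ?P = "\<lambda>d u v. v \<in> sympoly z d \<and> (\<forall>S. finite S \<longrightarrow> c \<in> S \<longrightarrow> v S = u (S - {c}))"
  have gen: "\<exists>v. ?P (sum_list rs) (pprod z rs) v" for rs
  proof (induction rs)
    case Nil
    then show ?case using one_in_sympoly by (auto simp: pprod_def)
  next
    case (Cons r rs)
    then obtain v where v: "?P (sum_list rs) (pprod z rs) v" by blast
    have "psum z r - cscale (z c ^ r) (\<lambda>_. 1) \<in> sympoly z r"
      using sympoly_mono[of 0 r z]
      by (intro cfun.subspace_diff cfun.subspace_scale subspace_sympoly psum_in_sympoly one_in_sympoly)
    from sympoly_mult[OF this conjunct1[OF v]]
    have "(\<lambda>S. (psum z r - cscale (z c ^ r) (\<lambda>_. 1)) S * v S) \<in> sympoly z (sum_list (r # rs))" by simp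
    moreover have "(psum z r - cscale (z c ^ r) (\<lambda>_. 1)) S * v S = pprod z (r # rs) (S - {c})"
      if "finite S" "c \<in> S" for S
      using that v by (simp add: pprod_def cscale_def psum_remove[OF that])
    ultimately show ?case by blast
  qed
  have "cfun.subspace {u. \<exists>v. ?P d u v}"
    unfolding cfun.subspace_def
  proof (intro conjI allI ballI)
    show "0 \<in> {u. \<exists>v. ?P d u v}" using cfun.subspace_0[OF subspace_sympoly] by force
    fix x y assume "x \<in> {u. \<exists>v. ?P d u v}" "y \<in> {u. \<exists>v. ?P d u v}"
    then obtain v w where "?P d x v" "?P d y w" by blast
    then have "?P d (x + y) (v + w)" using cfun.subspace_add[OF subspace_sympoly] by auto
    then show "x + y \<in> {u. \<exists>v. ?P d u v}" by blast
  next
    fix a x assume "x \<in> {u. \<exists>v. ?P d u v}"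
    then obtain v where "?P d x v" by blast
    then have "?P d (cscale a x) (cscale a v)" using cfun.subspace_scale[OF subspace_sympoly] by (auto simp: cscale_def)
    then show "cscale a x \<in> {u. \<exists>v. ?P d u v}" by blast
  qed
  moreover have "{pprod z rs | rs. sum_list rs \<le> d} \<subseteq> {u. \<exists>v. ?P d u v}"
    using gen sympoly_mono by blast
  ultimately have "sympoly z d \<subseteq> {u. \<exists>v. ?P d u v}"
    unfolding sympoly_def by (intro cfun.span_minimal)
  then show ?thesis using assms by blast
qed

text \<open>
  On \<open>l\<close>-sets, the \<open>l\<close>-fold creation with weight \<open>z_j - c\<close> is \<open>l!\<close> times the product.
\<close>

lemma root_product_in_sympoly:
  "\<exists>u\<in>sympoly z l. \<forall>S. finite S \<longrightarrow> card S = l \<longrightarrow> u S = (\<Prod>j\<in>S. z j - c)"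
proof -
  \<comment> \<open>iterated creation with a linear weight, a symmetrized product of linear factors\<close>
  define Q where "Q l = (create (\<lambda>j. z j - c) ^^ l) (\<lambda>_. 1)" for l
  have Q_Suc: "Q (Suc l) = create (\<lambda>j. z j - c) (Q l)" for l by (simp add: Q_def)
  have "Q l \<in> cfun.span {inj_sum z is | is. sum_list is \<le> l}" for l
  proof (induction l)
    case 0
    have "Q 0 = inj_sum z []" by (simp add: Q_def)
    then show ?case by (auto intro!: cfun.span_base exI[of _ "[]"])
  next
    case (Suc l)
    show ?case unfolding Q_Suc
      using linmap_create Suc cfun.subspace_span
    proof (rule span_linmap_in)
      fix g assume "g \<in> {inj_sum z is | is. sum_list is \<le> l}"
      then obtain "is" where g: "g = inj_sum z is" "sum_list is \<le> l" by auto
      have "create (\<lambda>j. z j - c) g = inj_sum z (1 # is) - cscale c (inj_sum z (0 # is))"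
        by (auto simp: g inj_sum_Cons create_def cscale_def algebra_simps sum_subtractf sum_distrib_left)
      moreover have "inj_sum z (1 # is) \<in> cfun.span {inj_sum z is | is. sum_list is \<le> Suc l}"
        "inj_sum z (0 # is) \<in> cfun.span {inj_sum z is | is. sum_list is \<le> Suc l}"
        by (rule cfun.span_base, intro CollectI exI conjI, rule refl, use g(2) in simp)+
      ultimately show "create (\<lambda>j. z j - c) g \<in> cfun.span {inj_sum z is | is. sum_list is \<le> Suc l}"
        by (simp add: cfun.span_diff cfun.span_scale)
    qed
  qed
  moreover have "cfun.span {inj_sum z is | is. sum_list is \<le> l} \<subseteq> sympoly z l"
    using inj_sum_in_sympoly sympoly_mono by (intro cfun.span_minimal subspace_sympoly) blast
  ultimately have Q: "Q l \<in> sympoly z l" by blast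
  have val: "Q l S = fact l * (\<Prod>j\<in>S. z j - c)" if "finite S" "card S = l" for l S
    using that
  proof (induction l arbitrary: S)
    case 0
    then show ?case by (simp add: Q_def)
  next
    case (Suc l)
    have "Q (Suc l) S = (\<Sum>j\<in>S. (z j - c) * (fact l * (\<Prod>j\<in>S - {j}. z j - c)))"
      unfolding Q_Suc create_def using Suc by (intro sum.cong refl) (simp add: card_Diff_singleton_if)
    also have "\<dots> = (\<Sum>j\<in>S. fact l * (\<Prod>j\<in>S. z j - c))"
      by (intro sum.cong refl) (simp add: prod.remove[OF Suc.prems(1)] mult.left_commute)
    finally show ?case using Suc.prems by (simp add: algebra_simps)
  qed
  show ?thesis
  proof (intro bexI allI impI)
    show "cscale (1 / fact l) (Q l) \<in> sympoly z l"
      using Q by (intro cfun.subspace_scale subspace_sympoly)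
  qed (simp add: cscale_def val)
qed


text \<open>
  Splitting by whether \<open>0\<close> is contained, the other elements being shifted down.
\<close>

lemma nsubsets_Suc_shift:
  "nsubsets (Suc N) (Suc l) = image Suc ` nsubsets N (Suc l) \<union> (\<lambda>\<mu>. insert 0 (Suc ` \<mu>)) ` nsubsets N l"
proof (intro equalityI subsetI)
  fix \<mu> assume "\<mu> \<in> nsubsets (Suc N) (Suc l)"
  then have \<mu>: "\<mu> \<subseteq> {..<Suc N}" "card \<mu> = Suc l" "finite \<mu>"
    by (auto simp: nsubsets_def intro: finite_subset)
  define \<nu> where "\<nu> = {j. Suc j \<in> \<mu>}"
  have \<nu>: "\<nu> \<subseteq> {..<N}" using \<mu>(1) by (auto simp: \<nu>_def)
  have img: "Suc ` \<nu> = \<mu> - {0}"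
    by (auto simp: \<nu>_def image_iff) (metis not0_implies_Suc)
  have card: "card \<nu> = card (\<mu> - {0})" unfolding img[symmetric] by (simp add: card_image)
  show "\<mu> \<in> image Suc ` nsubsets N (Suc l) \<union> (\<lambda>\<mu>. insert 0 (Suc ` \<mu>)) ` nsubsets N l"
  proof (cases "0 \<in> \<mu>")
    case True
    then have "\<nu> \<in> nsubsets N l" "\<mu> = insert 0 (Suc ` \<nu>)"
      using \<nu> card \<mu> img by (auto simp: nsubsets_def)
    then show ?thesis by blast
  next
    case False
    then have "\<nu> \<in> nsubsets N (Suc l)" "\<mu> = Suc ` \<nu>"
      using \<nu> card \<mu> img by (auto simp: nsubsets_def)
    then show ?thesis by blast
  qed
next
  fix \<mu> assume "\<mu> \<in> image Suc ` nsubsets N (Suc l) \<union> (\<lambda>\<mu>. insert 0 (Suc ` \<mu>)) ` nsubsets N l"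
  then show "\<mu> \<in> nsubsets (Suc N) (Suc l)"
  proof
    assume "\<mu> \<in> image Suc ` nsubsets N (Suc l)"
    then show ?thesis by (auto simp: nsubsets_def card_image)
  next
    assume "\<mu> \<in> (\<lambda>\<mu>. insert 0 (Suc ` \<mu>)) ` nsubsets N l"
    then obtain \<nu> where \<nu>: "\<mu> = insert 0 (Suc ` \<nu>)" "\<nu> \<in> nsubsets N l" by blast
    moreover have "finite \<nu>" using \<nu>(2) by (rule nsubsets_finite)
    ultimately show ?thesis by (auto simp: nsubsets_def card_image)
  qed
qed

text \<open>
  The induction adds the point \<open>N\<close>.  Sets that contain \<open>N\<close> are served by polynomials in the remaining
  points (\<open>sympoly_delete\<close>), sets that do not contain it by the multiples of the product of all \<open>z_j - z_N\<close>, which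
  vanishes on the former sets and on none of the latter.  The first kind is indexed by the \<open>\<mu>\<close> that
  contain \<open>0\<close> and the second kind by the others; with this choice the degree is the sum of \<open>\<mu>\<close>
  diminished by \<open>l choose 2\<close>.
\<close>

lemma sympoly_spanning_family:
  assumes "inj_on z {..<N}"
  shows "\<exists>g. (\<forall>\<mu>\<in>nsubsets N l. \<exists>d. \<Sum>\<mu> = d + (l choose 2) \<and> g \<mu> \<in> sympoly z d) \<and>
    (\<forall>u. \<exists>c. \<forall>S\<in>nsubsets N l. u S = (\<Sum>\<mu>\<in>nsubsets N l. c \<mu> * g \<mu> S))"
  using assms
proof (induction N arbitrary: l)
  case 0
  show ?case
  proof (cases l)
    case 0
    have "u S = (\<Sum>\<mu>\<in>nsubsets 0 0. u {} * (\<lambda>_ _. 1) \<mu> S)" if "S \<in> nsubsets 0 0" for u :: "nat set \<Rightarrow> complex" and S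
      using that by simp
    then show ?thesis using 0 one_in_sympoly
      by (intro exI[of _ "\<lambda>_ _. 1"]) (fastforce simp: numeral_2_eq_2)
  qed simp
next
  case (Suc N l)
  have inj: "inj_on z {..<N}" using Suc.prems by (auto simp: inj_on_def)
  show ?case
  proof (cases l)
    case 0
    have "u S = (\<Sum>\<mu>\<in>nsubsets (Suc N) 0. u {} * (\<lambda>_ _. 1) \<mu> S)" if "S \<in> nsubsets (Suc N) 0"
      for u :: "nat set \<Rightarrow> complex" and S
      using that by simp
    then show ?thesis using 0 one_in_sympoly
      by (intro exI[of _ "\<lambda>_ _. 1"]) (fastforce simp: numeral_2_eq_2)
  next
    case l: (Suc k)
    obtain g1 where g1: "\<forall>\<mu>\<in>nsubsets N l. \<exists>d. \<Sum>\<mu> = d + (l choose 2) \<and> g1 \<mu> \<in> sympoly z d"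
        "\<forall>u. \<exists>c. \<forall>S\<in>nsubsets N l. u S = (\<Sum>\<mu>\<in>nsubsets N l. c \<mu> * g1 \<mu> S)"
      using Suc.IH[OF inj, of l] by blast
    obtain g2 where g2: "\<forall>\<mu>\<in>nsubsets N k. \<exists>d. \<Sum>\<mu> = d + (k choose 2) \<and> g2 \<mu> \<in> sympoly z d"
        "\<forall>u. \<exists>c. \<forall>S\<in>nsubsets N k. u S = (\<Sum>\<mu>\<in>nsubsets N k. c \<mu> * g2 \<mu> S)"
      using Suc.IH[OF inj, of k] by blast
    have "\<forall>\<mu>\<in>nsubsets N k. \<exists>v. (\<exists>d. \<Sum>\<mu> = d + (k choose 2) \<and> v \<in> sympoly z d) \<and>
        (\<forall>S. finite S \<longrightarrow> N \<in> S \<longrightarrow> v S = g2 \<mu> (S - {N}))"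
      using g2(1) sympoly_delete by meson
    then obtain h where h: "\<And>\<mu>. \<mu> \<in> nsubsets N k \<Longrightarrow> \<exists>d. \<Sum>\<mu> = d + (k choose 2) \<and> h \<mu> \<in> sympoly z d"
        "\<And>\<mu> S. \<mu> \<in> nsubsets N k \<Longrightarrow> finite S \<Longrightarrow> N \<in> S \<Longrightarrow> h \<mu> S = g2 \<mu> (S - {N})"
      by metis
    obtain Q where Q: "Q \<in> sympoly z l" "\<And>S. finite S \<Longrightarrow> card S = l \<Longrightarrow> Q S = (\<Prod>j\<in>S. z j - z N)"
      using root_product_in_sympoly[of z l "z N"] by blast
    define dn where "dn \<mu> = {j. Suc j \<in> \<mu>}" for \<mu>
    have dn [simp]: "dn (Suc ` \<mu>) = \<mu>" "dn (insert 0 (Suc ` \<mu>)) = \<mu>" for \<mu>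
      by (auto simp: dn_def)
    \<comment> \<open>the induction hypotheses for \<open>l\<close> and \<open>l - 1\<close>, relabelled by subsets of \<open>{0, \<dots>, N}\<close>\<close>
    define g where "g \<mu> = (if 0 \<in> \<mu> then h (dn \<mu>) else (\<lambda>S. Q S * g1 (dn \<mu>) S))" for \<mu>
    have S: "nsubsets (Suc N) l = image Suc ` nsubsets N l \<union> (\<lambda>\<mu>. insert 0 (Suc ` \<mu>)) ` nsubsets N k"
      unfolding l by (rule nsubsets_Suc_shift)
    have choose: "l choose 2 = k + (k choose 2)" by (simp add: l numeral_2_eq_2)
    show ?thesis
    proof (intro exI[of _ g] conjI ballI allI)
      fix \<mu> assume "\<mu> \<in> nsubsets (Suc N) l"
      then consider \<nu> where "\<mu> = Suc ` \<nu>" "\<nu> \<in> nsubsets N l" | \<nu> where "\<mu> = insert 0 (Suc ` \<nu>)" "\<nu> \<in> nsubsets N k"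
        unfolding S by blast
      then show "\<exists>d. \<Sum>\<mu> = d + (l choose 2) \<and> g \<mu> \<in> sympoly z d"
      proof cases
        case 1
        then obtain d where d: "\<Sum>\<nu> = d + (l choose 2)" "g1 \<nu> \<in> sympoly z d" using g1(1) by blast
        have "\<Sum>\<mu> = \<Sum>\<nu> + l" using 1 by (simp add: sum.reindex sum.distrib nsubsets_def sum_Suc)
        moreover have "g \<mu> \<in> sympoly z (l + d)"
          using 1 sympoly_mult[OF Q(1) d(2)] by (simp add: g_def)
        ultimately show ?thesis using d(1) by (intro exI[of _ "l + d"]) simp
      next
        case 2
        obtain d where d: "\<Sum>\<nu> = d + (k choose 2)" "h \<nu> \<in> sympoly z d" using h(1)[OF 2(2)] by blast
        have fin: "finite \<nu>" using 2(2) by (rule nsubsets_finite)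
        have "\<Sum>\<mu> = \<Sum>\<nu> + k" using 2 fin by (simp add: sum.reindex sum.distrib nsubsets_def sum_Suc)
        moreover have "g \<mu> \<in> sympoly z d" using 2 d(2) by (simp add: g_def)
        ultimately show ?thesis using d(1) choose by (intro exI[of _ d]) simp
      qed
    next
      fix u :: "nat set \<Rightarrow> complex"
      obtain c2 where c2: "\<forall>S\<in>nsubsets N k. u (insert N S) = (\<Sum>\<mu>\<in>nsubsets N k. c2 \<mu> * g2 \<mu> S)"
        using g2(2) spec[of _ "\<lambda>S. u (insert N S)"] by blast
      \<comment> \<open>what is left after matching \<open>u\<close> on the sets that contain \<open>N\<close>, divided by the product of all \<open>z_j - z_N\<close>\<close>
      obtain c1 where c1: "\<forall>S\<in>nsubsets N l. (u S - (\<Sum>\<mu>\<in>nsubsets N k. c2 \<mu> * h \<mu> S)) / Q S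
          = (\<Sum>\<mu>\<in>nsubsets N l. c1 \<mu> * g1 \<mu> S)"
        using spec[OF g1(2), of "\<lambda>S. (u S - (\<Sum>\<mu>\<in>nsubsets N k. c2 \<mu> * h \<mu> S)) / Q S"] by blast
      define c where "c \<mu> = (if 0 \<in> \<mu> then c2 (dn \<mu>) else c1 (dn \<mu>))" for \<mu>
      show "\<exists>c. \<forall>S\<in>nsubsets (Suc N) l. u S = (\<Sum>\<mu>\<in>nsubsets (Suc N) l. c \<mu> * g \<mu> S)"
      proof (intro exI[of _ c] ballI)
        fix T assume T: "T \<in> nsubsets (Suc N) l"
        have inj1: "inj_on (image Suc) (nsubsets N l)"
          by (rule inj_on_inverseI[of _ dn]) simp
        have inj2: "inj_on (\<lambda>\<mu>. insert 0 (Suc ` \<mu>)) (nsubsets N k)"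
          by (rule inj_on_inverseI[of _ dn]) simp
        have "image Suc ` nsubsets N l \<inter> (\<lambda>\<mu>. insert 0 (Suc ` \<mu>)) ` nsubsets N k = {}" by blast
        then have "(\<Sum>\<mu>\<in>nsubsets (Suc N) l. c \<mu> * g \<mu> T)
            = (\<Sum>\<mu>\<in>image Suc ` nsubsets N l. c \<mu> * g \<mu> T) + (\<Sum>\<mu>\<in>(\<lambda>\<mu>. insert 0 (Suc ` \<mu>)) ` nsubsets N k. c \<mu> * g \<mu> T)"
          unfolding S by (simp add: sum.union_disjoint)
        also have "\<dots> = Q T * (\<Sum>\<mu>\<in>nsubsets N l. c1 \<mu> * g1 \<mu> T) + (\<Sum>\<mu>\<in>nsubsets N k. c2 \<mu> * h \<mu> T)"
          by (simp add: sum.reindex[OF inj1] sum.reindex[OF inj2] c_def g_def sum_distrib_left mult.left_commute)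
        also have "\<dots> = u T"
        proof (cases "N \<in> T")
          case True
          have fin: "finite T" "card T = l" using T by (auto simp: nsubsets_def intro: finite_subset)
          have "Q T = 0" unfolding Q(2)[OF fin] using True fin(1) by (intro prod_zero) auto
          moreover have "T - {N} \<in> nsubsets N k"
            using T True fin l by (auto simp: nsubsets_def less_Suc_eq)
          moreover have "insert N (T - {N}) = T" using True by blast
          ultimately show ?thesis
            using c2 h(2)[OF _ fin(1) True] by (metis (no_types, lifting) add.left_neutral mult_zero_left sum.cong)
        next
          case False
          then have T': "T \<in> nsubsets N l" using T by (auto simp: nsubsets_def less_Suc_eq)
          have fin: "finite T" "card T = l" using T by (auto simp: nsubsets_def intro: finite_subset)
          have "z j \<noteq> z N" if "j \<in> T" for j
            using that T' inj_onD[OF Suc.prems, of j N] by (auto simp: nsubsets_def)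
          then have "Q T \<noteq> 0" using Q(2)[OF fin] fin(1) by simp
          moreover have "(\<Sum>\<mu>\<in>nsubsets N l. c1 \<mu> * g1 \<mu> T) = (u T - (\<Sum>\<mu>\<in>nsubsets N k. c2 \<mu> * h \<mu> T)) / Q T"
            using c1 T' by simp
          ultimately show ?thesis by simp
        qed
        finally show "u T = (\<Sum>\<mu>\<in>nsubsets (Suc N) l. c \<mu> * g \<mu> T)" by simp
      qed
    qed
  qed
qed


section \<open>Alternants\<close>

text \<open>
  The fermionic counterpart of \<open>create\<close>; iterating it is Laplace expansion along the first row.
\<close>

definition acreate :: "(nat \<Rightarrow> complex) \<Rightarrow> (nat set \<Rightarrow> complex) \<Rightarrow> nat set \<Rightarrow> complex" where
  "acreate \<phi> u = (\<lambda>S. \<Sum>j\<in>S. (- 1) ^ card {k \<in> S. k < j} * \<phi> j * u (S - {j}))"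

text \<open>
  The determinant with entries \<open>z_j^i\<close>, where \<open>i\<close> runs through the list and \<open>j\<close> through \<open>S\<close> in
  increasing order; it is \<open>0\<close> if the numbers of rows and columns differ.
\<close>

definition alternant :: "(nat \<Rightarrow> complex) \<Rightarrow> nat list \<Rightarrow> nat set \<Rightarrow> complex" where
  "alternant z is = foldr (\<lambda>i. acreate (\<lambda>j. z j ^ i)) is (\<lambda>S. if S = {} then 1 else 0)"

lemma alternant_Nil: "alternant z [] = (\<lambda>S. if S = {} then 1 else 0)"
  and alternant_Cons: "alternant z (i # is) = acreate (\<lambda>j. z j ^ i) (alternant z is)"
  by (simp_all add: alternant_def)

lemma linmap_acreate: "linmap (acreate \<phi>)"
  by (auto simp: linmap_def acreate_def cscale_def algebra_simps sum.distrib sum_distrib_left)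

lemma acreate_anticommute: "acreate \<phi> (acreate \<psi> u) = - acreate \<psi> (acreate \<phi> u)"
proof
  fix S
  show "acreate \<phi> (acreate \<psi> u) S = (- acreate \<psi> (acreate \<phi> u)) S"
  proof (cases "finite S")
    case True
    define s where "s j S = (- 1 :: complex) ^ card {k \<in> S. k < j}" for j :: nat and S
    have s: "s j S * s k (S - {j}) = - (s k S * s j (S - {k}))" if "j < k" "j \<in> S" "k \<in> S" for j k
    proof -
      have "{i \<in> S - {k}. i < j} = {i \<in> S. i < j}" using that by auto
      moreover have "{i \<in> S. i < k} = insert j {i \<in> S - {j}. i < k}" using that by auto
      then have "card {i \<in> S. i < k} = Suc (card {i \<in> S - {j}. i < k})" using True by simp
      ultimately show ?thesis by (simp add: s_def)
    qed
    have s': "s j S * s k (S - {j}) = - (s k S * s j (S - {k}))" if "j \<noteq> k" "j \<in> S" "k \<in> S" for j k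
      using that s[of j k] s[of k j] by (cases "j < k") auto
    have "acreate \<phi> (acreate \<psi> u) S
        = (\<Sum>j\<in>S. \<Sum>k\<in>S - {j}. s j S * s k (S - {j}) * (\<phi> j * \<psi> k * u (S - {j} - {k})))"
      unfolding acreate_def sum_distrib_left s_def[symmetric] by (intro sum.cong refl) (simp add: ac_simps)
    also have "\<dots> = (\<Sum>k\<in>S. \<Sum>j\<in>S - {k}. s j S * s k (S - {j}) * (\<phi> j * \<psi> k * u (S - {j} - {k})))"
      by (rule sum_distinct_pairs_swap[OF True])
    also have "\<dots> = (\<Sum>k\<in>S. \<Sum>j\<in>S - {k}. - (s k S * s j (S - {k})) * (\<phi> j * \<psi> k * u (S - {k} - {j})))"
    proof (intro sum.cong refl)
      fix k j assume "k \<in> S" "j \<in> S - {k}"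
      then have "s j S * s k (S - {j}) = - (s k S * s j (S - {k}))" by (intro s') auto
      moreover have "S - {j} - {k} = S - {k} - {j}" by blast
      ultimately show "s j S * s k (S - {j}) * (\<phi> j * \<psi> k * u (S - {j} - {k}))
          = - (s k S * s j (S - {k})) * (\<phi> j * \<psi> k * u (S - {k} - {j}))"
        by (simp only:)
    qed
    also have "\<dots> = - acreate \<psi> (acreate \<phi> u) S"
      unfolding acreate_def sum_distrib_left s_def[symmetric] sum_negf[symmetric]
      by (intro sum.cong refl) (simp add: ac_simps)
    finally show ?thesis by simp
  qed (simp add: acreate_def)
qed

lemma alternant_swap: "alternant z (i # j # is) = - alternant z (j # i # is)"
  unfolding alternant_Cons by (rule acreate_anticommute)

text \<open>
  A power sum acts on alternants as a derivation.  In contrast to \<open>psum_inj_sum\<close> no longer list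
  occurs, as the base function vanishes on nonempty sets.
\<close>

lemma psum_alternant:
  "psum z r S * alternant z is S = (\<Sum>t<length is. alternant z (is[t := is ! t + r]) S)"
proof (induction "is" arbitrary: S)
  case Nil
  then show ?case by (simp add: psum_def alternant_Nil)
next
  case (Cons k "is")
  show ?case
  proof (cases "finite S")
    case False
    have alternant_0: "alternant z xs S = 0" if "xs \<noteq> []" for xs
      using that False by (cases xs) (simp_all add: alternant_Cons acreate_def)
    have "(\<Sum>t<length (k # is). alternant z ((k # is)[t := (k # is) ! t + r]) S) = 0"
      by (intro sum.neutral ballI alternant_0) (simp_all split: nat.split)
    then show ?thesis using False by (simp only: psum_def sum.infinite) simp
  next
    case True
    have "psum z r S * alternant z (k # is) S
        = (\<Sum>j\<in>S. (- 1) ^ card {k \<in> S. k < j} * z j ^ k * (psum z r S * alternant z is (S - {j})))"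
      by (simp add: alternant_Cons acreate_def sum_distrib_left mult.left_commute)
    also have "\<dots> = (\<Sum>j\<in>S. (- 1) ^ card {k \<in> S. k < j} * z j ^ (k + r) * alternant z is (S - {j})
        + (\<Sum>t<length is. (- 1) ^ card {k \<in> S. k < j} * z j ^ k * alternant z (is[t := is ! t + r]) (S - {j})))"
    proof (rule sum.cong[OF refl])
      fix j assume j: "j \<in> S"
      show "(- 1) ^ card {k \<in> S. k < j} * z j ^ k * (psum z r S * alternant z is (S - {j}))
        = (- 1) ^ card {k \<in> S. k < j} * z j ^ (k + r) * alternant z is (S - {j})
        + (\<Sum>t<length is. (- 1) ^ card {k \<in> S. k < j} * z j ^ k * alternant z (is[t := is ! t + r]) (S - {j}))"
        unfolding psum_remove[OF True j] distrib_right Cons.IH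
        by (simp add: algebra_simps power_add sum_distrib_left)
    qed
    also have "\<dots> = alternant z ((k + r) # is) S + (\<Sum>t<length is. alternant z (k # is[t := is ! t + r]) S)"
      unfolding sum.distrib by (subst sum.swap) (simp add: alternant_Cons acreate_def)
    finally show ?thesis by (simp add: sum.lessThan_Suc_shift del: sum.lessThan_Suc)
  qed
qed

lemma alternant_insort: "\<exists>c. alternant z (i # js) = cscale c (alternant z (insort i js))"
proof (induction js)
  case Nil
  then show ?case by (intro exI[of _ 1]) (simp add: cscale_def)
next
  case (Cons j js)
  show ?case
  proof (cases "i \<le> j")
    case True
    then show ?thesis by (intro exI[of _ 1]) (simp add: cscale_def)
  next
    case False
    obtain c where c: "alternant z (i # js) = cscale c (alternant z (insort i js))" using Cons by blast
    have "alternant z (i # j # js) = - acreate (\<lambda>k. z k ^ j) (alternant z (i # js))"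
      by (subst alternant_swap) (simp add: alternant_Cons)
    also have "\<dots> = - cscale c (acreate (\<lambda>k. z k ^ j) (alternant z (insort i js)))"
      using linmap_acreate c by (simp add: linmap_def)
    also have "\<dots> = cscale (- c) (alternant z (insort i (j # js)))"
      using False by (auto simp: cscale_def alternant_Cons)
    finally show ?thesis by blast
  qed
qed

lemma alternant_sort: "\<exists>c. alternant z is = cscale c (alternant z (sort is))"
proof (induction "is")
  case Nil
  then show ?case by (intro exI[of _ 1]) (simp add: cscale_def)
next
  case (Cons i "is")
  then obtain c where c: "alternant z is = cscale c (alternant z (sort is))" by blast
  obtain d where d: "alternant z (i # sort is) = cscale d (alternant z (insort i (sort is)))" using alternant_insort by blast
  have "alternant z (i # is) = cscale c (alternant z (i # sort is))"
    using linmap_acreate c by (simp add: linmap_def alternant_Cons)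
  also have "\<dots> = cscale (c * d) (alternant z (sort (i # is)))"
    unfolding d by (auto simp: cscale_def)
  finally show ?case by blast
qed

lemma alternant_repeat: "alternant z (i # i # is) = 0"
proof -
  have "alternant z (i # i # is) S = - alternant z (i # i # is) S" for S
    using fun_cong[OF alternant_swap[of z i i "is"], of S] by simp
  then have "2 * alternant z (i # i # is) S = 0" for S
    unfolding mult_2 using eq_neg_iff_add_eq_0 by blast
  then have "alternant z (i # i # is) S = 0" for S by simp
  then show ?thesis by (auto simp: zero_fun_def)
qed

lemma alternant_sorted_not_distinct: "sorted is \<Longrightarrow> \<not> distinct is \<Longrightarrow> alternant z is = 0"
proof (induction "is")
  case (Cons i "is")
  show ?case
  proof (cases "distinct is")
    case True
    then have "i \<in> set is" using Cons.prems by simp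
    then obtain js where "is = i # js"
      using Cons.prems by (cases "is") (auto simp: order.antisym)
    then show ?thesis by (simp add: alternant_repeat)
  next
    case False
    then have "alternant z is = 0" using Cons.prems by (intro Cons.IH) simp_all
    show ?thesis unfolding alternant_Cons \<open>alternant z is = 0\<close> by (rule linmap_0[OF linmap_acreate])
  qed
qed simp

lemma alternant_not_distinct:
  assumes "\<not> distinct is"
  shows "alternant z is = 0"
proof -
  obtain c where "alternant z is = cscale c (alternant z (sort is))" using alternant_sort by blast
  moreover have "alternant z (sort is) = 0"
    using assms by (intro alternant_sorted_not_distinct) auto
  ultimately show ?thesis by (metis cfun.scale_zero_right)
qed

text \<open>
  The remainder of \<open>x^i\<close> modulo the polynomial with roots \<open>z_j\<close>; division does not raise the degree.
\<close>

lemma power_reduce: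
  fixes z :: "nat \<Rightarrow> complex"
  assumes "finite J"
  shows "\<exists>d. (\<forall>j\<in>J. z j ^ i = (\<Sum>k<card J. d k * z j ^ k)) \<and> (\<forall>k. i < k \<longrightarrow> d k = 0)"
proof (cases "J = {}")
  case True
  then show ?thesis by (intro exI[of _ "\<lambda>_. 0"]) simp
next
  case False
  define p where "p = (\<Prod>j\<in>J. [:- z j, 1:])"
  define q where "q = monom (1 :: complex) i mod p"
  have deg: "degree p = card J" unfolding p_def by (subst degree_prod_eq_sum_degree) auto
  have K: "card J > 0" using False assms by (simp add: card_gt_0_iff)
  then have "degree q < card J" unfolding q_def using deg degree_mod_less'[of p] by (metis degree_0 degree_mod_less gr_implies_not0)
  have "degree q \<le> i"
  proof (cases "i < card J")
    case True
    have "q = monom 1 i" unfolding q_def using True deg by (intro mod_poly_less) (simp add: degree_monom_eq)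
    then show ?thesis by (simp add: degree_monom_eq)
  qed (use \<open>degree q < card J\<close> in simp)
  show ?thesis
  proof (intro exI[of _ "coeff q"] conjI ballI allI impI)
    fix j assume j: "j \<in> J"
    have "poly p (z j) = 0" unfolding p_def poly_prod using j assms by (intro prod_zero) auto
    then have "z j ^ i = poly q (z j)"
      using div_mult_mod_eq[of "monom 1 i" p] unfolding q_def
      by (metis add.left_neutral mult_zero_right poly_add poly_monom poly_mult mult_1)
    also have "\<dots> = (\<Sum>k\<le>degree q. coeff q k * z j ^ k)" by (rule poly_altdef)
    also have "\<dots> = (\<Sum>k<card J. coeff q k * z j ^ k)"
      using \<open>degree q < card J\<close> by (intro sum.mono_neutral_left) (auto simp: coeff_eq_0)
    finally show "z j ^ i = (\<Sum>k<card J. coeff q k * z j ^ k)" .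
  next
    fix k assume "i < k"
    then show "coeff q k = 0" using \<open>degree q \<le> i\<close> by (intro coeff_eq_0) simp
  qed
qed

text \<open>
  Functions are compared on subsets of \<open>J\<close> only, because powers are reduced modulo the polynomial with the roots
  \<open>z_j\<close>, \<open>j \<in> J\<close>.
\<close>

definition below :: "'b set \<Rightarrow> ('b set \<Rightarrow> complex) \<Rightarrow> 'b set \<Rightarrow> complex" where
  "below J u = (\<lambda>S. if S \<subseteq> J then u S else 0)"

lemma linmap_below: "linmap (below J)"
  by (auto simp: linmap_def below_def cscale_def)

lemma below_acreate_cong:
  "(\<And>j. j \<in> J \<Longrightarrow> \<phi> j = \<psi> j) \<Longrightarrow> below J u = below J v \<Longrightarrow> below J (acreate \<phi> u) = below J (acreate \<psi> v)"
proof
  fix S assume 1: "\<And>j. j \<in> J \<Longrightarrow> \<phi> j = \<psi> j" and 2: "below J u = below J v"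
  have "u T = v T" if "T \<subseteq> J" for T using fun_cong[OF 2, of T] that by (simp add: below_def)
  moreover have "S - {j} \<subseteq> J" if "S \<subseteq> J" for j using that by blast
  ultimately show "below J (acreate \<phi> u) S = below J (acreate \<psi> v) S"
    using 1 by (auto simp: below_def acreate_def intro!: sum.cong)
qed

lemma below_idem: "below J (below J u) = below J u"
  by (auto simp: below_def)

lemma alternant_reduce:
  assumes "finite J"
  shows "below J (alternant z is) \<in> cfun.span {below J (alternant z js) | js.
    length js = length is \<and> set js \<subseteq> {..<card J} \<and> sum_list js \<le> sum_list is}"
proof (induction "is")
  case Nil
  show ?case by (rule cfun.span_base) auto
next
  case (Cons i "is")
  let ?G = "{below J (alternant z js) | js.
    length js = length (i # is) \<and> set js \<subseteq> {..<card J} \<and> sum_list js \<le> sum_list (i # is)}"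
  let ?F = "\<lambda>u. below J (acreate (\<lambda>j. z j ^ i) u)"
  obtain d where d: "\<forall>j\<in>J. z j ^ i = (\<Sum>k<card J. d k * z j ^ k)" "\<forall>k. i < k \<longrightarrow> d k = 0"
    using power_reduce[OF assms] by blast
  have "?F (below J (alternant z is)) \<in> cfun.span ?G"
    using linmap_comp[OF linmap_below linmap_acreate] Cons cfun.subspace_span
  proof (rule span_linmap_in)
    fix g assume "g \<in> {below J (alternant z js) |js.
      length js = length is \<and> set js \<subseteq> {..<card J} \<and> sum_list js \<le> sum_list is}"
    then obtain js where g: "g = below J (alternant z js)"
      and js: "length js = length is" "set js \<subseteq> {..<card J}" "sum_list js \<le> sum_list is" by blast
    have "?F g = below J (acreate (\<lambda>j. \<Sum>k<card J. d k * z j ^ k) (alternant z js))"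
      unfolding g by (rule below_acreate_cong) (auto simp: d(1) below_idem)
    also have "acreate (\<lambda>j. \<Sum>k<card J. d k * z j ^ k) (alternant z js) = (\<Sum>k<card J. cscale (d k) (alternant z (k # js)))"
    proof
      fix S
      have "acreate (\<lambda>j. \<Sum>k<card J. d k * z j ^ k) (alternant z js) S
        = (\<Sum>j\<in>S. \<Sum>k<card J. d k * ((- 1) ^ card {k \<in> S. k < j} * z j ^ k * alternant z js (S - {j})))"
        by (simp add: acreate_def sum_distrib_left sum_distrib_right ac_simps)
      then show "acreate (\<lambda>j. \<Sum>k<card J. d k * z j ^ k) (alternant z js) S = (\<Sum>k<card J. cscale (d k) (alternant z (k # js))) S"
        by (subst (asm) sum.swap) (simp add: sum_fun_apply cscale_def alternant_Cons acreate_def sum_distrib_left)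
    qed
    also have "below J (\<Sum>k<card J. cscale (d k) (alternant z (k # js))) = (\<Sum>k<card J. cscale (d k) (below J (alternant z (k # js))))"
      by (simp add: linmap_sum[OF linmap_below] linmap_scale[OF linmap_below])
    also have "\<dots> \<in> cfun.span ?G"
    proof (rule cfun.span_sum)
      fix k assume k: "k \<in> {..<card J}"
      show "cscale (d k) (below J (alternant z (k # js))) \<in> cfun.span ?G"
      proof (cases "k \<le> i")
        case True
        then show ?thesis using k js
          by (intro cfun.span_scale cfun.span_base) (auto intro!: exI[of _ "k # js"])
      next
        case False
        then have "cscale (d k) (below J (alternant z (k # js))) = 0" using d(2) by (metis cfun.scale_zero_left not_le)
        then show ?thesis by (simp only: cfun.span_zero)
      qed
    qed
    finally show "?F g \<in> cfun.span ?G" .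
  qed
  moreover have "?F (below J (alternant z is)) = below J (alternant z (i # is))"
    unfolding alternant_Cons by (rule below_acreate_cong) (auto simp: below_idem)
  ultimately show ?case by simp
qed

text \<open>
  Modulo sign, only sorted lists of distinct exponents below \<open>card J\<close> remain, that is, subsets.
\<close>

lemma alternant_reduce_sorted:
  assumes "finite J"
  shows "below J (alternant z is) \<in> cfun.span ((\<lambda>\<mu>. below J (alternant z (sorted_list_of_set \<mu>))) `
    {\<mu> \<in> nsubsets (card J) (length is). \<Sum>\<mu> \<le> sum_list is})"
proof -
  let ?G = "(\<lambda>\<mu>. below J (alternant z (sorted_list_of_set \<mu>))) ` {\<mu> \<in> nsubsets (card J) (length is). \<Sum>\<mu> \<le> sum_list is}"
  have "{below J (alternant z js) | js. length js = length is \<and> set js \<subseteq> {..<card J} \<and> sum_list js \<le> sum_list is}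
      \<subseteq> cfun.span ?G"
  proof safe
    fix js assume js: "length js = length is" "set js \<subseteq> {..<card J}" "sum_list js \<le> sum_list is"
    obtain c where c: "alternant z js = cscale c (alternant z (sort js))" using alternant_sort by blast
    show "below J (alternant z js) \<in> cfun.span ?G"
    proof (cases "distinct js")
      case True
      then have "sort js = sorted_list_of_set (set js)"
        by (metis sorted_list_of_set_sort_remdups distinct_remdups_id)
      moreover have "set js \<in> {\<mu> \<in> nsubsets (card J) (length is). \<Sum>\<mu> \<le> sum_list is}"
        unfolding nsubsets_def mem_Collect_eq distinct_card[OF True] distinct_sum_list_conv_Sum[OF True, symmetric]
        using js by blast
      ultimately have "below J (alternant z (sort js)) \<in> ?G" by (simp only: image_eqI)
      then show ?thesis
        unfolding c linmap_scale[OF linmap_below] by (intro cfun.span_scale cfun.span_base)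
    next
      case False
      then have "below J (alternant z js) = 0" by (metis alternant_not_distinct linmap_0[OF linmap_below])
      then show ?thesis by (metis cfun.span_zero)
    qed
  qed
  then have "cfun.span {below J (alternant z js) | js. length js = length is \<and> set js \<subseteq> {..<card J} \<and> sum_list js \<le> sum_list is}
      \<subseteq> cfun.span ?G" by (rule cfun.span_minimal) (rule cfun.subspace_span)
  then show ?thesis using alternant_reduce[OF assms] by blast
qed

text \<open>
  The Vandermonde determinant.  Fix \<open>a \<in> S\<close> and let \<open>q\<close> be the monic polynomial with roots \<open>z_j\<close>, \<open>j \<noteq> a\<close>.
  Replacing the row of the highest power by the values of \<open>q\<close> does not change the determinant, and its
  expansion then has a single term.
\<close>

lemma alternant_nonzero:
  assumes "finite S" "inj_on z S"
  shows "alternant z (rev [0..<card S]) S \<noteq> 0"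
  using assms
proof (induction "card S" arbitrary: S)
  case 0
  then show ?case by (simp add: alternant_Nil)
next
  case (Suc l)
  obtain a where a: "a \<in> S" using Suc.hyps(2) by fastforce
  let ?T = "S - {a}" and ?\<Delta> = "alternant z (rev [0..<l])"
  have T: "card ?T = l" "finite ?T" "inj_on z ?T"
    using Suc a by (auto simp: card_Diff_singleton_if inj_on_def)
  then have IH: "?\<Delta> ?T \<noteq> 0" using Suc.hyps(1)[of ?T] by simp
  \<comment> \<open>adding lower rows turns the row of the power \<open>l\<close> into the values of this monic polynomial\<close>
  define q where "q = (\<Prod>j\<in>?T. [:- z j, 1:])"
  have deg: "degree q = l" unfolding q_def by (subst degree_prod_eq_sum_degree) (auto simp: T)
  have lead: "coeff q l = 1" unfolding deg[symmetric] q_def by (simp add: lead_coeff_prod)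
  have "acreate (\<lambda>j. poly q (z j)) ?\<Delta> S = (- 1) ^ card {k \<in> S. k < a} * poly q (z a) * ?\<Delta> ?T"
  proof -
    have "poly q (z j) = 0" if "j \<in> S" "j \<noteq> a" for j
      unfolding q_def poly_prod using that T(2) by (intro prod_zero) auto
    then show ?thesis using Suc.prems(1) a by (simp add: acreate_def sum.remove)
  qed
  moreover have "poly q (z a) \<noteq> 0"
    unfolding q_def poly_prod using T(2) Suc.prems(2) a by (auto simp: inj_on_def)
  ultimately have nz: "acreate (\<lambda>j. poly q (z j)) ?\<Delta> S \<noteq> 0" using IH by simp
  have "acreate (\<lambda>j. poly q (z j)) ?\<Delta> S = (\<Sum>k\<le>l. coeff q k * alternant z (k # rev [0..<l]) S)"
  proof -
    have "acreate (\<lambda>j. poly q (z j)) ?\<Delta> S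
      = (\<Sum>j\<in>S. \<Sum>k\<le>l. coeff q k * ((- 1) ^ card {k \<in> S. k < j} * z j ^ k * ?\<Delta> (S - {j})))"
      by (simp add: acreate_def poly_altdef deg sum_distrib_left sum_distrib_right ac_simps)
    then show ?thesis
      by (subst (asm) sum.swap) (simp add: alternant_Cons acreate_def sum_distrib_left)
  qed
  also have "\<dots> = (\<Sum>k\<le>l. if k = l then alternant z (l # rev [0..<l]) S else 0)"
  proof (intro sum.cong refl)
    fix k assume "k \<in> {..l}"
    then have "k \<noteq> l \<Longrightarrow> alternant z (k # rev [0..<l]) = 0" by (intro alternant_not_distinct) auto
    then show "coeff q k * alternant z (k # rev [0..<l]) S = (if k = l then alternant z (l # rev [0..<l]) S else 0)"
      using lead by auto
  qed
  also have "\<dots> = alternant z (rev [0..<card S]) S" using Suc.hyps(2)[symmetric] by simp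
  finally show ?case using nz by simp
qed

definition on_level :: "nat \<Rightarrow> nat \<Rightarrow> (nat set \<Rightarrow> complex) \<Rightarrow> nat set \<Rightarrow> complex" where
  "on_level N l u = (\<lambda>S. if S \<in> nsubsets N l then u S else 0)"

lemma linmap_on_level: "linmap (on_level N l)"
  by (auto simp: linmap_def on_level_def cscale_def)

lemma sum_rev_upt: "sum_list (rev [0..<l]) = l choose 2"
  by (induction l) (simp_all add: numeral_2_eq_2)

lemma sympoly_mult_alternant:
  assumes "u \<in> sympoly z d"
  shows "(\<lambda>S. u S * alternant z (rev [0..<l]) S) \<in>
    cfun.span {alternant z js | js. length js = l \<and> sum_list js \<le> d + (l choose 2)}"
proof -
  define Z where "Z d = cfun.span {alternant z js | js. length js = l \<and> sum_list js \<le> d + (l choose 2)}" for d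
  have psum: "(\<lambda>S. psum z r S * v S) \<in> Z (r + d)" if "v \<in> Z d" for r d v
    using linmap_mult[of "psum z r"] that[unfolded Z_def] cfun.subspace_span unfolding Z_def
  proof (rule span_linmap_in)
    fix g assume "g \<in> {alternant z js | js. length js = l \<and> sum_list js \<le> d + (l choose 2)}"
    then obtain js where js: "g = alternant z js" "length js = l" "sum_list js \<le> d + (l choose 2)" by blast
    have "(\<lambda>S. psum z r S * g S) = (\<Sum>t<length js. alternant z (js[t := js ! t + r]))"
      by (rule ext) (simp add: js(1) psum_alternant sum_fun_apply)
    also have "\<dots> \<in> cfun.span {alternant z js | js. length js = l \<and> sum_list js \<le> r + d + (l choose 2)}"
    proof (intro cfun.span_sum cfun.span_base)
      fix t assume "t \<in> {..<length js}"
      then have "sum_list (js[t := js ! t + r]) \<le> r + d + (l choose 2)"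
        using js by (simp add: sum_list_update_add)
      then show "alternant z (js[t := js ! t + r]) \<in> {alternant z js | js. length js = l \<and> sum_list js \<le> r + d + (l choose 2)}"
        using js(2) by (intro CollectI exI[of _ "js[t := js ! t + r]"]) simp
    qed
    finally show "(\<lambda>S. psum z r S * g S) \<in> cfun.span {alternant z js | js. length js = l \<and> sum_list js \<le> r + d + (l choose 2)}" .
  qed
  have gen: "(\<lambda>S. pprod z rs S * alternant z (rev [0..<l]) S) \<in> Z (sum_list rs)" for rs
  proof (induction rs)
    case Nil
    have "alternant z (rev [0..<l]) \<in> Z 0"
      unfolding Z_def by (intro cfun.span_base CollectI exI[of _ "rev [0..<l]"] conjI refl)
        (simp, simp only: sum_rev_upt)
    then show ?case by (simp add: pprod_def)
  next
    case (Cons r rs)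
    then show ?case using psum[OF Cons, of r] by (simp add: pprod_def mult.assoc)
  qed
  have mono: "Z a \<subseteq> Z b" if "a \<le> b" for a b
    unfolding Z_def using that by (intro cfun.span_mono) auto
  have "(\<lambda>S. alternant z (rev [0..<l]) S * u S) \<in> Z d"
    using linmap_mult assms[unfolded sympoly_def]
  proof (rule span_linmap_in)
    show "cfun.subspace (Z d)" by (simp add: Z_def cfun.subspace_span)
    fix g assume "g \<in> {pprod z rs |rs. sum_list rs \<le> d}"
    then obtain rs where "g = pprod z rs" "sum_list rs \<le> d" by blast
    then show "(\<lambda>S. alternant z (rev [0..<l]) S * g S) \<in> Z d"
      using gen[of rs] mono[of "sum_list rs" d] by (auto simp: mult.commute)
  qed
  then show ?thesis by (simp add: Z_def mult.commute)
qed

text \<open>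
  Multiplication by the Vandermonde determinant is injective on functions on \<open>l\<close>-sets and takes symmetric
  polynomials of degree at most \<open>d\<close> to combinations of alternants of degree at most \<open>d + (l choose 2)\<close>.
\<close>

lemma sympoly_on_level_upper:
  assumes "inj_on z {..<N}" "u \<in> sympoly z d"
  shows "on_level N l u \<in> cfun.span ((\<lambda>\<mu>. on_level N l
      (\<lambda>S. alternant z (sorted_list_of_set \<mu>) S / alternant z (rev [0..<l]) S)) ` {\<mu> \<in> nsubsets N l. \<Sum>\<mu> \<le> d + (l choose 2)})"
proof -
  define \<Delta> where "\<Delta> = alternant z (rev [0..<l])"
  define J where "J = {..<N}"
  \<comment> \<open>division by the Vandermonde determinant undoes the multiplication\<close>
  define F where "F v = on_level N l (\<lambda>S. below J v S / \<Delta> S)" for v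
  let ?G = "(\<lambda>\<mu>. on_level N l (\<lambda>S. alternant z (sorted_list_of_set \<mu>) S / \<Delta> S)) ` {\<mu> \<in> nsubsets N l. \<Sum>\<mu> \<le> d + (l choose 2)}"
  have F: "linmap F"
    by (auto simp: linmap_def F_def on_level_def below_def cscale_def add_divide_distrib)
  have Fb: "F (below J v) = F v" for v by (simp add: F_def below_idem)
  have Fon: "F v = on_level N l (\<lambda>S. v S / \<Delta> S)" for v
    by (auto simp: F_def on_level_def below_def J_def nsubsets_def)
  have nz: "\<Delta> S \<noteq> 0" if "S \<in> nsubsets N l" for S
  proof -
    have "finite S" "card S = l" "inj_on z S"
      using that assms(1) by (auto simp: nsubsets_def intro: finite_subset inj_on_subset)
    then show ?thesis using alternant_nonzero[of S z] by (simp add: \<Delta>_def)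
  qed
  have "on_level N l u = F (\<lambda>S. u S * \<Delta> S)"
    unfolding Fon using nz by (auto simp: on_level_def)
  also have "\<dots> \<in> cfun.span ?G"
    using F sympoly_mult_alternant[OF assms(2), of l] cfun.subspace_span unfolding \<Delta>_def[symmetric]
  proof (rule span_linmap_in)
    fix g assume "g \<in> {alternant z js | js. length js = l \<and> sum_list js \<le> d + (l choose 2)}"
    then obtain js where js: "g = alternant z js" "length js = l" "sum_list js \<le> d + (l choose 2)" by blast
    have "below J g \<in> cfun.span ((\<lambda>\<mu>. below J (alternant z (sorted_list_of_set \<mu>))) `
        {\<mu> \<in> nsubsets (card J) (length js). \<Sum>\<mu> \<le> sum_list js})"
      unfolding js(1) by (rule alternant_reduce_sorted) (simp add: J_def)
    with F have "F (below J g) \<in> cfun.span ?G"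
      using cfun.subspace_span
    proof (rule span_linmap_in)
      fix h assume "h \<in> (\<lambda>\<mu>. below J (alternant z (sorted_list_of_set \<mu>))) ` {\<mu> \<in> nsubsets (card J) (length js). \<Sum>\<mu> \<le> sum_list js}"
      then obtain \<mu> where \<mu>: "h = below J (alternant z (sorted_list_of_set \<mu>))" "\<mu> \<in> nsubsets N l" "\<Sum>\<mu> \<le> d + (l choose 2)"
        using js by (auto simp: J_def)
      then have "F h \<in> ?G" unfolding \<mu>(1) Fb unfolding Fon by blast
      then show "F h \<in> cfun.span ?G" by (rule cfun.span_base)
    qed
    then show "F g \<in> cfun.span ?G" by (simp add: Fb)
  qed
  finally show ?thesis by (simp add: \<Delta>_def)
qed

text \<open>
  On \<open>l\<close>-sets the symmetrized monomials in exactly \<open>l\<close> variables suffice: they are closed under power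
  sums, since the longer term in \<open>psum_inj_sum\<close> vanishes there, and contain the constants.
\<close>

lemma on_level_sympoly_eq:
  "on_level N l ` sympoly z d
    = cfun.span {on_level N l (inj_sum z is) | is. length is = l \<and> sum_list is \<le> d}"
proof (intro equalityI)
  have "inj_sum z is \<in> sympoly z d" if "sum_list is \<le> d" for "is"
    using inj_sum_in_sympoly sympoly_mono[OF that] by blast
  then have "{on_level N l (inj_sum z is) | is. length is = l \<and> sum_list is \<le> d} \<subseteq> on_level N l ` sympoly z d"
    by blast
  moreover have "cfun.subspace (on_level N l ` sympoly z d)"
    unfolding sympoly_def linmap_image_span[OF linmap_on_level] by (rule cfun.subspace_span)
  ultimately show "cfun.span {on_level N l (inj_sum z is) | is. length is = l \<and> sum_list is \<le> d}
      \<subseteq> on_level N l ` sympoly z d"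
    by (rule cfun.span_minimal)
next
  define Z where "Z d = cfun.span {on_level N l (inj_sum z is) | is. length is = l \<and> sum_list is \<le> d}" for d
  have mono: "Z a \<subseteq> Z b" if "a \<le> b" for a b
    unfolding Z_def using that by (intro cfun.span_mono) auto
  have psum: "(\<lambda>S. psum z r S * v S) \<in> Z (r + d)" if "v \<in> Z d" for r d v
    using linmap_mult[of "psum z r"] that[unfolded Z_def] cfun.subspace_span unfolding Z_def
  proof (rule span_linmap_in)
    fix g assume "g \<in> {on_level N l (inj_sum z is) | is. length is = l \<and> sum_list is \<le> d}"
    then obtain js where js: "g = on_level N l (inj_sum z js)" "length js = l" "sum_list js \<le> d" by blast
    have "inj_sum z (r # js) S = 0" if "S \<in> nsubsets N l" for S
      using that js by (intro inj_sum_eq_0) (auto simp: nsubsets_def intro: finite_subset)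
    then have "(\<lambda>S. psum z r S * g S) = (\<Sum>t<length js. on_level N l (inj_sum z (js[t := js ! t + r])))"
      by (intro ext) (auto simp: js(1) sum_fun_apply on_level_def psum_inj_sum)
    also have "\<dots> \<in> cfun.span {on_level N l (inj_sum z is) | is. length is = l \<and> sum_list is \<le> r + d}"
    proof (intro cfun.span_sum cfun.span_base)
      fix t assume "t \<in> {..<length js}"
      then have "sum_list (js[t := js ! t + r]) \<le> r + d"
        using js by (simp add: sum_list_update_add)
      then show "on_level N l (inj_sum z (js[t := js ! t + r]))
          \<in> {on_level N l (inj_sum z is) | is. length is = l \<and> sum_list is \<le> r + d}"
        using js(2) by (intro CollectI exI[of _ "js[t := js ! t + r]"]) simp
    qed
    finally show "(\<lambda>S. psum z r S * g S) \<in> cfun.span {on_level N l (inj_sum z is) | is. length is = l \<and> sum_list is \<le> r + d}" .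
  qed
  have one: "on_level N l (\<lambda>_. 1) \<in> Z 0"
  proof -
    have val: "inj_sum z (replicate l 0) S = fact l" if "finite S" "card S = l" for S l
      using that
    proof (induction l arbitrary: S)
      case (Suc l)
      have "inj_sum z (replicate (Suc l) 0) S = (\<Sum>j\<in>S. fact l)"
        unfolding replicate_Suc inj_sum_Cons create_def
        using Suc by (intro sum.cong refl) (simp add: card_Diff_singleton_if)
      then show ?case using Suc.prems by (simp add: algebra_simps)
    qed simp
    have "inj_sum z (replicate l 0) S = fact l" if "S \<in> nsubsets N l" for S
      using that by (intro val) (auto simp: nsubsets_def intro: finite_subset)
    then have "on_level N l (\<lambda>_. 1) = cscale (1 / fact l) (on_level N l (inj_sum z (replicate l 0)))"
      by (auto simp: on_level_def cscale_def)
    moreover have "on_level N l (inj_sum z (replicate l 0)) \<in> Z 0"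
      unfolding Z_def by (intro cfun.span_base CollectI exI[of _ "replicate l 0"]) (simp add: sum_list_replicate)
    ultimately show ?thesis unfolding Z_def by (simp add: cfun.span_scale)
  qed
  have gen: "on_level N l (pprod z rs) \<in> Z (sum_list rs)" for rs
  proof (induction rs)
    case Nil
    then show ?case using one by (simp add: pprod_def)
  next
    case (Cons r rs)
    have "on_level N l (pprod z (r # rs)) = (\<lambda>S. psum z r S * on_level N l (pprod z rs) S)"
      by (auto simp: on_level_def pprod_def)
    then show ?case using psum[OF Cons, of r] by simp
  qed
  have "on_level N l u \<in> Z d" if "u \<in> sympoly z d" for u
    using linmap_on_level that[unfolded sympoly_def]
  proof (rule span_linmap_in)
    show "cfun.subspace (Z d)" by (simp add: Z_def cfun.subspace_span)
    fix g assume "g \<in> {pprod z rs |rs. sum_list rs \<le> d}"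
    then obtain rs where "g = pprod z rs" "sum_list rs \<le> d" by blast
    then show "on_level N l g \<in> Z d" using gen[of rs] mono[of "sum_list rs" d] by auto
  qed
  then show "on_level N l ` sympoly z d \<subseteq> cfun.span {on_level N l (inj_sum z is) | is. length is = l \<and> sum_list is \<le> d}"
    unfolding Z_def by blast
qed

text \<open>
  The lower bound \<open>sympoly_spanning_family\<close> and the upper bound \<open>sympoly_on_level_upper\<close> agree.
\<close>

theorem level_basis:
  assumes "inj_on z {..<N}"
  shows "\<exists>g. inj_on g (nsubsets N l) \<and> cfun.independent (g ` nsubsets N l) \<and>
    (\<forall>\<mu>\<in>nsubsets N l. l choose 2 \<le> \<Sum>\<mu>) \<and>
    (\<forall>d. cfun.span {on_level N l (inj_sum z is) | is. length is = l \<and> sum_list is \<le> d}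
       = cfun.span (g ` {\<mu> \<in> nsubsets N l. \<Sum>\<mu> \<le> d + (l choose 2)}))"
proof -
  obtain g where g: "\<forall>\<mu>\<in>nsubsets N l. \<exists>d. \<Sum>\<mu> = d + (l choose 2) \<and> g \<mu> \<in> sympoly z d"
      "\<forall>u. \<exists>c. \<forall>S\<in>nsubsets N l. u S = (\<Sum>\<mu>\<in>nsubsets N l. c \<mu> * g \<mu> S)"
    using sympoly_spanning_family[OF assms] by blast
  define h where "h \<mu> = on_level N l (g \<mu>)" for \<mu>
  have span: "delta ` nsubsets N l \<subseteq> cfun.span (h ` nsubsets N l)"
  proof safe
    fix T assume T: "T \<in> nsubsets N l"
    obtain c where c: "\<forall>S\<in>nsubsets N l. delta T S = (\<Sum>\<mu>\<in>nsubsets N l. c \<mu> * g \<mu> S)" using g(2) by blast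
    have outside: "delta T S = 0" if "S \<notin> nsubsets N l" for S using that T by (auto simp: delta_def)
    then have "delta T = (\<Sum>\<mu>\<in>nsubsets N l. cscale (c \<mu>) (h \<mu>))"
    proof (intro ext)
      fix S show "delta T S = (\<Sum>\<mu>\<in>nsubsets N l. cscale (c \<mu>) (h \<mu>)) S"
        using c outside
        by (cases "S \<in> nsubsets N l") (simp_all add: sum_fun_apply cscale_def h_def on_level_def)
    qed
    then show "delta T \<in> cfun.span (h ` nsubsets N l)"
      by (simp add: cfun.span_sum cfun.span_scale cfun.span_base)
  qed
  have card: "card (delta ` nsubsets N l) = card (nsubsets N l)"
    by (intro card_image inj_on_subset[OF inj_delta] subset_UNIV)
  note fam = independent_family_if_card[OF finite_nsubsets independent_delta[OF finite_nsubsets] span card]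
  note inj = fam(1) and ind = fam(2)
  have "on_level N l ` sympoly z d = cfun.span (h ` {\<mu> \<in> nsubsets N l. \<Sum>\<mu> \<le> d + (l choose 2)})" for d
  proof (rule equalityI)
    let ?I = "{\<mu> \<in> nsubsets N l. \<Sum>\<mu> \<le> d + (l choose 2)}"
    have sub: "h ` ?I \<subseteq> on_level N l ` sympoly z d"
    proof safe
      fix \<mu> assume \<mu>: "\<mu> \<in> nsubsets N l" "\<Sum>\<mu> \<le> d + (l choose 2)"
      then obtain e where "\<Sum>\<mu> = e + (l choose 2)" "g \<mu> \<in> sympoly z e" using g(1) by blast
      then have "g \<mu> \<in> sympoly z d" using \<mu>(2) sympoly_mono[of e d z] by auto
      then show "h \<mu> \<in> on_level N l ` sympoly z d" by (simp add: h_def)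
    qed
    then show "cfun.span (h ` ?I) \<subseteq> on_level N l ` sympoly z d"
      unfolding on_level_sympoly_eq by (rule cfun.span_minimal) (rule cfun.subspace_span)
    let ?T = "(\<lambda>\<mu>. on_level N l (\<lambda>S. alternant z (sorted_list_of_set \<mu>) S / alternant z (rev [0..<l]) S)) ` ?I"
    have "cfun.independent (h ` ?I)" using ind by (rule cfun.independent_mono) auto
    moreover have "on_level N l ` sympoly z d \<subseteq> cfun.span ?T"
      using sympoly_on_level_upper[OF assms] by blast
    moreover have "card ?T \<le> card (h ` ?I)"
    proof -
      have "card (h ` ?I) = card ?I" by (intro card_image inj_on_subset[OF inj]) auto
      then show ?thesis using card_image_le[of ?I] by simp
    qed
    ultimately show "on_level N l ` sympoly z d \<subseteq> cfun.span (h ` ?I)"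
      using sub by (intro independent_spans_if_card[of "h ` ?I" _ ?T]) auto
  qed
  moreover have "\<forall>\<mu>\<in>nsubsets N l. l choose 2 \<le> \<Sum>\<mu>"
    using g(1) by (metis le_add2)
  ultimately show ?thesis using inj ind unfolding on_level_sympoly_eq by blast
qed


section \<open>The current algebra acting on tensors\<close>

definition sl2_f :: "complex^2^2" where
  "sl2_f = vector [vector [0, 0], vector [1, 0]]"

definition sl2_h :: "complex^2^2" where
  "sl2_h = vector [vector [1, 0], vector [0, - 1]]"

lemma sl2_entries [simp]:
  "sl2_e $ 1 $ 1 = 0" "sl2_e $ 1 $ 2 = 1" "sl2_e $ 2 $ 1 = 0" "sl2_e $ 2 $ 2 = 0"
  "sl2_f $ 1 $ 1 = 0" "sl2_f $ 1 $ 2 = 0" "sl2_f $ 2 $ 1 = 1" "sl2_f $ 2 $ 2 = 0"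
  "sl2_h $ 1 $ 1 = 1" "sl2_h $ 1 $ 2 = 0" "sl2_h $ 2 $ 1 = 0" "sl2_h $ 2 $ 2 = - 1"
  by (simp_all add: sl2_e_def sl2_f_def sl2_h_def vector_2)

lemma sl2_members: "sl2_e \<in> sl2" "sl2_f \<in> sl2" "sl2_h \<in> sl2"
  by (simp_all add: sl2_def trace_def sum_2)

lemma conj_transpose_sl2:
  "conj_transpose sl2_e = sl2_f" "conj_transpose sl2_f = sl2_e" "conj_transpose sl2_h = sl2_h"
  by (simp_all add: conj_transpose_def vec_eq_iff forall_2)

lemma sl2_diag: "x \<in> sl2 \<Longrightarrow> x $ 2 $ 2 = - x $ 1 $ 1"
  by (simp add: sl2_def trace_def sum_2 add_eq_0_iff)

lemma linmap_tensor_act: "linmap (tensor_act N a x)"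
  by (auto simp: linmap_def tensor_act_def cscale_def algebra_simps sum.distrib sum_distrib_left)

lemma tensor_act_add: "tensor_act N a (x + y) f = tensor_act N a x f + tensor_act N a y f"
  by (auto simp: tensor_act_def algebra_simps sum.distrib)

lemma tensor_act_uminus: "tensor_act N a (- x) f = - tensor_act N a x f"
  by (auto simp: tensor_act_def sum_negf)

lemma tensor_act_sl2:
  assumes "x \<in> sl2"
  shows "tensor_act N a x f = cscale (x $ 1 $ 1) (tensor_act N a sl2_h f)
    + cscale (x $ 1 $ 2) (tensor_act N a sl2_e f) + cscale (x $ 2 $ 1) (tensor_act N a sl2_f f)"
proof
  fix s :: "2 list"
  have "(\<Sum>b\<in>UNIV. x $ c $ b * g b) = x $ 1 $ 1 * (\<Sum>b\<in>UNIV. sl2_h $ c $ b * g b)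
      + x $ 1 $ 2 * (\<Sum>b\<in>UNIV. sl2_e $ c $ b * g b) + x $ 2 $ 1 * (\<Sum>b\<in>UNIV. sl2_f $ c $ b * g b)"
    for c :: 2 and g
    using exhaust_2[of c] by (auto simp: sum_2 sl2_diag[OF assms])
  then show "tensor_act N a x f s = (cscale (x $ 1 $ 1) (tensor_act N a sl2_h f)
    + cscale (x $ 1 $ 2) (tensor_act N a sl2_e f) + cscale (x $ 2 $ 1) (tensor_act N a sl2_f f)) s"
    by (simp add: tensor_act_def cscale_def sum.distrib sum_distrib_left algebra_simps)
qed

text \<open>
  Operators on different tensor factors commute, so only the diagonal terms of the double sum survive.
\<close>

lemma tensor_act_commutator:
  "tensor_act N a x (tensor_act N b y f) - tensor_act N b y (tensor_act N a x f)
    = tensor_act N (\<lambda>j. a j * b j) (x ** y - y ** x) f"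
proof
  fix s :: "2 list"
  define D where "D x y j k = (\<Sum>c\<in>UNIV. x $ (s ! j) $ c * (\<Sum>d\<in>UNIV. y $ (s[j := c] ! k) $ d * f (s[j := c, k := d])))"
    for x y :: "complex^2^2" and j k
  show "(tensor_act N a x (tensor_act N b y f) - tensor_act N b y (tensor_act N a x f)) s
    = tensor_act N (\<lambda>j. a j * b j) (x ** y - y ** x) f s"
  proof (cases "length s = N")
    case True
    have act: "tensor_act N a x (tensor_act N b y f) s = (\<Sum>j<N. \<Sum>k<N. a j * b k * D x y j k)" for a b x y
    proof -
      have "tensor_act N a x (tensor_act N b y f) s
        = (\<Sum>j<N. \<Sum>c\<in>UNIV. \<Sum>k<N. a j * b k * (x $ (s ! j) $ c * (\<Sum>d\<in>UNIV. y $ (s[j := c] ! k) $ d * f (s[j := c, k := d]))))"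
        using True by (simp add: tensor_act_def sum_distrib_left ac_simps)
      also have "\<dots> = (\<Sum>j<N. \<Sum>k<N. a j * b k * D x y j k)"
        unfolding D_def by (intro sum.cong refl, subst sum.swap) (simp add: sum_distrib_left)
      finally show ?thesis .
    qed
    have off: "D x y j k = D y x k j" if "j \<noteq> k" for j k
    proof -
      have "D x y j k = (\<Sum>c\<in>UNIV. \<Sum>d\<in>UNIV. x $ (s ! j) $ c * (y $ (s ! k) $ d * f (s[j := c, k := d])))"
        using that by (simp add: D_def sum_distrib_left)
      also have "\<dots> = (\<Sum>d\<in>UNIV. \<Sum>c\<in>UNIV. x $ (s ! j) $ c * (y $ (s ! k) $ d * f (s[j := c, k := d])))"
        by (rule sum.swap)
      also have "\<dots> = (\<Sum>d\<in>UNIV. \<Sum>c\<in>UNIV. y $ (s ! k) $ d * (x $ (s ! j) $ c * f (s[k := d, j := c])))"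
        using that by (intro sum.cong refl) (simp add: list_update_swap mult.left_commute)
      also have "\<dots> = D y x k j" using that by (simp add: D_def sum_distrib_left)
      finally show ?thesis .
    qed
    have diag: "D x y j j = (\<Sum>d\<in>UNIV. (x ** y) $ (s ! j) $ d * f (s[j := d]))" if "j < N" for x y j
    proof -
      have "D x y j j = (\<Sum>c\<in>UNIV. \<Sum>d\<in>UNIV. x $ (s ! j) $ c * (y $ c $ d * f (s[j := d])))"
        using that True by (simp add: D_def sum_distrib_left)
      also have "\<dots> = (\<Sum>d\<in>UNIV. \<Sum>c\<in>UNIV. x $ (s ! j) $ c * (y $ c $ d * f (s[j := d])))"
        by (rule sum.swap)
      finally show ?thesis by (simp add: matrix_matrix_mult_def sum_distrib_right mult.assoc)
    qed
    have "(tensor_act N a x (tensor_act N b y f) - tensor_act N b y (tensor_act N a x f)) s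
        = (\<Sum>j<N. \<Sum>k<N. a j * b k * D x y j k) - (\<Sum>k<N. \<Sum>j<N. b k * a j * D y x k j)"
      by (simp only: minus_apply act)
    also have "(\<Sum>k<N. \<Sum>j<N. b k * a j * D y x k j) = (\<Sum>j<N. \<Sum>k<N. b k * a j * D y x k j)"
      by (rule sum.swap)
    also have "(\<Sum>j<N. \<Sum>k<N. a j * b k * D x y j k) - (\<Sum>j<N. \<Sum>k<N. b k * a j * D y x k j)
        = (\<Sum>j<N. \<Sum>k<N. if k = j then a j * b j * (D x y j j - D y x j j) else 0)"
      unfolding sum_subtractf[symmetric]
      by (intro sum.cong refl) (auto simp: off algebra_simps)
    also have "\<dots> = (\<Sum>j<N. a j * b j * (D x y j j - D y x j j))"
      by (intro sum.cong refl) (simp add: sum.delta)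
    also have "\<dots> = tensor_act N (\<lambda>j. a j * b j) (x ** y - y ** x) f s"
      using True by (simp add: tensor_act_def diag algebra_simps sum_subtractf)
    finally show ?thesis .
  qed (simp add: tensor_act_def)
qed

lemma sl2_brackets:
  "sl2_e ** sl2_f - sl2_f ** sl2_e = sl2_h"
  "sl2_f ** sl2_e - sl2_e ** sl2_f = - sl2_h"
  "sl2_h ** sl2_e - sl2_e ** sl2_h = sl2_e + sl2_e"
  by (simp_all add: vec_eq_iff forall_2 matrix_matrix_mult_def sum_2)

text \<open>
  The positions raised from the lowest weight vector; their number is called the level.  At level
  \<open>l\<close> the weight is \<open>2l - N\<close>.
\<close>

definition ones :: "2 list \<Rightarrow> nat set" where
  "ones s = {j. j < length s \<and> s ! j = 1}"

lemma finite_ones [simp]: "finite (ones s)"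
  by (rule finite_subset[of _ "{..<length s}"]) (auto simp: ones_def)

lemma card_ones_le: "card (ones s) \<le> length s"
  using card_mono[of "{..<length s}" "ones s"] by (auto simp: ones_def)

lemma sl2_h_site:
  "(\<Sum>b\<in>UNIV. sl2_h $ (s ! j) $ b * f (s[j := b])) = (if s ! j = 1 then f s else - f s)"
proof (cases "s ! j = 1")
  case True
  then have "s[j := 1] = s" using list_update_id[of s j] by simp
  then show ?thesis using True by (simp add: sum_2)
next
  case False
  then have 2: "s ! j = 2" using exhaust_2[of "s ! j"] by blast
  then have "s[j := 2] = s" using list_update_id[of s j] by simp
  then show ?thesis using 2 by (simp add: sum_2)
qed

lemma tensor_act_h:
  "tensor_act N (\<lambda>_. 1) sl2_h f s = (if length s = N then (2 * of_nat (card (ones s)) - of_nat N) * f s else 0)"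
proof (cases "length s = N")
  case True
  have "tensor_act N (\<lambda>_. 1) sl2_h f s = (\<Sum>j<N. (if s ! j = 1 then 2 else 0) * f s - f s)"
    using True by (auto simp: tensor_act_def sl2_h_site intro!: sum.cong)
  also have "\<dots> = (\<Sum>j<N. (if s ! j = 1 then 2 else 0)) * f s - of_nat N * f s"
    by (simp add: sum_subtractf sum_distrib_right)
  also have "(\<Sum>j<N. (if s ! j = 1 then 2 else 0)) = (2 * of_nat (card (ones s)) :: complex)"
    using True by (simp add: sum.If_cases ones_def Int_def lessThan_def)
  finally show ?thesis using True by (simp add: algebra_simps)
qed (simp add: tensor_act_def)

text \<open>
  The generators of the fusion filtration.
\<close>

definition fvec :: "nat \<Rightarrow> (nat \<Rightarrow> complex) \<Rightarrow> nat list \<Rightarrow> tensor" where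
  "fvec N z is = foldr (current_act N z sl2_e) is (lowest N)"

lemma fvec_Nil: "fvec N z [] = lowest N"
  and fvec_Cons: "fvec N z (i # is) = tensor_act N (\<lambda>j. z j ^ i) sl2_e (fvec N z is)"
  by (simp_all add: fvec_def current_act_def)

text \<open>
  The bound on the degree is strict, so that \<open>d = Suc m\<close> describes a step of the filtration and
  \<open>d = m\<close> the preceding one; the step before degree \<open>0\<close> is then the zero space.
\<close>

definition level_space :: "nat \<Rightarrow> (nat \<Rightarrow> complex) \<Rightarrow> nat \<Rightarrow> nat \<Rightarrow> tensor set" where
  "level_space N z l d = cfun.span {fvec N z is | is. length is = l \<and> sum_list is < d}"

lemma subspace_level_space: "cfun.subspace (level_space N z l d)"
  by (simp add: level_space_def cfun.subspace_span)

lemma V_lt_eq: "V_lt N z d = cfun.span {fvec N z is | is. sum_list is < d}"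
proof -
  have deg: "V_deg N z k = cfun.span {fvec N z is | is. sum_list is = k}" for k
    by (simp add: V_deg_def fvec_def)
  have "(\<Union>k\<in>{..<d}. V_deg N z k) \<subseteq> cfun.span {fvec N z is | is. sum_list is < d}"
    unfolding deg by (intro UN_least cfun.span_mono) auto
  then have "V_lt N z d \<subseteq> cfun.span {fvec N z is | is. sum_list is < d}"
    unfolding V_lt_def by (rule cfun.span_minimal) (rule cfun.subspace_span)
  moreover have "{fvec N z is | is. sum_list is < d} \<subseteq> (\<Union>k\<in>{..<d}. V_deg N z k)"
  proof safe
    fix "is" :: "nat list" assume "sum_list is < d"
    moreover have "fvec N z is \<in> V_deg N z (sum_list is)"
      unfolding deg by (rule cfun.span_base) blast
    ultimately show "fvec N z is \<in> (\<Union>k\<in>{..<d}. V_deg N z k)" by blast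
  qed
  then have "cfun.span {fvec N z is | is. sum_list is < d} \<subseteq> V_lt N z d"
    unfolding V_lt_def by (rule cfun.span_mono)
  ultimately show ?thesis by (rule subset_antisym)
qed

lemma V_le_eq: "V_le N z m = V_lt N z (Suc m)"
  by (simp add: V_le_def V_lt_def lessThan_Suc_atMost)

lemma subspace_V_lt: "cfun.subspace (V_lt N z d)"
  by (simp add: V_lt_eq cfun.subspace_span)

lemma V_lt_mono: "d \<le> d' \<Longrightarrow> V_lt N z d \<subseteq> V_lt N z d'"
  unfolding V_lt_eq by (intro cfun.span_mono) auto

lemma level_space_subset: "level_space N z l d \<subseteq> V_lt N z d"
  unfolding V_lt_eq level_space_def by (intro cfun.span_mono) auto

lemma fvec_in_span: "length is = l \<Longrightarrow> sum_list is \<le> d \<Longrightarrow>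
    fvec N z is \<in> cfun.span {fvec N z js | js. length js = l \<and> sum_list js \<le> d}"
  by (rule cfun.span_base) blast

text \<open>
  By \<open>[h_i, e_k] = 2 e_(i+k)\<close>; on the lowest weight vector \<open>h_i\<close> is a scalar, which loses the degree \<open>i\<close>.
\<close>

lemma tensor_act_h_fvec:
  "tensor_act N (\<lambda>j. z j ^ i) sl2_h (fvec N z is)
    \<in> cfun.span {fvec N z js | js. length js = length is \<and> sum_list js \<le> i + sum_list is}"
proof (induction "is")
  case Nil
  have "tensor_act N (\<lambda>j. z j ^ i) sl2_h (lowest N) = cscale (- (\<Sum>j<N. z j ^ i)) (lowest N)"
  proof
    fix s :: "2 list"
    show "tensor_act N (\<lambda>j. z j ^ i) sl2_h (lowest N) s = cscale (- (\<Sum>j<N. z j ^ i)) (lowest N) s"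
    proof (cases "length s = N")
      case True
      have "lowest N s = 0" if "j < N" "s ! j = 1" for j
      proof -
        have "s \<noteq> replicate N 2" using that by auto
        then show ?thesis by (simp add: lowest_def)
      qed
      then have "(\<Sum>b\<in>UNIV. sl2_h $ (s ! j) $ b * lowest N (s[j := b])) = - lowest N s" if "j < N" for j
        unfolding sl2_h_site using that by auto
      then show ?thesis using True
        by (simp add: tensor_act_def cscale_def sum_distrib_right sum_negf)
    next
      case False
      then have "s \<noteq> replicate N 2" by auto
      then show ?thesis using False by (simp add: tensor_act_def cscale_def lowest_def)
    qed
  qed
  moreover have "lowest N \<in> cfun.span {fvec N z js | js. length js = length ([] :: nat list) \<and> sum_list js \<le> i + sum_list []}"
    by (rule cfun.span_base) (auto intro!: exI[of _ "[]"] simp: fvec_Nil)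
  ultimately show ?case unfolding fvec_Nil by (simp only: cfun.span_scale)
next
  case (Cons k "is")
  let ?E = "tensor_act N (\<lambda>j. z j ^ k) sl2_e" and ?H = "tensor_act N (\<lambda>j. z j ^ i) sl2_h"
  let ?Z = "cfun.span {fvec N z js | js. length js = length (k # is) \<and> sum_list js \<le> i + sum_list (k # is)}"
  have "?H (fvec N z (k # is)) - ?E (?H (fvec N z is)) = fvec N z ((i + k) # is) + fvec N z ((i + k) # is)"
    unfolding fvec_Cons tensor_act_commutator sl2_brackets tensor_act_add by (simp add: power_add)
  then have "?H (fvec N z (k # is)) = ?E (?H (fvec N z is)) + (fvec N z ((i + k) # is) + fvec N z ((i + k) # is))"
    by (simp add: algebra_simps)
  moreover have "?E (?H (fvec N z is)) \<in> ?Z"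
    using linmap_tensor_act Cons cfun.subspace_span
  proof (rule span_linmap_in)
    fix g assume "g \<in> {fvec N z js | js. length js = length is \<and> sum_list js \<le> i + sum_list is}"
    then obtain js where js: "g = fvec N z js" "length js = length is" "sum_list js \<le> i + sum_list is" by blast
    have "?E g = fvec N z (k # js)" by (simp add: js(1) fvec_Cons)
    moreover have "fvec N z (k # js) \<in> ?Z" by (rule fvec_in_span) (use js in simp_all)
    ultimately show "?E g \<in> ?Z" by (simp only:)
  qed
  moreover have "fvec N z ((i + k) # is) \<in> ?Z" by (rule fvec_in_span) simp_all
  ultimately show ?case by (simp only: cfun.span_add)
qed

lemma tensor_act_f_lowest: "tensor_act N a sl2_f (lowest N) = 0"
proof
  fix s :: "2 list"
  have "(\<Sum>b\<in>UNIV. sl2_f $ (s ! j) $ b * lowest N (s[j := b])) = 0" if "j < N" "length s = N" for j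
  proof -
    have "s[j := 1] \<noteq> replicate N 2"
    proof
      assume "s[j := 1] = replicate N 2"
      then have "s[j := 1] ! j = replicate N 2 ! j" by (simp only:)
      then show False using that by simp
    qed
    then show ?thesis using exhaust_2[of "s ! j"] by (auto simp: sum_2 lowest_def)
  qed
  then show "tensor_act N a sl2_f (lowest N) s = 0 s" by (simp add: tensor_act_def)
qed

text \<open>
  By \<open>[f, e_k] = - h_k\<close> and the preceding lemmas.  In particular the filtration is stable under \<open>f\<close>.
\<close>

lemma tensor_act_f_fvec:
  "tensor_act N (\<lambda>_. 1) sl2_f (fvec N z is)
    \<in> cfun.span {fvec N z js | js. Suc (length js) = length is \<and> sum_list js \<le> sum_list is}"
proof (induction "is")
  case Nil
  show ?case unfolding fvec_Nil tensor_act_f_lowest by (rule cfun.span_zero)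
next
  case (Cons k "is")
  let ?E = "tensor_act N (\<lambda>j. z j ^ k) sl2_e" and ?F = "tensor_act N (\<lambda>_. 1) sl2_f"
  let ?Z = "cfun.span {fvec N z js | js. Suc (length js) = length (k # is) \<and> sum_list js \<le> sum_list (k # is)}"
  have "?F (fvec N z (k # is)) - ?E (?F (fvec N z is)) = - tensor_act N (\<lambda>j. z j ^ k) sl2_h (fvec N z is)"
    unfolding fvec_Cons tensor_act_commutator sl2_brackets tensor_act_uminus by simp
  then have "?F (fvec N z (k # is)) = ?E (?F (fvec N z is)) - tensor_act N (\<lambda>j. z j ^ k) sl2_h (fvec N z is)"
    by (simp add: algebra_simps)
  moreover have "?E (?F (fvec N z is)) \<in> ?Z"
    using linmap_tensor_act Cons cfun.subspace_span
  proof (rule span_linmap_in)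
    fix g assume "g \<in> {fvec N z js | js. Suc (length js) = length is \<and> sum_list js \<le> sum_list is}"
    then obtain js where js: "g = fvec N z js" "Suc (length js) = length is" "sum_list js \<le> sum_list is" by blast
    then have "?E g = fvec N z (k # js)" by (simp add: fvec_Cons)
    moreover have "fvec N z (k # js) \<in> ?Z"
      using js by (intro cfun.span_base CollectI exI[of _ "k # js"]) simp
    ultimately show "?E g \<in> ?Z" by (simp only:)
  qed
  moreover have "tensor_act N (\<lambda>j. z j ^ k) sl2_h (fvec N z is) \<in> ?Z"
    using tensor_act_h_fvec[of N z k "is"] by simp
  ultimately show ?case by (simp only: cfun.span_diff)
qed

lemma level_space_e:
  assumes "w \<in> level_space N z l d"
  shows "tensor_act N (\<lambda>_. 1) sl2_e w \<in> level_space N z (Suc l) d"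
  using linmap_tensor_act assms[unfolded level_space_def] subspace_level_space
proof (rule span_linmap_in)
  fix g assume "g \<in> {fvec N z is | is. length is = l \<and> sum_list is < d}"
  then obtain "is" where g: "g = fvec N z is" "length is = l" "sum_list is < d" by blast
  then have "tensor_act N (\<lambda>_. 1) sl2_e g = fvec N z (0 # is)" by (simp add: fvec_Cons)
  moreover have "fvec N z (0 # is) \<in> level_space N z (Suc l) d"
    unfolding level_space_def using g by (intro cfun.span_base CollectI exI[of _ "0 # is"]) simp
  ultimately show "tensor_act N (\<lambda>_. 1) sl2_e g \<in> level_space N z (Suc l) d" by simp
qed

lemma level_space_f:
  assumes "w \<in> level_space N z (Suc l) d"
  shows "tensor_act N (\<lambda>_. 1) sl2_f w \<in> level_space N z l d"
  using linmap_tensor_act assms[unfolded level_space_def] subspace_level_space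
proof (rule span_linmap_in)
  fix g assume "g \<in> {fvec N z is | is. length is = Suc l \<and> sum_list is < d}"
  then obtain "is" where g: "g = fvec N z is" "length is = Suc l" "sum_list is < d" by blast
  have "cfun.span {fvec N z js | js. Suc (length js) = length is \<and> sum_list js \<le> sum_list is} \<subseteq> level_space N z l d"
    unfolding level_space_def using g by (intro cfun.span_mono) auto
  then show "tensor_act N (\<lambda>_. 1) sl2_f g \<in> level_space N z l d"
    using tensor_act_f_fvec g(1) by blast
qed

lemma level_space_f_0:
  assumes "w \<in> level_space N z 0 d"
  shows "tensor_act N (\<lambda>_. 1) sl2_f w = 0"
proof -
  have "tensor_act N (\<lambda>_. 1) sl2_f w \<in> {0}"
    using linmap_tensor_act assms[unfolded level_space_def]
  proof (rule span_linmap_in)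
    show "cfun.subspace {0 :: tensor}" by (rule cfun.subspace_single_0)
    fix g assume "g \<in> {fvec N z is | is. length is = 0 \<and> sum_list is < d}"
    then show "tensor_act N (\<lambda>_. 1) sl2_f g \<in> {0}" by (auto simp: fvec_Nil tensor_act_f_lowest)
  qed
  then show ?thesis by simp
qed

definition tens :: "nat \<Rightarrow> (nat set \<Rightarrow> complex) \<Rightarrow> tensor" where
  "tens N u = (\<lambda>s. if length s = N then u (ones s) else 0)"

lemma linmap_tens: "linmap (tens N)"
  by (auto simp: linmap_def tens_def cscale_def)

text \<open>
  The translation between the current algebra and symmetric functions: each \<open>e_i\<close> becomes \<open>create\<close>
  with weight \<open>z_j^i\<close>.
\<close>

lemma fvec_eq_tens: "fvec N z is = tens N (on_level N (length is) (inj_sum z is))"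
proof (induction "is")
  case Nil
  have "ones s = {} \<longleftrightarrow> s = replicate N 2" if "length s = N" for s
  proof
    assume ones: "ones s = {}"
    have "s ! j = 2" if "j < N" for j
      using that ones \<open>length s = N\<close> exhaust_2[of "s ! j"] by (auto simp: ones_def)
    then show "s = replicate N 2" using \<open>length s = N\<close> by (simp add: list_eq_iff_nth_eq)
  qed (auto simp: ones_def)
  then show ?case
    by (auto simp: fvec_Nil lowest_def tens_def on_level_def)
next
  case (Cons i "is")
  show ?case
  proof
    fix s :: "2 list"
    show "fvec N z (i # is) s = tens N (on_level N (length (i # is)) (inj_sum z (i # is))) s"
    proof (cases "length s = N")
      case True
      let ?S = "ones s"
      have S: "?S \<subseteq> {..<N}" using True by (auto simp: ones_def)
      have site: "(\<Sum>b\<in>UNIV. sl2_e $ (s ! j) $ b * fvec N z is (s[j := b]))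
          = (if j \<in> ?S then on_level N (length is) (inj_sum z is) (?S - {j}) else 0)" if j: "j < N" for j
      proof (cases "s ! j = 1")
        case True
        have "ones (s[j := 2]) = ?S - {j}"
          using j \<open>length s = N\<close> by (auto simp: ones_def nth_list_update)
        then show ?thesis using True j \<open>length s = N\<close>
          by (simp add: sum_2 Cons tens_def) (simp add: ones_def)
      next
        case False
        then show ?thesis using exhaust_2[of "s ! j"] by (auto simp: sum_2 ones_def)
      qed
      have "fvec N z (i # is) s = (\<Sum>j<N. z j ^ i * (if j \<in> ?S then on_level N (length is) (inj_sum z is) (?S - {j}) else 0))"
        using True by (simp add: fvec_Cons tensor_act_def site)
      also have "\<dots> = (\<Sum>j\<in>?S. z j ^ i * on_level N (length is) (inj_sum z is) (?S - {j}))"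
        using S by (intro sum.mono_neutral_cong_right) auto
      also have "\<dots> = on_level N (length (i # is)) (inj_sum z (i # is)) ?S"
      proof -
        have "?S - {j} \<in> nsubsets N (length is) \<longleftrightarrow> ?S \<in> nsubsets N (length (i # is))" if "j \<in> ?S" for j
          using S that card_Suc_Diff1[of ?S j] by (auto simp: nsubsets_def)
        then show ?thesis
          by (auto simp: on_level_def inj_sum_Cons create_def intro!: sum.cong)
      qed
      finally show ?thesis using True by (simp add: tens_def)
    qed (simp add: fvec_Cons tensor_act_def tens_def)
  qed
qed

text \<open>
  A left inverse of \<open>tens\<close>, used to carry linear independence over to tensors.
\<close>

definition untens :: "nat \<Rightarrow> tensor \<Rightarrow> nat set \<Rightarrow> complex" where
  "untens N w = (\<lambda>S. if S \<subseteq> {..<N} then w (map (\<lambda>j. if j \<in> S then 1 else 2) [0..<N]) else 0)"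

lemma linmap_untens: "linmap (untens N)"
  by (auto simp: linmap_def untens_def cscale_def)

lemma untens_tens:
  assumes "\<And>S. \<not> S \<subseteq> {..<N} \<Longrightarrow> u S = 0"
  shows "untens N (tens N u) = u"
proof
  fix S
  have "ones (map (\<lambda>j. if j \<in> S then 1 else 2) [0..<N]) = S" if "S \<subseteq> {..<N}"
    using that by (auto simp: ones_def split: if_splits)
  then show "untens N (tens N u) S = u S" using assms by (auto simp: untens_def tens_def)
qed

lemma independent_left_inverse:
  assumes "linmap G" "\<And>b. b \<in> B \<Longrightarrow> G (F b) = b" "cfun.independent B"
  shows "cfun.independent (F ` B)"
proof
  assume "cfun.dependent (F ` B)"
  then obtain b where b: "b \<in> B" "F b \<in> cfun.span (F ` B - {F b})" by (auto simp: cfun.dependent_def)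
  have "G (F b) \<in> cfun.span (B - {b})"
    using assms(1) b(2) cfun.subspace_span
  proof (rule span_linmap_in)
    fix g assume "g \<in> F ` B - {F b}"
    then show "G g \<in> cfun.span (B - {b})" using assms(2) by (auto intro: cfun.span_base)
  qed
  then show False using assms(2,3) b(1) by (auto simp: cfun.dependent_def)
qed

theorem level_space_basis:
  assumes "inj_on z {..<N}"
  shows "\<exists>g. inj_on g (nsubsets N l) \<and> cfun.independent (g ` nsubsets N l) \<and>
    (\<forall>d. level_space N z l d = cfun.span (g ` {\<mu> \<in> nsubsets N l. \<Sum>\<mu> < d + (l choose 2)}))"
proof -
  obtain g where g: "inj_on g (nsubsets N l)" "cfun.independent (g ` nsubsets N l)"
      "\<forall>\<mu>\<in>nsubsets N l. l choose 2 \<le> \<Sum>\<mu>"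
      "\<And>d. cfun.span {on_level N l (inj_sum z is) | is. length is = l \<and> sum_list is \<le> d}
       = cfun.span (g ` {\<mu> \<in> nsubsets N l. \<Sum>\<mu> \<le> d + (l choose 2)})"
    using level_basis[OF assms] by blast
  have supp: "g \<mu> S = 0" if "\<mu> \<in> nsubsets N l" "\<not> S \<subseteq> {..<N}" for \<mu> S
  proof -
    have "g \<mu> \<in> cfun.span (g ` {\<nu> \<in> nsubsets N l. \<Sum>\<nu> \<le> \<Sum>\<mu> + (l choose 2)})"
      using that by (intro cfun.span_base) auto
    moreover have "cfun.span {on_level N l (inj_sum z is) | is. length is = l \<and> sum_list is \<le> \<Sum>\<mu>} \<subseteq> {u. u S = 0}"
      using that by (intro cfun.span_minimal) (auto simp: on_level_def nsubsets_def cfun.subspace_def cscale_def)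
    ultimately show ?thesis using g(4) by blast
  qed
  have inv: "untens N (tens N b) = b" if b: "b \<in> g ` nsubsets N l" for b
  proof -
    obtain \<mu> where \<mu>: "b = g \<mu>" "\<mu> \<in> nsubsets N l" using b by blast
    show ?thesis unfolding \<mu>(1) by (rule untens_tens) (rule supp[OF \<mu>(2)])
  qed
  define h where "h \<mu> = tens N (g \<mu>)" for \<mu>
  have g_h: "g \<mu> = untens N (h \<mu>)" if "\<mu> \<in> nsubsets N l" for \<mu>
    unfolding h_def using inv[OF imageI[OF that]] by (rule sym)
  have "inj_on h (nsubsets N l)"
  proof (rule inj_onI)
    fix \<mu> \<nu> assume \<mu>: "\<mu> \<in> nsubsets N l" and \<nu>: "\<nu> \<in> nsubsets N l" and eq: "h \<mu> = h \<nu>"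
    have "g \<mu> = g \<nu>" unfolding g_h[OF \<mu>] g_h[OF \<nu>] eq ..
    then show "\<mu> = \<nu>" using inj_onD[OF g(1)] \<mu> \<nu> by blast
  qed
  moreover have "cfun.independent (h ` nsubsets N l)"
  proof -
    have "cfun.independent (tens N ` g ` nsubsets N l)"
      by (rule independent_left_inverse[OF linmap_untens _ g(2)]) (rule inv)
    then show ?thesis unfolding h_def image_image .
  qed
  moreover have "level_space N z l d = cfun.span (h ` {\<mu> \<in> nsubsets N l. \<Sum>\<mu> < d + (l choose 2)})" for d
  proof (cases d)
    case 0
    have 1: "{\<mu> \<in> nsubsets N l. \<Sum>\<mu> < 0 + (l choose 2)} = {}" using g(3) by auto
    show ?thesis unfolding 0 1 level_space_def by simp
  next
    case (Suc e)
    have "level_space N z l d = cfun.span (tens N ` {on_level N l (inj_sum z is) | is. length is = l \<and> sum_list is \<le> e})"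
      unfolding level_space_def fvec_eq_tens Suc less_Suc_eq_le
      by (rule arg_cong[of _ _ cfun.span]) auto
    also have "\<dots> = cfun.span (tens N ` g ` {\<mu> \<in> nsubsets N l. \<Sum>\<mu> \<le> e + (l choose 2)})"
      unfolding linmap_image_span[OF linmap_tens, symmetric] g(4) ..
    finally show ?thesis by (simp add: h_def image_image Suc less_Suc_eq_le)
  qed
  ultimately show ?thesis by blast
qed

definition level_part :: "nat \<Rightarrow> tensor \<Rightarrow> tensor" where
  "level_part l w = (\<lambda>s. if card (ones s) = l then w s else 0)"

lemma linmap_level_part: "linmap (level_part l)"
  by (auto simp: linmap_def level_part_def cscale_def)

lemma level_part_fvec: "level_part l (fvec N z is) = (if length is = l then fvec N z is else 0)"
  by (auto simp: level_part_def fvec_eq_tens tens_def on_level_def nsubsets_def)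

lemma level_part_in_level_space:
  assumes "w \<in> V_lt N z d"
  shows "level_part l w \<in> level_space N z l d"
  using linmap_level_part assms[unfolded V_lt_eq] subspace_level_space
proof (rule span_linmap_in)
  fix g assume "g \<in> {fvec N z is | is. sum_list is < d}"
  then obtain "is" where g: "g = fvec N z is" "sum_list is < d" by blast
  show "level_part l g \<in> level_space N z l d"
  proof (cases "length is = l")
    case True
    then have "level_part l g = fvec N z is" by (simp add: g level_part_fvec)
    then show ?thesis using True g(2) unfolding level_space_def by (auto intro: cfun.span_base)
  next
    case False
    then have "level_part l g = 0" by (simp add: g level_part_fvec)
    then show ?thesis using cfun.subspace_0[OF subspace_level_space] by simp
  qed
qed

lemma level_part_level_space:
  assumes "w \<in> level_space N z l d"
  shows "level_part l w = w"
proof -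
  have "level_part l w - w \<in> {0}"
    using _ assms[unfolded level_space_def] cfun.subspace_single_0
  proof (rule span_linmap_in[where F = "\<lambda>w. level_part l w - w"])
    show "linmap (\<lambda>w. level_part l w - w)" by (auto simp: linmap_def level_part_def cscale_def)
  qed (auto simp: level_part_fvec)
  then show ?thesis by simp
qed

text \<open>
  The filtration is compatible with the decomposition into levels.
\<close>

lemma level_space_inter:
  "w \<in> level_space N z l d \<Longrightarrow> w \<in> V_lt N z d' \<Longrightarrow> w \<in> level_space N z l d'"
  using level_part_in_level_space[of w N z d' l] level_part_level_space[of w N z l d] by simp

lemma V_lt_subset_tensors: "V_lt N z d \<subseteq> tensors N"
  unfolding V_lt_eq
  by (rule cfun.span_minimal)
    (auto simp: fvec_eq_tens tens_def tensors_def cfun.subspace_def cscale_def)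

lemma sum_level_part:
  assumes "w \<in> V_lt N z d"
  shows "w = (\<Sum>l\<le>N. level_part l w)"
proof
  fix s
  show "w s = (\<Sum>l\<le>N. level_part l w) s"
  proof (cases "length s = N")
    case True
    then have "card (ones s) \<in> {..N}" using card_ones_le[of s] by simp
    then show ?thesis by (simp add: sum_fun_apply level_part_def)
  next
    case False
    then have "w s = 0" using subsetD[OF V_lt_subset_tensors assms] by (simp add: tensors_def)
    then show ?thesis by (simp add: sum_fun_apply level_part_def)
  qed
qed

lemma level_space_h:
  assumes "w \<in> level_space N z l d"
  shows "tensor_act N (\<lambda>_. 1) sl2_h w = cscale (2 * of_nat l - of_nat N) w"
proof
  fix s
  have "w \<in> tensors N" by (rule subsetD[OF V_lt_subset_tensors subsetD[OF level_space_subset assms]])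
  then have 1: "length s \<noteq> N \<Longrightarrow> w s = 0" by (simp add: tensors_def)
  have "w s = level_part l w s" using level_part_level_space[OF assms] by simp
  then have "card (ones s) \<noteq> l \<Longrightarrow> w s = 0" by (simp add: level_part_def)
  then show "tensor_act N (\<lambda>_. 1) sl2_h w s = cscale (2 * of_nat l - of_nat N) w s"
    using 1 by (auto simp: tensor_act_h cscale_def)
qed

lemma V_lt_sl2:
  assumes "x \<in> sl2" "w \<in> V_lt N z d"
  shows "tensor_act N (\<lambda>_. 1) x w \<in> V_lt N z d"
proof -
  have gen: "tensor_act N (\<lambda>_. 1) y w \<in> V_lt N z d"
    if "\<And>is. sum_list is < d \<Longrightarrow> tensor_act N (\<lambda>_. 1) y (fvec N z is) \<in> V_lt N z d" for y
    using linmap_tensor_act assms(2)[unfolded V_lt_eq] subspace_V_lt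
  proof (rule span_linmap_in)
    fix g assume "g \<in> {fvec N z is |is. sum_list is < d}"
    then show "tensor_act N (\<lambda>_. 1) y g \<in> V_lt N z d" using that by blast
  qed
  have fv: "fvec N z is \<in> level_space N z (length is) d" if "sum_list is < d" for "is"
    unfolding level_space_def using that by (intro cfun.span_base) blast
  have "tensor_act N (\<lambda>_. 1) sl2_e w \<in> V_lt N z d"
    by (rule gen) (rule subsetD[OF level_space_subset level_space_e[OF fv]])
  moreover have "tensor_act N (\<lambda>_. 1) sl2_h w \<in> V_lt N z d"
  proof (rule gen)
    fix "is" assume "sum_list is < d"
    then have "fvec N z is \<in> level_space N z (length is) d" by (rule fv)
    then show "tensor_act N (\<lambda>_. 1) sl2_h (fvec N z is) \<in> V_lt N z d"
      unfolding level_space_h[OF \<open>fvec N z is \<in> _\<close>]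
      by (rule cfun.subspace_scale[OF subspace_V_lt subsetD[OF level_space_subset]])
  qed
  moreover have "tensor_act N (\<lambda>_. 1) sl2_f w \<in> V_lt N z d"
  proof (rule gen)
    fix "is" assume "sum_list is < d"
    then have 1: "fvec N z is \<in> level_space N z (length is) d" by (rule fv)
    show "tensor_act N (\<lambda>_. 1) sl2_f (fvec N z is) \<in> V_lt N z d"
    proof (cases "length is")
      case 0
      have "tensor_act N (\<lambda>_. 1) sl2_f (fvec N z is) = 0" using 1 unfolding 0 by (rule level_space_f_0)
      then show ?thesis using cfun.subspace_0[OF subspace_V_lt] by (simp only:)
    next
      case (Suc l)
      show ?thesis using 1 unfolding Suc by (rule subsetD[OF level_space_subset level_space_f])
    qed
  qed
  ultimately show ?thesis
    unfolding tensor_act_sl2[OF assms(1)]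
    using subspace_V_lt by (intro cfun.subspace_add cfun.subspace_scale)
qed


section \<open>Semi-inner products\<close>

text \<open>
  An inner product on the quotient \<open>W / U\<close>, given on representatives.
\<close>

locale semi_inner =
  fixes W U :: "('a \<Rightarrow> complex) set" and \<beta> :: "('a \<Rightarrow> complex) \<Rightarrow> ('a \<Rightarrow> complex) \<Rightarrow> complex"
  assumes subspace_W: "cfun.subspace W"
    and subspace_U: "cfun.subspace U"
    and U_subset: "U \<subseteq> W"
    and form_add: "\<lbrakk>u \<in> W; v \<in> W; w \<in> W\<rbrakk> \<Longrightarrow> \<beta> (u + v) w = \<beta> u w + \<beta> v w"
    and form_scale: "\<lbrakk>v \<in> W; w \<in> W\<rbrakk> \<Longrightarrow> \<beta> (cscale c v) w = c * \<beta> v w"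
    and form_herm: "\<lbrakk>v \<in> W; w \<in> W\<rbrakk> \<Longrightarrow> \<beta> w v = cnj (\<beta> v w)"
    and form_null: "\<lbrakk>u \<in> U; w \<in> W\<rbrakk> \<Longrightarrow> \<beta> u w = 0"
    and form_pos: "\<lbrakk>w \<in> W; w \<notin> U\<rbrakk> \<Longrightarrow> 0 < Re (\<beta> w w)"
begin

lemmas W_closed = cfun.subspace_add[OF subspace_W] cfun.subspace_scale[OF subspace_W]
  cfun.subspace_diff[OF subspace_W] cfun.subspace_sum[OF subspace_W] cfun.subspace_0[OF subspace_W]

lemma form_null_right: "u \<in> U \<Longrightarrow> w \<in> W \<Longrightarrow> \<beta> w u = 0"
  using form_herm[of u w] form_null[of u w] U_subset by auto

lemma form_scale_right: "v \<in> W \<Longrightarrow> w \<in> W \<Longrightarrow> \<beta> w (cscale c v) = cnj c * \<beta> w v"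
  using form_herm[of "cscale c v" w] form_herm[of v w] form_scale[of v w c] W_closed by simp

lemma form_add_right: "u \<in> W \<Longrightarrow> v \<in> W \<Longrightarrow> w \<in> W \<Longrightarrow> \<beta> w (u + v) = \<beta> w u + \<beta> w v"
  using form_herm[of "u + v" w] form_herm[of u w] form_herm[of v w] form_add[of u v w] W_closed by simp

lemma form_diff:
  assumes "u \<in> W" "v \<in> W" "w \<in> W"
  shows "\<beta> (u - v) w = \<beta> u w - \<beta> v w"
  using form_add[of "u - v" v w] assms W_closed(3)[OF assms(1,2)] by simp

lemma form_cong:
  assumes "u \<in> W" "v \<in> W" "w \<in> W" "u - v \<in> U"
  shows "\<beta> u w = \<beta> v w"
  using form_diff[OF assms(1,2,3)] form_null[OF assms(4,3)] by simp

lemma form_cong_right: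
  assumes "u \<in> W" "v \<in> W" "w \<in> W" "u - v \<in> U"
  shows "\<beta> w u = \<beta> w v"
  using form_cong[OF assms] form_herm assms by metis

lemma form_sum:
  assumes "\<And>i. i \<in> A \<Longrightarrow> h i \<in> W" "w \<in> W"
  shows "\<beta> (\<Sum>i\<in>A. h i) w = (\<Sum>i\<in>A. \<beta> (h i) w)"
proof -
  have 0: "\<beta> 0 w = 0" by (rule form_null[OF cfun.subspace_0[OF subspace_U] assms(2)])
  show ?thesis using assms(1)
  proof (induction A rule: infinite_finite_induct)
    case (infinite A)
    have "sum h A = 0" "(\<Sum>i\<in>A. \<beta> (h i) w) = 0" by (rule sum.infinite[OF infinite(1)])+
    then show ?case using 0 by (simp only:)
  next
    case empty
    then show ?case using 0 by (simp only: sum.empty)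
  next
    case (insert i A)
    have "\<beta> (\<Sum>i\<in>insert i A. h i) w = \<beta> (h i + (\<Sum>i\<in>A. h i)) w"
      unfolding sum.insert[OF insert.hyps] ..
    also have "\<dots> = \<beta> (h i) w + \<beta> (\<Sum>i\<in>A. h i) w"
      using insert.prems assms(2) by (intro form_add W_closed(4)) auto
    also have "\<dots> = (\<Sum>i\<in>insert i A. \<beta> (h i) w)"
      using insert by simp
    finally show ?case .
  qed
qed

lemma in_U_if: "w \<in> W \<Longrightarrow> \<beta> w w = 0 \<Longrightarrow> w \<in> U"
  using form_pos[of w] by auto

lemma form_real: "w \<in> W \<Longrightarrow> \<beta> w w = of_real (Re (\<beta> w w))"
  using form_herm[of w w] by (metis Reals_cnj_iff of_real_Re)

definition orthonormal :: "'i set \<Rightarrow> ('i \<Rightarrow> 'a \<Rightarrow> complex) \<Rightarrow> bool" where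
  "orthonormal I b \<longleftrightarrow> (\<forall>i\<in>I. b i \<in> W) \<and> (\<forall>i\<in>I. \<forall>j\<in>I. \<beta> (b i) (b j) = (if i = j then 1 else 0))"

definition complete :: "('a \<Rightarrow> complex) set \<Rightarrow> 'i set \<Rightarrow> ('i \<Rightarrow> 'a \<Rightarrow> complex) \<Rightarrow> bool" where
  "complete X I b \<longleftrightarrow> (\<forall>w\<in>X. (\<forall>i\<in>I. \<beta> w (b i) = 0) \<longrightarrow> w \<in> U)"

lemma form_sub_projection:
  assumes "finite I" "orthonormal I b" "w \<in> W" "i \<in> I"
  shows "\<beta> (w - (\<Sum>j\<in>I. cscale (\<beta> w (b j)) (b j))) (b i) = 0"
proof -
  have bW: "\<And>j. j \<in> I \<Longrightarrow> b j \<in> W" using assms(2) by (simp add: orthonormal_def)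
  have "\<beta> (\<Sum>j\<in>I. cscale (\<beta> w (b j)) (b j)) (b i) = (\<Sum>j\<in>I. \<beta> w (b j) * \<beta> (b j) (b i))"
    using bW assms(4) by (subst form_sum) (auto simp: W_closed form_scale)
  also have "\<dots> = (\<Sum>j\<in>I. if j = i then \<beta> w (b i) else 0)"
    using assms(2,4) by (intro sum.cong refl) (auto simp: orthonormal_def)
  also have "\<dots> = \<beta> w (b i)" using assms(1,4) by simp
  finally show ?thesis
    using bW assms(3,4) by (subst form_diff) (auto intro!: W_closed)
qed

lemma expansion:
  assumes "finite I" "orthonormal I b" "complete X I b" "cfun.subspace X" "X \<subseteq> W"
    "\<And>i. i \<in> I \<Longrightarrow> b i \<in> X" "w \<in> X"
  shows "w - (\<Sum>j\<in>I. cscale (\<beta> w (b j)) (b j)) \<in> U"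
proof -
  have "w - (\<Sum>j\<in>I. cscale (\<beta> w (b j)) (b j)) \<in> X"
    using assms by (intro cfun.subspace_diff cfun.subspace_sum cfun.subspace_scale) auto
  then show ?thesis
    using assms form_sub_projection[OF assms(1,2)] unfolding complete_def by blast
qed

text \<open>
  A vector whose component orthogonal to the previous ones is in the radical contributes nothing.
\<close>

lemma gram_schmidt:
  assumes "finite S" "S \<subseteq> W"
  shows "\<exists>Y. finite Y \<and> Y \<subseteq> cfun.span S \<and> orthonormal Y (\<lambda>y. y) \<and> complete (cfun.span S) Y (\<lambda>y. y)"
  using assms
proof (induction S rule: finite_induct)
  case empty
  have "complete (cfun.span {}) {} (\<lambda>y. y)"
    using cfun.subspace_0[OF subspace_U] by (simp only: complete_def cfun.span_empty) blast
  then show ?case by (intro exI[of _ "{}"]) (auto simp: orthonormal_def)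
next
  case (insert a S)
  then obtain Y where Y: "finite Y" "Y \<subseteq> cfun.span S" "orthonormal Y (\<lambda>y. y)"
      "complete (cfun.span S) Y (\<lambda>y. y)" by auto
  have SW: "cfun.span S \<subseteq> W" using insert.prems subspace_W by (intro cfun.span_minimal) auto
  have YW: "Y \<subseteq> W" using Y(2) SW by blast
  have aW: "a \<in> W" using insert.prems by simp
  define p where "p = (\<Sum>y\<in>Y. cscale (\<beta> a y) y)"
  \<comment> \<open>the component of \<open>a\<close> orthogonal to \<open>Y\<close>\<close>
  define a' where "a' = a - p"
  have pS: "p \<in> cfun.span S" unfolding p_def using Y(2) by (intro cfun.span_sum cfun.span_scale) auto
  have pW: "p \<in> W" using pS SW by blast
  have a'W: "a' \<in> W" unfolding a'_def using aW pW by (rule W_closed)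
  have a'Y: "\<beta> a' y = 0" if "y \<in> Y" for y
    unfolding a'_def p_def using form_sub_projection[OF Y(1,3) aW that] .
  have mono: "cfun.span S \<subseteq> cfun.span (insert a S)" by (intro cfun.span_mono) auto
  have a'S: "a' \<in> cfun.span (insert a S)"
    unfolding a'_def by (rule cfun.span_diff[OF cfun.span_base[OF insertI1] subsetD[OF mono pS]])
  have dec: "\<exists>k s. w = cscale k a' + s \<and> s \<in> cfun.span S" if w: "w \<in> cfun.span (insert a S)" for w
  proof -
    obtain k where k: "w - cscale k a \<in> cfun.span S" using w cfun.span_breakdown_eq by blast
    have "w = cscale k a' + ((w - cscale k a) + cscale k p)"
      by (simp add: a'_def cfun.scale_right_diff_distrib)
    moreover have "(w - cscale k a) + cscale k p \<in> cfun.span S"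
      using k pS by (intro cfun.span_add cfun.span_scale)
    ultimately show ?thesis by blast
  qed
  have sU: "s \<in> U" if ws: "w = cscale k a' + s" "s \<in> cfun.span S" "\<forall>y\<in>Y. \<beta> w y = 0" for w k s
  proof -
    have "\<beta> s y = 0" if "y \<in> Y" for y
    proof -
      have "\<beta> w y = \<beta> (cscale k a') y + \<beta> s y"
        unfolding ws(1) using a'W ws(2) SW YW that by (intro form_add W_closed) auto
      also have "\<beta> (cscale k a') y = 0" using a'Y[OF that] form_scale[OF a'W, of y k] that YW by auto
      finally show ?thesis using ws(3) that by simp
    qed
    then show ?thesis using Y(4) ws(2) by (simp add: complete_def)
  qed
  show ?case
  proof (cases "a' \<in> U")
    case True
    have "complete (cfun.span (insert a S)) Y (\<lambda>y. y)"
      unfolding complete_def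
    proof (intro ballI impI)
      fix w assume w: "w \<in> cfun.span (insert a S)" "\<forall>y\<in>Y. \<beta> w y = 0"
      obtain k s where ks: "w = cscale k a' + s" "s \<in> cfun.span S" using dec[OF w(1)] by blast
      then have "s \<in> U" using sU w(2) by blast
      then show "w \<in> U" unfolding ks(1) using True subspace_U by (intro cfun.subspace_add cfun.subspace_scale)
    qed
    then show ?thesis using Y mono by blast
  next
    case False
    define r where "r = Re (\<beta> a' a')"
    have r: "r > 0" "\<beta> a' a' = of_real r" using form_pos[OF a'W False] form_real[OF a'W] by (simp_all add: r_def)
    define v where "v = cscale (of_real (1 / sqrt r)) a'"
    have vW: "v \<in> W" unfolding v_def using a'W by (rule W_closed)
    have va: "\<beta> a' v = of_real (sqrt r)"
    proof -
      have "\<beta> a' v = of_real (1 / sqrt r) * of_real r"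
        unfolding v_def form_scale_right[OF a'W a'W] r(2) by simp
      also have "\<dots> = of_real (1 / sqrt r * r)" by (rule of_real_mult[symmetric])
      also have "1 / sqrt r * r = sqrt r" using r(1) by (simp add: real_div_sqrt)
      finally show ?thesis .
    qed
    have vv: "\<beta> v v = 1"
    proof -
      have "\<beta> v v = of_real (1 / sqrt r) * of_real (sqrt r)"
        using form_scale[OF a'W vW] va unfolding v_def[symmetric] by (metis v_def)
      also have "\<dots> = of_real (1 / sqrt r * sqrt r)" by (rule of_real_mult[symmetric])
      also have "1 / sqrt r * sqrt r = 1" using r(1) by simp
      finally show ?thesis by simp
    qed
    have vY: "\<beta> v y = 0" "\<beta> y v = 0" if "y \<in> Y" for y
    proof -
      have yW: "y \<in> W" using that YW by blast
      show "\<beta> v y = 0" unfolding v_def form_scale[OF a'W yW] a'Y[OF that] by simp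
      then show "\<beta> y v = 0" using form_herm[OF vW yW] by simp
    qed
    have "orthonormal (insert v Y) (\<lambda>y. y)"
      using Y(3) vW vv vY unfolding orthonormal_def by (metis insert_iff zero_neq_one)
    moreover have "complete (cfun.span (insert a S)) (insert v Y) (\<lambda>y. y)"
      unfolding complete_def
    proof (intro ballI impI)
      fix w assume w: "w \<in> cfun.span (insert a S)" "\<forall>y\<in>insert v Y. \<beta> w y = 0"
      obtain k s where ks: "w = cscale k a' + s" "s \<in> cfun.span S" using dec[OF w(1)] by blast
      then have s: "s \<in> U" using sU w(2) by blast
      have "0 = \<beta> w v" using w(2) by simp
      also have "\<dots> = \<beta> (cscale k a') v + \<beta> s v"
        unfolding ks(1) using a'W vW s U_subset by (intro form_add W_closed) auto
      also have "\<dots> = k * of_real (sqrt r)"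
        using form_scale[OF a'W vW] form_null[OF s vW] va by simp
      finally have "k = 0" using r(1) by simp
      then have "w = s" unfolding ks(1) by (simp add: cfun.scale_zero_left)
      then show "w \<in> U" using s by simp
    qed
    moreover have "v \<in> cfun.span (insert a S)" unfolding v_def using a'S by (rule cfun.span_scale)
    ultimately show ?thesis using Y(1,2) mono by (intro exI[of _ "insert v Y"]) auto
  qed
qed

text \<open>
  The cardinality is the dimension of \<open>X\<close> modulo its intersection with the radical; the latter is
  measured by a subset of a basis of \<open>X\<close>.
\<close>

lemma orthonormal_complete_card:
  assumes "finite I" "orthonormal I b" "complete X I b" "cfun.subspace X" "X \<subseteq> W"
    "\<And>i. i \<in> I \<Longrightarrow> b i \<in> X"
    and G: "finite G" "cfun.independent G" "X = cfun.span G" "G0 \<subseteq> G" "X \<inter> U = cfun.span G0"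
  shows "card I + card G0 = card G"
proof -
  have bW: "\<And>j. j \<in> I \<Longrightarrow> b j \<in> W" using assms(2) by (simp add: orthonormal_def)
  have G0: "G0 \<subseteq> U" "finite G0" "cfun.independent G0"
    using cfun.span_superset[of G0] G(5) finite_subset[OF G(4,1)] cfun.independent_mono[OF G(2,4)] by auto
  have "cfun.independent (b ` J \<union> G0) \<and> card (b ` J \<union> G0) = card J + card G0" if "J \<subseteq> I" for J
  proof -
    have "finite J" using that assms(1) finite_subset by blast
    then show ?thesis using that
    proof (induction J rule: finite_induct)
      case empty
      then show ?case using G0 by simp
    next
      case (insert i J)
      have i: "i \<in> I" "b i \<in> W" using insert.prems bW by auto
      have "cfun.subspace {w \<in> W. \<beta> w (b i) = 0}"
        unfolding cfun.subspace_def
      proof (intro conjI allI ballI)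
        show "0 \<in> {w \<in> W. \<beta> w (b i) = 0}"
          using form_null[OF cfun.subspace_0[OF subspace_U] i(2)] W_closed(5) by blast
      qed (auto simp: form_add form_scale i(2) intro: W_closed)
      moreover have "b ` J \<union> G0 \<subseteq> {w \<in> W. \<beta> w (b i) = 0}"
      proof
        fix x assume "x \<in> b ` J \<union> G0"
        then consider j where "j \<in> J" "x = b j" | "x \<in> G0" by blast
        then show "x \<in> {w \<in> W. \<beta> w (b i) = 0}"
        proof cases
          case 1
          then have "j \<noteq> i" "j \<in> I" using insert by auto
          then show ?thesis using assms(2) i 1 by (simp add: orthonormal_def)
        next
          case 2
          then show ?thesis using G0(1) U_subset form_null[of x "b i"] i(2) by blast
        qed
      qed
      ultimately have "cfun.span (b ` J \<union> G0) \<subseteq> {w \<in> W. \<beta> w (b i) = 0}"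
        by (rule cfun.span_minimal[rotated])
      moreover have "\<beta> (b i) (b i) = 1" using assms(2) i by (simp add: orthonormal_def)
      ultimately have notin: "b i \<notin> cfun.span (b ` J \<union> G0)" by auto
      have "b i \<notin> b ` J \<union> G0" by (rule contra_subsetD[OF cfun.span_superset notin])
      moreover have "J \<subseteq> I" using insert.prems by blast
      note IH = insert.IH[OF this]
      moreover have "cfun.independent (insert (b i) (b ` J \<union> G0))"
        by (rule cfun.independent_insertI[OF notin conjunct1[OF IH]])
      ultimately show ?case using insert.hyps G0(2) by simp
    qed
  qed
  from this[OF subset_refl] have ind: "cfun.independent (b ` I \<union> G0)"
    and card: "card (b ` I \<union> G0) = card I + card G0" by auto
  have fin: "finite (b ` I \<union> G0)" using assms(1) G0(2) by simp
  have "G \<subseteq> cfun.span (b ` I \<union> G0)"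
  proof
    fix w assume "w \<in> G"
    then have w: "w \<in> X" unfolding G(3) by (rule cfun.span_base)
    define p where "p = (\<Sum>j\<in>I. cscale (\<beta> w (b j)) (b j))"
    have "w - p \<in> U" unfolding p_def using assms(1-6) w by (rule expansion)
    moreover have "w - p \<in> X" unfolding p_def
      using assms(4,6) w by (intro cfun.subspace_diff cfun.subspace_sum cfun.subspace_scale) auto
    ultimately have "w - p \<in> cfun.span G0" using G(5) by blast
    then have "w - p \<in> cfun.span (b ` I \<union> G0)" by (rule subsetD[OF cfun.span_mono, rotated]) (rule Un_upper2)
    moreover have "p \<in> cfun.span (b ` I \<union> G0)" unfolding p_def
      by (intro cfun.span_sum cfun.span_scale cfun.span_base) auto
    ultimately have "(w - p) + p \<in> cfun.span (b ` I \<union> G0)" by (rule cfun.span_add)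
    then show "w \<in> cfun.span (b ` I \<union> G0)" by simp
  qed
  moreover have "b ` I \<union> G0 \<subseteq> cfun.span G"
    using assms(6) G(4) cfun.span_superset[of G] unfolding G(3) by blast
  ultimately show ?thesis
    using cfun.independent_span_bound[OF fin G(2)] cfun.independent_span_bound[OF G(1) ind] card by simp
qed

end

section \<open>Orthonormal bases adapted to sl2\<close>

text \<open>
  The matrix coefficient of \<open>e\<close> from the basis vector \<open>j - 1\<close> to \<open>j\<close> of \<open>M_(2k+1)\<close>, and of \<open>f\<close> back.
\<close>

definition ladder :: "nat \<Rightarrow> nat \<Rightarrow> complex" where
  "ladder k j = of_real (sqrt (real j * (real (2 * k + 1) - real j)))"

lemma ladder_0 [simp]: "ladder k 0 = 0"
  by (simp add: ladder_def)

lemma cnj_ladder [simp]: "cnj (ladder k j) = ladder k j"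
  by (simp add: ladder_def)

lemma ladder_square:
  assumes "j \<le> 2 * k + 1"
  shows "ladder k j * ladder k j = of_real (real j * (real (2 * k + 1) - real j))"
proof -
  have "real j \<le> real (2 * k + 1)" using assms by (rule of_nat_mono)
  then have "0 \<le> real j * (real (2 * k + 1) - real j)" by simp
  then show ?thesis by (simp add: ladder_def flip: of_real_mult)
qed

lemma ladder_nonzero: "0 < j \<Longrightarrow> j \<le> 2 * k \<Longrightarrow> ladder k j \<noteq> 0"
  by (simp add: ladder_def)

text \<open>
  The relation \<open>f e = e f - h\<close> on the basis vector \<open>j\<close> of \<open>M_(2k+1)\<close>.
\<close>

lemma ladder_step:
  assumes "j \<le> 2 * k"
  shows "ladder k j * ladder k j + of_real (2 * real k - 2 * real j) = ladder k (Suc j) * ladder k (Suc j)"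
proof -
  have le: "j \<le> 2 * k + 1" "Suc j \<le> 2 * k + 1" using assms by auto
  have "real j * (real (2 * k + 1) - real j) + (2 * real k - 2 * real j)
      = real (Suc j) * (real (2 * k + 1) - real (Suc j))"
    by (simp add: algebra_simps)
  then show ?thesis unfolding ladder_square[OF le(1)] ladder_square[OF le(2)] of_real_add[symmetric] by (rule arg_cong)
qed

text \<open>
  \<open>X l\<close> is the weight space of weight \<open>2l - 2n\<close>; the scalar by which \<open>h\<close> acts on it enters through the
  commutator of \<open>e\<close> and \<open>f\<close>.
\<close>

locale sl2_form = semi_inner W U \<beta> for W U :: "('a \<Rightarrow> complex) set" and \<beta> +
  fixes n :: nat and X :: "nat \<Rightarrow> ('a \<Rightarrow> complex) set" and e f :: "('a \<Rightarrow> complex) \<Rightarrow> 'a \<Rightarrow> complex"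
  assumes subspace_X: "cfun.subspace (X l)"
    and X_subset: "X l \<subseteq> W"
    and X_finite: "\<exists>G. finite G \<and> X l = cfun.span G"
    and linmap_e: "linmap e" and linmap_f: "linmap f"
    and e_X: "w \<in> X l \<Longrightarrow> e w \<in> X (Suc l)"
    and f_X: "w \<in> X (Suc l) \<Longrightarrow> f w \<in> X l"
    and f_X0: "w \<in> X 0 \<Longrightarrow> f w = 0"
    and f_e: "w \<in> X l \<Longrightarrow> f (e w) = e (f w) + cscale (of_real (2 * real n - 2 * real l)) w"
    and adjoint: "v \<in> X l \<Longrightarrow> w \<in> X (Suc l) \<Longrightarrow> \<beta> (e v) w = \<beta> v (f w)"
    and orthogonal: "l \<noteq> l' \<Longrightarrow> v \<in> X l \<Longrightarrow> w \<in> X l' \<Longrightarrow> \<beta> v w = 0"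
begin

lemmas X_W = subsetD[OF X_subset]
lemmas X_closed = cfun.subspace_add[OF subspace_X] cfun.subspace_scale[OF subspace_X]
  cfun.subspace_diff[OF subspace_X] cfun.subspace_0[OF subspace_X]
lemmas U_closed = cfun.subspace_add[OF subspace_U] cfun.subspace_scale[OF subspace_U]
  cfun.subspace_diff[OF subspace_U] cfun.subspace_0[OF subspace_U]

lemma linmap_diff: "linmap F \<Longrightarrow> F (u - v) = F u - F v"
  by (metis linmap_add diff_add_cancel add_diff_cancel)

lemma adjoint': "v \<in> X l \<Longrightarrow> w \<in> X (Suc l) \<Longrightarrow> \<beta> w (e v) = \<beta> (f w) v"
  using adjoint[of v l w] form_herm[of "e v" w] form_herm[of v "f w"] e_X[of v l] f_X[of w l] X_W
  by metis

text \<open>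
  The radical is stable under \<open>e\<close> by adjointness.
\<close>

lemma e_U:
  assumes "u \<in> X l" "u \<in> U"
  shows "e u \<in> U"
proof (rule in_U_if)
  have "e u \<in> X (Suc l)" "f (e u) \<in> X l" using assms e_X f_X by auto
  then show "e u \<in> W" "\<beta> (e u) (e u) = 0"
    using adjoint[of u l "e u"] form_null[OF assms(2)] assms(1) X_W by auto
qed

definition prim :: "nat \<Rightarrow> ('a \<Rightarrow> complex) set" where
  "prim l = {w \<in> X l. f w \<in> U}"

lemma subspace_prim: "cfun.subspace (prim l)"
  unfolding cfun.subspace_def
proof (intro conjI allI ballI)
  have "f 0 \<in> U" using linmap_0[OF linmap_f] U_closed(4) by metis
  then show "0 \<in> prim l" using X_closed(4) unfolding prim_def by blast
next
  fix x y assume "x \<in> prim l" "y \<in> prim l"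
  then show "x + y \<in> prim l"
    unfolding prim_def mem_Collect_eq linmap_add[OF linmap_f] by (blast intro: X_closed U_closed)
next
  fix c x assume "x \<in> prim l"
  then show "cscale c x \<in> prim l"
    unfolding prim_def mem_Collect_eq linmap_scale[OF linmap_f] by (blast intro: X_closed U_closed)
qed

lemma prim_orthonormal_basis:
  "\<exists>Y. finite Y \<and> Y \<subseteq> prim l \<and> orthonormal Y (\<lambda>y. y) \<and> complete (prim l) Y (\<lambda>y. y)"
proof -
  obtain G where G: "finite G" "X l = cfun.span G" using X_finite by blast
  obtain B where B: "B \<subseteq> prim l" "cfun.independent B" "prim l \<subseteq> cfun.span B"
    using cfun.maximal_independent_subset by blast
  have "B \<subseteq> cfun.span G" using B(1) G(2) by (auto simp: prim_def)
  then have "finite B" using cfun.independent_span_bound[OF G(1) B(2)] by simp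
  moreover have "cfun.span B = prim l"
    using B cfun.span_minimal[OF B(1) subspace_prim] by blast
  moreover have "B \<subseteq> W" using B(1) X_W by (auto simp: prim_def)
  ultimately show ?thesis using gram_schmidt[of B] by simp
qed

text \<open>
  The normalized vector \<open>e^j v\<close>, for primitive \<open>v\<close> generating a copy of \<open>M_(2k+1)\<close>.
\<close>

primrec raise :: "nat \<Rightarrow> nat \<Rightarrow> ('a \<Rightarrow> complex) \<Rightarrow> 'a \<Rightarrow> complex" where
  "raise k 0 v = v"
| "raise k (Suc j) v = cscale (1 / ladder k (Suc j)) (e (raise k j v))"

lemma e_raise: "j < 2 * k \<Longrightarrow> e (raise k j v) = cscale (ladder k (Suc j)) (raise k (Suc j) v)"
  by (simp add: ladder_nonzero)

lemma raise_X: "k \<le> n \<Longrightarrow> v \<in> prim (n - k) \<Longrightarrow> raise k j v \<in> X (n - k + j)"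
  by (induction j) (auto simp: prim_def intro: X_closed e_X)

text \<open>
  One step of the induction that determines \<open>f\<close> on the raised vectors; the hypothesis says that \<open>e f\<close> acts on
  the \<open>j\<close>-th vector as in \<open>M_(2k+1)\<close>.
\<close>

lemma f_raise_aux:
  assumes "k \<le> n" "v \<in> prim (n - k)" "j < 2 * k"
    and "e (f (raise k j v)) - cscale (ladder k j * ladder k j) (raise k j v) \<in> U"
  shows "f (raise k (Suc j) v) - cscale (ladder k (Suc j)) (raise k j v) \<in> U"
proof -
  let ?v = "raise k j v" and ?c = "ladder k (Suc j)"
  have nz: "?c \<noteq> 0" using assms(3) by (simp add: ladder_nonzero)
  have level_part: "2 * real n - 2 * real (n - k + j) = 2 * real k - 2 * real j"
    using assms(1) by (simp add: of_nat_diff)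
  have "f (raise k (Suc j) v) = cscale (1 / ?c) (f (e ?v))"
    unfolding raise.simps by (rule linmap_scale[OF linmap_f])
  also have "f (e ?v) = e (f ?v) + cscale (of_real (2 * real k - 2 * real j)) ?v"
    using f_e[OF raise_X[OF assms(1,2)], of j] unfolding level_part .
  finally have "f (raise k (Suc j) v) = cscale (1 / ?c) (e (f ?v) + cscale (of_real (2 * real k - 2 * real j)) ?v)" .
  moreover have "?c = (ladder k j * ladder k j + of_real (2 * real k - 2 * real j)) / ?c"
    using ladder_step[of j k] assms(3) nz by (simp add: divide_simps)
  ultimately have "f (raise k (Suc j) v) - cscale ?c ?v
      = cscale (1 / ?c) (e (f ?v) + cscale (of_real (2 * real k - 2 * real j)) ?v)
        - cscale ((ladder k j * ladder k j + of_real (2 * real k - 2 * real j)) / ?c) ?v"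
    by (simp only:)
  also have "\<dots> = cscale (1 / ?c) (e (f ?v) - cscale (ladder k j * ladder k j) ?v)"
    by (rule ext) (simp add: cscale_def diff_divide_distrib add_divide_distrib algebra_simps)
  finally show ?thesis using U_closed(2)[OF assms(4)] by (simp only:)
qed

lemma e_f_raise:
  assumes "k \<le> n" "v \<in> prim (n - k)"
  shows "j \<le> 2 * k \<Longrightarrow> e (f (raise k j v)) - cscale (ladder k j * ladder k j) (raise k j v) \<in> U"
proof (induction j)
  case 0
  have "f v \<in> U" "v \<in> X (n - k)" using assms(2) by (auto simp: prim_def)
  have "e (f v) \<in> U"
  proof (cases "n - k")
    case 0
    then have "f v = 0" using f_X0 \<open>v \<in> X (n - k)\<close> by simp
    then show ?thesis using linmap_0[OF linmap_e] U_closed(4) by metis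
  next
    case (Suc l)
    then show ?thesis using e_U[of "f v" l] f_X[of v l] \<open>v \<in> X (n - k)\<close> \<open>f v \<in> U\<close> by simp
  qed
  then show ?case
    by (simp only: raise.simps ladder_0 mult_zero_left cfun.scale_zero_left diff_zero)
next
  case (Suc j)
  let ?v = "raise k j v" and ?w = "raise k (Suc j) v" and ?c = "ladder k (Suc j)"
  have "f ?w - cscale ?c ?v \<in> U" using Suc.prems by (intro f_raise_aux[OF assms _ Suc.IH]) auto
  moreover have "f ?w - cscale ?c ?v \<in> X (n - k + j)"
    using raise_X[OF assms, of j] raise_X[OF assms, of "Suc j"] by (intro X_closed f_X) auto
  ultimately have "e (f ?w - cscale ?c ?v) \<in> U" by (rule e_U[rotated])
  moreover have "e (f ?w - cscale ?c ?v) = e (f ?w) - cscale (?c * ?c) ?w"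
    unfolding linmap_diff[OF linmap_e] linmap_scale[OF linmap_e]
    using e_raise[of j k v] Suc.prems by (simp only: cfun.scale_scale)
  ultimately show ?case by (simp only:)
qed

lemma f_raise:
  assumes "k \<le> n" "v \<in> prim (n - k)" "j < 2 * k"
  shows "f (raise k (Suc j) v) - cscale (ladder k (Suc j)) (raise k j v) \<in> U"
  using assms(3) by (intro f_raise_aux[OF assms e_f_raise[OF assms(1,2)]]) simp

text \<open>
  The norm of \<open>e v\<close> for the top vector \<open>v\<close> is a multiple of the \<open>f e\<close>-eigenvalue, which is \<open>0\<close>.
\<close>

lemma e_raise_top:
  assumes "k \<le> n" "v \<in> prim (n - k)"
  shows "e (raise k (2 * k) v) \<in> U"
proof -
  let ?v = "raise k (2 * k) v" and ?l = "n - k + 2 * k"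
  have v: "?v \<in> X ?l" using assms by (rule raise_X)
  have level_part: "2 * real n - 2 * real ?l = - (2 * real k)" using assms(1) by (simp add: of_nat_diff)
  have "ladder k (2 * k) * ladder k (2 * k) = of_real (2 * real k)"
    by (subst ladder_square) simp_all
  then have "e (f ?v) - cscale (of_real (2 * real k)) ?v \<in> U"
    using e_f_raise[OF assms order_refl] by (simp only:)
  moreover have "f (e ?v) = e (f ?v) - cscale (of_real (2 * real k)) ?v"
    unfolding f_e[OF v] level_part by (auto simp: cscale_def)
  ultimately have "f (e ?v) \<in> U" by (simp only:)
  then have "\<beta> (e ?v) (e ?v) = 0"
    using adjoint[OF v, of "e ?v"] e_X[OF v] v X_W form_null_right[of "f (e ?v)" ?v] by auto
  then show ?thesis using e_X[OF v] X_W by (intro in_U_if) auto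
qed

text \<open>
  Vectors of different level are orthogonal.  On the same level, adjointness lowers both vectors
  simultaneously until one of them is primitive and is annihilated by \<open>f\<close>.
\<close>

lemma form_raise:
  assumes "k \<le> n" "v \<in> prim (n - k)" "k' \<le> n" "v' \<in> prim (n - k')"
  shows "j \<le> 2 * k \<Longrightarrow> j' \<le> 2 * k' \<Longrightarrow>
    \<beta> (raise k j v) (raise k' j' v') = (if k = k' \<and> j = j' then \<beta> v v' else 0)"
proof (induction j arbitrary: j')
  case 0
  have v: "v \<in> X (n - k)" "f v \<in> U" using assms(2) by (auto simp: prim_def)
  show ?case
  proof (cases "n - k = n - k' + j'")
    case False
    then have "\<beta> v (raise k' j' v') = 0" using v(1) raise_X[OF assms(3,4)] by (rule orthogonal)
    then show ?thesis using False by auto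
  next
    case True
    show ?thesis
    proof (cases j')
      case 0
      then show ?thesis using True assms by auto
    next
      case (Suc i)
      let ?w = "raise k' i v'"
      have w: "?w \<in> X (n - k' + i)" using assms(3,4) by (rule raise_X)
      have v': "v \<in> X (Suc (n - k' + i))" using v(1) True Suc by simp
      have "\<beta> v (e ?w) = 0"
        using adjoint'[OF w v'] form_null[OF v(2)] w X_W by auto
      then show ?thesis
        using Suc form_scale_right[of "e ?w" v "1 / ladder k' (Suc i)"] e_X[OF w] v(1) X_W by auto
    qed
  qed
next
  case (Suc i)
  let ?v = "raise k i v"
  have v: "?v \<in> X (n - k + i)" using assms(1,2) by (rule raise_X)
  show ?case
  proof (cases "n - k + Suc i = n - k' + j'")
    case False
    then have "\<beta> (raise k (Suc i) v) (raise k' j' v') = 0"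
      using raise_X[OF assms(1,2), of "Suc i"] raise_X[OF assms(3,4), of j'] by (rule orthogonal)
    then show ?thesis using False by auto
  next
    case True
    let ?w = "raise k' j' v'"
    have w: "?w \<in> X (Suc (n - k + i))" using raise_X[OF assms(3,4), of j'] True by simp
    have fw: "f ?w \<in> X (n - k + i)" using w by (rule f_X)
    have eq: "\<beta> (raise k (Suc i) v) ?w = 1 / ladder k (Suc i) * \<beta> ?v (f ?w)"
      using form_scale[of "e ?v" ?w] e_X[OF v] w X_W adjoint[OF v w] by simp
    show ?thesis
    proof (cases j')
      case 0
      then have "f ?w \<in> U" using assms(4) by (simp add: prim_def)
      then show ?thesis using eq form_null_right[of "f ?w" ?v] v X_W 0 by auto
    next
      case (Suc i')
      let ?u = "raise k' i' v'"
      have u: "?u \<in> X (n - k + i)" using raise_X[OF assms(3,4), of i'] True Suc by simp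
      have "\<beta> ?v (f ?w) = \<beta> ?v (cscale (ladder k' (Suc i')) ?u)"
        using f_raise[OF assms(3,4), of i'] Suc.prems Suc v u fw
        by (intro form_cong_right) (auto intro: X_W X_closed)
      also have "\<dots> = ladder k' (Suc i') * \<beta> ?v ?u"
        using form_scale_right[of ?u ?v] u v X_W by auto
      also have "\<beta> ?v ?u = (if k = k' \<and> i = i' then \<beta> v v' else 0)"
        using Suc.prems Suc by (intro Suc.IH) auto
      finally show ?thesis
        unfolding eq using Suc Suc.prems ladder_nonzero[of "Suc i" k] by auto
    qed
  qed
qed

text \<open>
  If \<open>w\<close> is orthogonal to all raised vectors of its level, so is \<open>f w\<close>, and by induction \<open>w\<close> is primitive.  Up
  to level \<open>n\<close> completeness of the primitive vectors applies.  Above level \<open>n\<close> the weight is positive, and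
  the squared norm of \<open>e w\<close> would be a negative multiple of that of \<open>w\<close>.
\<close>

theorem complete_raise:
  assumes K: "\<And>k. k \<le> n \<Longrightarrow> K k \<subseteq> prim (n - k) \<and> complete (prim (n - k)) (K k) (\<lambda>y. y)"
  shows "w \<in> X l \<Longrightarrow> (\<And>k j y. k \<le> n \<Longrightarrow> j \<le> 2 * k \<Longrightarrow> n - k + j = l \<Longrightarrow> y \<in> K k \<Longrightarrow> \<beta> w (raise k j y) = 0)
    \<Longrightarrow> w \<in> U"
proof (induction l arbitrary: w)
  case 0
  then have "w \<in> prim 0" using f_X0 U_closed(4) by (simp add: prim_def)
  moreover have "\<beta> w y = 0" if "y \<in> K n" for y using 0(2)[of n 0 y] that by simp
  ultimately show ?case using K[of n] by (auto simp: complete_def)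
next
  case (Suc l)
  have fw: "f w \<in> X l" using Suc.prems(1) by (rule f_X)
  have fwU: "f w \<in> U"
  proof (rule Suc.IH[OF fw])
    fix k j y assume k: "k \<le> n" and j: "j \<le> 2 * k" "n - k + j = l" and y: "y \<in> K k"
    have yp: "y \<in> prim (n - k)" using K[OF k] y by blast
    have r: "raise k j y \<in> X l" using raise_X[OF k yp, of j] j by simp
    have eq: "\<beta> (f w) (raise k j y) = \<beta> w (e (raise k j y))"
      using adjoint'[OF r Suc.prems(1)] by simp
    show "\<beta> (f w) (raise k j y) = 0"
    proof (cases "j = 2 * k")
      case True
      then have "e (raise k j y) \<in> U" using e_raise_top[OF k yp] by simp
      then show ?thesis unfolding eq using Suc.prems(1) X_W by (intro form_null_right) auto
    next
      case False
      have "\<beta> w (raise k (Suc j) y) = 0" using k j False y by (intro Suc.prems(2)) auto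
      moreover have "raise k (Suc j) y \<in> W" "w \<in> W"
        by (rule X_W[OF raise_X[OF k yp]], rule X_W[OF Suc.prems(1)])
      moreover have "e (raise k j y) = cscale (ladder k (Suc j)) (raise k (Suc j) y)"
        using False j(1) by (intro e_raise) simp
      ultimately show ?thesis unfolding eq by (simp only: form_scale_right mult_zero_right)
    qed
  qed
  then have wp: "w \<in> prim (Suc l)" using Suc.prems(1) by (simp add: prim_def)
  show ?case
  proof (cases "Suc l \<le> n")
    case True
    have "\<beta> w y = 0" if "y \<in> K (n - Suc l)" for y
      using Suc.prems(2)[of "n - Suc l" 0 y] that True by simp
    moreover have "n - (n - Suc l) = Suc l" using True by simp
    ultimately show ?thesis using K[of "n - Suc l"] wp by (auto simp: complete_def)
  next
    case False
    let ?c = "2 * real n - 2 * real (Suc l)"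
    have w: "w \<in> W" by (rule X_W[OF Suc.prems(1)])
    have ew: "e w \<in> X (Suc (Suc l))" "e w \<in> W" by (rule e_X[OF Suc.prems(1)], rule X_W[OF e_X[OF Suc.prems(1)]])
    have efw: "e (f w) \<in> U" using e_U[OF fw fwU] .
    have "\<beta> (e w) (e w) = \<beta> w (f (e w))" using adjoint[OF Suc.prems(1) ew(1)] .
    also have "\<dots> = \<beta> w (e (f w)) + \<beta> w (cscale (of_real ?c) w)"
      unfolding f_e[OF Suc.prems(1)] using w efw U_subset by (intro form_add_right W_closed) auto
    also have "\<dots> = of_real ?c * \<beta> w w"
      using form_null_right[OF efw w] form_scale_right[OF w w] by simp
    finally have "Re (\<beta> (e w) (e w)) = ?c * Re (\<beta> w w)" by simp
    moreover have "0 \<le> Re (\<beta> (e w) (e w))"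
      using form_pos[OF ew(2)] form_null[of "e w" "e w"] ew(2) by (cases "e w \<in> U") auto
    moreover have "?c < 0" using False by simp
    moreover have "?c * Re (\<beta> w w) < 0" if "w \<notin> U"
      using mult_neg_pos[OF _ form_pos[OF w that]] False by simp
    ultimately show ?thesis by linarith
  qed
qed

text \<open>
  The raised vectors at level \<open>l \<le> n\<close> are counted by the primitive vectors of all levels up to \<open>l\<close>,
  so the number of primitive vectors of level \<open>l\<close> is \<open>D l - D (l - 1)\<close>.  Hence any index sets \<open>A k\<close>
  of the right size can label them.
\<close>

theorem adapted_basis:
  fixes A :: "nat \<Rightarrow> 't set" and D :: "nat \<Rightarrow> nat"
  assumes D: "\<And>l (I :: (nat \<times> ('a \<Rightarrow> complex)) set) b. \<lbrakk>finite I; orthonormal I b; complete (X l) I b;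
      \<And>i. i \<in> I \<Longrightarrow> b i \<in> X l\<rbrakk> \<Longrightarrow> card I = D l"
    and A: "\<And>k. k \<le> n \<Longrightarrow> finite (A k)"
      "\<And>k. k \<le> n \<Longrightarrow> card (A k) + (if k = n then 0 else D (n - k - 1)) = D (n - k)"
  obtains b where
    "\<And>k j \<tau>. k \<le> n \<Longrightarrow> \<tau> \<in> A k \<Longrightarrow> b (k, j, \<tau>) \<in> X (n - k + j)"
    "\<And>k j \<tau> k' j' \<tau>'. k \<le> n \<Longrightarrow> j \<le> 2 * k \<Longrightarrow> \<tau> \<in> A k \<Longrightarrow> k' \<le> n \<Longrightarrow> j' \<le> 2 * k' \<Longrightarrow> \<tau>' \<in> A k' \<Longrightarrow>
      \<beta> (b (k, j, \<tau>)) (b (k', j', \<tau>')) = (if (k, j, \<tau>) = (k', j', \<tau>') then 1 else 0)"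
    "\<And>w l. w \<in> X l \<Longrightarrow> (\<And>k j \<tau>. k \<le> n \<Longrightarrow> j \<le> 2 * k \<Longrightarrow> n - k + j = l \<Longrightarrow> \<tau> \<in> A k \<Longrightarrow> \<beta> w (b (k, j, \<tau>)) = 0)
      \<Longrightarrow> w \<in> U"
    "\<And>k j \<tau>. k \<le> n \<Longrightarrow> j < 2 * k \<Longrightarrow> \<tau> \<in> A k \<Longrightarrow> e (b (k, j, \<tau>)) = cscale (ladder k (Suc j)) (b (k, Suc j, \<tau>))"
    "\<And>k \<tau>. k \<le> n \<Longrightarrow> \<tau> \<in> A k \<Longrightarrow> e (b (k, 2 * k, \<tau>)) \<in> U"
    "\<And>k \<tau>. k \<le> n \<Longrightarrow> \<tau> \<in> A k \<Longrightarrow> f (b (k, 0, \<tau>)) \<in> U"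
    "\<And>k j \<tau>. k \<le> n \<Longrightarrow> j < 2 * k \<Longrightarrow> \<tau> \<in> A k \<Longrightarrow>
      f (b (k, Suc j, \<tau>)) - cscale (ladder k (Suc j)) (b (k, j, \<tau>)) \<in> U"
proof -
  have "\<forall>k. \<exists>Y. finite Y \<and> Y \<subseteq> prim (n - k) \<and> orthonormal Y (\<lambda>y. y) \<and> complete (prim (n - k)) Y (\<lambda>y. y)"
    using prim_orthonormal_basis by blast
  then obtain K where K: "\<And>k. finite (K k)" "\<And>k. K k \<subseteq> prim (n - k)"
      "\<And>k. orthonormal (K k) (\<lambda>y. y)" "\<And>k. complete (prim (n - k)) (K k) (\<lambda>y. y)"
    by metis
  \<comment> \<open>a copy of \<open>M_(2k+1)\<close> meets the levels from \<open>n - k\<close> to \<open>n + k\<close>, each of them once\<close>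
  have sumK: "(\<Sum>k\<in>{n - l..n}. card (K k)) = D l" if l: "l \<le> n" for l
  proof -
    define I where "I = Sigma {n - l..n} K"
    define b where "b = (\<lambda>(k, y). raise k (l - (n - k)) y)"
    have I: "k \<le> n" "l - (n - k) \<le> 2 * k" "n - k + (l - (n - k)) = l" "y \<in> prim (n - k)" "y \<in> K k"
      if "(k, y) \<in> I" for k y
      using that l K(2) by (auto simp: I_def)
    have bX: "b i \<in> X l" if "i \<in> I" for i
    proof -
      obtain k y where i: "i = (k, y)" by (cases i)
      have ky: "(k, y) \<in> I" using that i by simp
      show ?thesis
        using raise_X[OF I(1)[OF ky] I(4)[OF ky], of "l - (n - k)"] unfolding b_def i prod.case I(3)[OF ky] .
    qed
    have "orthonormal I b"
      unfolding orthonormal_def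
    proof (intro conjI ballI)
      fix i assume "i \<in> I"
      then show "b i \<in> W" using bX X_W by blast
    next
      fix i i' assume ii: "i \<in> I" "i' \<in> I"
      obtain k y k' y' where i: "i = (k, y)" "i' = (k', y')" by (cases i; cases i')
      note h = I[OF ii(1)[unfolded i]] I[OF ii(2)[unfolded i]]
      have "\<beta> (b i) (b i') = (if k = k' \<and> l - (n - k) = l - (n - k') then \<beta> y y' else 0)"
        unfolding b_def i prod.case using h by (intro form_raise) auto
      also have "\<dots> = (if i = i' then 1 else 0)"
        using K(3)[of k] h(5) h(10) by (auto simp: i orthonormal_def)
      finally show "\<beta> (b i) (b i') = (if i = i' then 1 else 0)" .
    qed
    moreover have "complete (X l) I b"
      unfolding complete_def
    proof (intro ballI impI)
      fix w assume w: "w \<in> X l" "\<forall>i\<in>I. \<beta> w (b i) = 0"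
      show "w \<in> U"
      proof (rule complete_raise[of K w l])
        show "K k \<subseteq> prim (n - k) \<and> complete (prim (n - k)) (K k) (\<lambda>y. y)" for k using K by blast
        show "w \<in> X l" by (rule w)
        fix k j y assume k: "k \<le> n" "j \<le> 2 * k" "n - k + j = l" "y \<in> K k"
        then have "(k, y) \<in> I" "j = l - (n - k)" by (auto simp: I_def)
        then show "\<beta> w (raise k j y) = 0" using w(2) by (auto simp: b_def)
      qed
    qed
    moreover have "finite I" using K(1) by (simp add: I_def)
    ultimately have "card I = D l" using bX by (intro D)
    then show ?thesis using K(1) by (simp add: I_def)
  qed
  have cardK: "card (K k) = card (A k)" if k: "k \<le> n" for k
  proof (cases "k = n")
    case True
    then show ?thesis using sumK[of 0] A(2)[of n] by simp
  next
    case False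
    have "{n - (n - k)..n} = insert k {n - (n - k - 1)..n}" using k False by auto
    then have "(\<Sum>k\<in>{n - (n - k)..n}. card (K k)) = card (K k) + (\<Sum>k\<in>{n - (n - k - 1)..n}. card (K k))"
      using k False by (simp only:) (subst sum.insert; auto)
    then have "D (n - k) = card (K k) + D (n - k - 1)" using sumK[of "n - k"] sumK[of "n - k - 1"] by simp
    then show ?thesis using A(2)[OF k] False by simp
  qed
  have "\<exists>\<theta>. bij_betw \<theta> (A k) (K k)" if "k \<le> n" for k
    using finite_same_card_bij[of "A k" "K k"] A(1) K(1) cardK that by simp
  then obtain \<theta> where \<theta>: "\<And>k. k \<le> n \<Longrightarrow> bij_betw (\<theta> k) (A k) (K k)" by metis
  have \<theta>K: "\<theta> k \<tau> \<in> K k" if "k \<le> n" "\<tau> \<in> A k" for k \<tau>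
    using \<theta>[OF that(1)] that(2) by (auto simp: bij_betw_def)
  have \<theta>p: "\<theta> k \<tau> \<in> prim (n - k)" if "k \<le> n" "\<tau> \<in> A k" for k \<tau>
    using \<theta>K[OF that] K(2) by blast
  define b where "b = (\<lambda>(k, j, \<tau>). raise k j (\<theta> k \<tau>))"
  show thesis
  proof (rule that[of b])
    fix k j \<tau> assume "k \<le> n" "\<tau> \<in> A k"
    then show "b (k, j, \<tau>) \<in> X (n - k + j)" using raise_X \<theta>p by (simp add: b_def)
  next
    fix k j \<tau> k' j' \<tau>'
    assume h: "k \<le> n" "j \<le> 2 * k" "\<tau> \<in> A k" "k' \<le> n" "j' \<le> 2 * k'" "\<tau>' \<in> A k'"
    have "\<beta> (b (k, j, \<tau>)) (b (k', j', \<tau>')) = (if k = k' \<and> j = j' then \<beta> (\<theta> k \<tau>) (\<theta> k' \<tau>') else 0)"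
      unfolding b_def prod.case using h \<theta>p by (intro form_raise) auto
    also have "\<dots> = (if (k, j, \<tau>) = (k', j', \<tau>') then 1 else 0)"
    proof (cases "k = k'")
      case True
      have "\<theta> k \<tau> = \<theta> k \<tau>' \<longleftrightarrow> \<tau> = \<tau>'" using \<theta>[OF h(1)] h True by (auto simp: bij_betw_def inj_on_eq_iff)
      then show ?thesis using K(3)[of k] \<theta>K h True by (auto simp: orthonormal_def)
    qed simp
    finally show "\<beta> (b (k, j, \<tau>)) (b (k', j', \<tau>')) = (if (k, j, \<tau>) = (k', j', \<tau>') then 1 else 0)" .
  next
    fix w l assume w: "w \<in> X l"
      and 0: "\<And>k j \<tau>. k \<le> n \<Longrightarrow> j \<le> 2 * k \<Longrightarrow> n - k + j = l \<Longrightarrow> \<tau> \<in> A k \<Longrightarrow> \<beta> w (b (k, j, \<tau>)) = 0"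
    show "w \<in> U"
    proof (rule complete_raise[of K w l])
      show "K k \<subseteq> prim (n - k) \<and> complete (prim (n - k)) (K k) (\<lambda>y. y)" for k using K by blast
      show "w \<in> X l" by (rule w)
      fix k j y assume k: "k \<le> n" "j \<le> 2 * k" "n - k + j = l" "y \<in> K k"
      then obtain \<tau> where "\<tau> \<in> A k" "y = \<theta> k \<tau>" using \<theta>[OF k(1)] by (auto simp: bij_betw_def)
      then show "\<beta> w (raise k j y) = 0" using 0[OF k(1-3)] by (simp add: b_def)
    qed
  next
    fix k j \<tau> assume "k \<le> n" "j < 2 * k" "\<tau> \<in> A k"
    then show "e (b (k, j, \<tau>)) = cscale (ladder k (Suc j)) (b (k, Suc j, \<tau>))"
      unfolding b_def prod.case by (intro e_raise)
  next
    fix k \<tau> assume "k \<le> n" "\<tau> \<in> A k"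
    then show "e (b (k, 2 * k, \<tau>)) \<in> U"
      unfolding b_def prod.case using \<theta>p by (intro e_raise_top) auto
  next
    fix k \<tau> assume "k \<le> n" "\<tau> \<in> A k"
    then show "f (b (k, 0, \<tau>)) \<in> U" using \<theta>p by (simp add: b_def prim_def)
  next
    fix k j \<tau> assume "k \<le> n" "j < 2 * k" "\<tau> \<in> A k"
    then show "f (b (k, Suc j, \<tau>)) - cscale (ladder k (Suc j)) (b (k, j, \<tau>)) \<in> U"
      unfolding b_def prod.case using \<theta>p by (intro f_raise) auto
  qed
qed

end


section \<open>The fusion product\<close>

locale fusion_form =
  fixes n :: nat and z :: "nat \<Rightarrow> complex"
    and B :: "(nat \<Rightarrow> tensor set) \<Rightarrow> (nat \<Rightarrow> tensor set) \<Rightarrow> complex"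
  assumes inj_z: "inj_on z {..<2 * n}"
    and unitary: "unitary_rep (fusion (2 * n) z B)"
    and orthogonal: "orthogonal_grading (fusion (2 * n) z B)"
begin

abbreviation lt :: "nat \<Rightarrow> tensor set" where "lt m \<equiv> V_lt (2 * n) z m"

abbreviation act :: "complex^2^2 \<Rightarrow> tensor \<Rightarrow> tensor" where "act x \<equiv> tensor_act (2 * n) (\<lambda>_. 1) x"

lemmas lt_closed = cfun.subspace_add[OF subspace_V_lt] cfun.subspace_scale[OF subspace_V_lt]
  cfun.subspace_diff[OF subspace_V_lt] cfun.subspace_0[OF subspace_V_lt]

definition coset :: "nat \<Rightarrow> tensor \<Rightarrow> tensor set" where
  "coset m a = {a + u | u. u \<in> lt m}"

lemma in_coset: "x \<in> coset m a \<longleftrightarrow> x - a \<in> lt m"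
proof
  assume "x - a \<in> lt m"
  moreover have "x = a + (x - a)" by (rule add_diff_cancel_left'[symmetric, THEN trans]) (simp only: add_diff_eq add_diff_cancel_left')
  ultimately show "x \<in> coset m a" unfolding coset_def by blast
next
  assume "x \<in> coset m a"
  then obtain u where "x = a + u" "u \<in> lt m" unfolding coset_def by blast
  then show "x - a \<in> lt m" by (simp only: add_diff_cancel_left')
qed

lemma coset_eq_iff: "coset m a = coset m b \<longleftrightarrow> a - b \<in> lt m"
proof
  assume "coset m a = coset m b"
  moreover have "a \<in> coset m a" unfolding in_coset diff_self by (rule lt_closed)
  ultimately show "a - b \<in> lt m" by (simp only: in_coset)
next
  assume ab: "a - b \<in> lt m"
  show "coset m a = coset m b"
  proof (intro set_eqI)
    fix x
    have "x - b = (x - a) + (a - b)" "x - a = (x - b) - (a - b)" by simp_all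
    then show "x \<in> coset m a \<longleftrightarrow> x \<in> coset m b" unfolding in_coset using ab lt_closed(1,3) by metis
  qed
qed

lemma coset_0: "coset m 0 = lt m"
  by (rule set_eqI) (simp only: in_coset diff_zero)

lemma coset_add: "{x + y | x y. x \<in> coset m a \<and> y \<in> coset m b} = coset m (a + b)"
proof (intro set_eqI iffI)
  fix w assume "w \<in> {x + y | x y. x \<in> coset m a \<and> y \<in> coset m b}"
  then obtain x y where "w = x + y" "x - a \<in> lt m" "y - b \<in> lt m" unfolding in_coset by blast
  then show "w \<in> coset m (a + b)" unfolding in_coset using lt_closed(1) by (metis add_diff_add)
next
  fix w assume "w \<in> coset m (a + b)"
  then have "w - b - a \<in> lt m" unfolding in_coset by (simp only: diff_diff_eq add.commute)
  moreover have "b - b \<in> lt m" unfolding diff_self by (rule lt_closed)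
  moreover have "w = (w - b) + b" by (simp only: diff_add_cancel)
  ultimately show "w \<in> {x + y | x y. x \<in> coset m a \<and> y \<in> coset m b}" unfolding in_coset by blast
qed

lemma coset_linmap:
  assumes "linmap F" "\<And>u. u \<in> lt m \<Longrightarrow> F u \<in> lt m"
  shows "{F x + u | x u. x \<in> coset m a \<and> u \<in> lt m} = coset m (F a)"
proof (intro set_eqI iffI)
  fix w assume "w \<in> {F x + u | x u. x \<in> coset m a \<and> u \<in> lt m}"
  then obtain x u where w: "w = F x + u" "x - a \<in> lt m" "u \<in> lt m" unfolding in_coset by blast
  have "F (x - a) + F a = F x" unfolding linmap_add[OF assms(1), symmetric] diff_add_cancel ..
  moreover have "(p + q + u) - q = p + u" for p q u :: tensor by (rule ext) simp
  ultimately have "w - F a = F (x - a) + u" unfolding w(1) by metis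
  then show "w \<in> coset m (F a)" unfolding in_coset using assms(2)[OF w(2)] w(3) lt_closed(1) by metis
next
  fix w assume w: "w \<in> coset m (F a)"
  have "a \<in> coset m a" unfolding in_coset diff_self by (rule lt_closed)
  moreover have "w = F a + (w - F a)" by (rule ext) simp
  ultimately show "w \<in> {F x + u | x u. x \<in> coset m a \<and> u \<in> lt m}"
    using w unfolding in_coset[of w] by blast
qed

lemma linmap_cscale: "linmap (cscale c)"
  by (auto simp: linmap_def cscale_def algebra_simps)

lemma current_act_0: "current_act N z x 0 = tensor_act N (\<lambda>_. 1) x"
  by (simp add: current_act_def)

text \<open>
  The choices of representatives for the homogeneous components of elements of the associated graded space.
\<close>

definition fam :: "(nat \<Rightarrow> tensor) set" where
  "fam = {a. (\<forall>m. a m \<in> lt (Suc m)) \<and> finite {m. a m \<notin> lt m}}"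

definition cosets :: "(nat \<Rightarrow> tensor) \<Rightarrow> nat \<Rightarrow> tensor set" where
  "cosets a = (\<lambda>m. coset m (a m))"

text \<open>
  The family concentrated in degree \<open>m\<close>.
\<close>

definition at_deg :: "nat \<Rightarrow> tensor \<Rightarrow> nat \<Rightarrow> tensor" where
  "at_deg m a = (\<lambda>k. if k = m then a else 0)"

lemma lt_Suc: "u \<in> lt m \<Longrightarrow> u \<in> lt (Suc m)"
  by (rule subsetD[OF V_lt_mono[OF le_SucI[OF order_refl]]])

lemma at_deg_same: "at_deg m a m = a"
  and at_deg_diff: "k \<noteq> m \<Longrightarrow> at_deg m a k = 0"
  by (simp_all only: at_deg_def refl if_True if_False)

lemma famD: "a \<in> fam \<Longrightarrow> a m \<in> lt (Suc m)"
  by (simp add: fam_def)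

lemma fam_linmap:
  assumes "a \<in> fam" "linmap F" "\<And>m u. u \<in> lt m \<Longrightarrow> F u \<in> lt m"
  shows "(\<lambda>m. F (a m)) \<in> fam"
proof -
  have "{m. F (a m) \<notin> lt m} \<subseteq> {m. a m \<notin> lt m}" using assms(3) by blast
  then show ?thesis using assms(1,3) unfolding fam_def by (auto intro: finite_subset)
qed

lemma fam_add:
  assumes "a \<in> fam" "b \<in> fam"
  shows "(\<lambda>m. a m + b m) \<in> fam"
proof -
  have "{m. a m + b m \<notin> lt m} \<subseteq> {m. a m \<notin> lt m} \<union> {m. b m \<notin> lt m}" using lt_closed(1) by blast
  moreover have "finite ({m. a m \<notin> lt m} \<union> {m. b m \<notin> lt m})" using assms by (simp add: fam_def)
  ultimately have "finite {m. a m + b m \<notin> lt m}" by (rule finite_subset)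
  moreover have "a m + b m \<in> lt (Suc m)" for m using famD[OF assms(1)] famD[OF assms(2)] by (rule lt_closed)
  ultimately show ?thesis unfolding fam_def by blast
qed

lemma at_deg_fam: "a \<in> lt (Suc m) \<Longrightarrow> at_deg m a \<in> fam"
proof -
  assume a: "a \<in> lt (Suc m)"
  have "{k. at_deg m a k \<notin> lt k} \<subseteq> {m}" using lt_closed(4) by (auto simp: at_deg_def)
  then have "finite {k. at_deg m a k \<notin> lt k}" by (rule finite_subset) simp
  moreover have "at_deg m a k \<in> lt (Suc k)" for k 
    using a lt_closed(4) at_deg_same at_deg_diff by metis
  ultimately show ?thesis unfolding fam_def by blast
qed

lemma quot_eq: "quot (2 * n) z m = coset m ` lt (Suc m)"
  unfolding quot_def V_le_eq coset_def by blast

lemma fusion_carr_eq: "fusion_carr (2 * n) z = cosets ` fam"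
proof (intro set_eqI iffI)
  fix v assume v: "v \<in> fusion_carr (2 * n) z"
  have "\<forall>m. \<exists>a. a \<in> lt (Suc m) \<and> v m = coset m a" using v unfolding fusion_carr_def quot_eq by blast
  then obtain a where a: "\<And>m. a m \<in> lt (Suc m)" "\<And>m. v m = coset m (a m)" by metis
  have "v m = lt m \<longleftrightarrow> a m \<in> lt m" for m
    unfolding a(2) coset_0[symmetric] coset_eq_iff by (simp only: coset_0 diff_zero)
  then have "a \<in> fam" using v a(1) unfolding fam_def fusion_carr_def by simp
  moreover have "v = cosets a" by (rule ext) (simp add: cosets_def a(2))
  ultimately show "v \<in> cosets ` fam" by blast
next
  fix v assume "v \<in> cosets ` fam"
  then obtain a where a: "a \<in> fam" "v = cosets a" by blast
  have "coset m (a m) = lt m \<longleftrightarrow> a m \<in> lt m" for m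
    using coset_eq_iff[of m "a m" 0] by (simp only: coset_0 diff_zero)
  then show "v \<in> fusion_carr (2 * n) z"
    using a unfolding fusion_carr_def quot_eq fam_def cosets_def by simp
qed

lemma cosets_eq_iff: "cosets a = cosets b \<longleftrightarrow> (\<forall>m. a m - b m \<in> lt m)"
  by (simp only: cosets_def fun_eq_iff coset_eq_iff)

lemma fusion_carr: "carr (fusion (2 * n) z B) = cosets ` fam"
  by (simp add: fusion_def fusion_carr_eq)

lemma fusion_add: "vadd (fusion (2 * n) z B) (cosets a) (cosets b) = cosets (\<lambda>m. a m + b m)"
  by (simp add: fusion_def cosets_def coset_add)

lemma fusion_scale: "vscale (fusion (2 * n) z B) c (cosets a) = cosets (\<lambda>m. cscale c (a m))"
  by (simp add: fusion_def cosets_def coset_linmap[OF linmap_cscale lt_closed(2)])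

lemma fusion_act:
  assumes "x \<in> sl2"
  shows "vact (fusion (2 * n) z B) x (cosets a) = cosets (\<lambda>m. act x (a m))"
  by (simp add: fusion_def cosets_def current_act_0 coset_linmap[OF linmap_tensor_act V_lt_sl2[OF assms]])

lemma fusion_zero: "vzero (fusion (2 * n) z B) = cosets (\<lambda>_. 0)"
  by (simp only: fusion_def cosets_def coset_0 sl2_rep.simps)

lemma fusion_deg: "deg (fusion (2 * n) z B) m = cosets ` {a \<in> fam. \<forall>k. k \<noteq> m \<longrightarrow> a k \<in> lt k}"
proof -
  have "cosets a k = lt k \<longleftrightarrow> a k \<in> lt k" for a k
    using coset_eq_iff[of k "a k" 0] by (simp only: cosets_def coset_0 diff_zero)
  then show ?thesis by (auto simp: fusion_def fusion_carr_eq)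
qed

lemma fam_scale: "a \<in> fam \<Longrightarrow> (\<lambda>m. cscale c (a m)) \<in> fam"
  by (rule fam_linmap[OF _ linmap_cscale lt_closed(2)])

lemma fam_act: "x \<in> sl2 \<Longrightarrow> a \<in> fam \<Longrightarrow> (\<lambda>m. act x (a m)) \<in> fam"
  by (rule fam_linmap[OF _ linmap_tensor_act V_lt_sl2])

lemma B_add: "\<lbrakk>a \<in> fam; b \<in> fam; c \<in> fam\<rbrakk> \<Longrightarrow> B (cosets (\<lambda>m. a m + b m)) (cosets c) = B (cosets a) (cosets c) + B (cosets b) (cosets c)"
proof -
  assume h: "a \<in> fam" "b \<in> fam" "c \<in> fam"
  have ip: "ip (fusion (2 * n) z B) = B" by (simp add: fusion_def)
  have "B (vadd (fusion (2 * n) z B) (cosets a) (cosets b)) (cosets c) = B (cosets a) (cosets c) + B (cosets b) (cosets c)"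
    using unitary h unfolding unitary_rep_def fusion_carr ip by blast
  then show ?thesis unfolding fusion_add .
qed

lemma B_scale: "\<lbrakk>a \<in> fam; c \<in> fam\<rbrakk> \<Longrightarrow> B (cosets (\<lambda>m. cscale r (a m))) (cosets c) = r * B (cosets a) (cosets c)"
proof -
  assume h: "a \<in> fam" "c \<in> fam"
  have ip: "ip (fusion (2 * n) z B) = B" by (simp add: fusion_def)
  have "B (vscale (fusion (2 * n) z B) r (cosets a)) (cosets c) = r * B (cosets a) (cosets c)"
    using unitary h unfolding unitary_rep_def fusion_carr ip by blast
  then show ?thesis unfolding fusion_scale .
qed

lemma B_herm: "\<lbrakk>a \<in> fam; c \<in> fam\<rbrakk> \<Longrightarrow> B (cosets c) (cosets a) = cnj (B (cosets a) (cosets c))"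
proof -
  assume h: "a \<in> fam" "c \<in> fam"
  have ip: "ip (fusion (2 * n) z B) = B" by (simp add: fusion_def)
  show ?thesis using unitary h unfolding unitary_rep_def fusion_carr ip by blast
qed

lemma B_pos: "a \<in> fam \<Longrightarrow> a m \<notin> lt m \<Longrightarrow> 0 < Re (B (cosets a) (cosets a))"
proof -
  assume h: "a \<in> fam" "a m \<notin> lt m"
  have ip: "ip (fusion (2 * n) z B) = B" by (simp add: fusion_def)
  have "cosets a \<noteq> vzero (fusion (2 * n) z B)"
    unfolding fusion_zero cosets_eq_iff diff_zero using h(2) by blast
  then show ?thesis using unitary h unfolding unitary_rep_def fusion_carr ip by blast
qed

lemma B_act: "\<lbrakk>x \<in> sl2; conj_transpose x \<in> sl2; a \<in> fam; c \<in> fam\<rbrakk> \<Longrightarrow>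
    B (cosets (\<lambda>m. act x (a m))) (cosets c) = B (cosets a) (cosets (\<lambda>m. act (conj_transpose x) (c m)))"
proof -
  assume h: "x \<in> sl2" "conj_transpose x \<in> sl2" "a \<in> fam" "c \<in> fam"
  have ip: "ip (fusion (2 * n) z B) = B" by (simp add: fusion_def)
  have "B (vact (fusion (2 * n) z B) x (cosets a)) (cosets c) = B (cosets a) (vact (fusion (2 * n) z B) (conj_transpose x) (cosets c))"
    using unitary h unfolding unitary_rep_def fusion_carr ip by blast
  then show ?thesis unfolding fusion_act[OF h(1)] fusion_act[OF h(2)] .
qed

lemma B_zero: "c \<in> fam \<Longrightarrow> B (cosets (\<lambda>_. 0)) (cosets c) = 0"
  using B_scale[of c c 0] unfolding cfun.scale_zero_left by simp

lemma B_orthogonal: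
  assumes "m \<noteq> k" "a \<in> lt (Suc m)" "b \<in> lt (Suc k)"
  shows "B (cosets (at_deg m a)) (cosets (at_deg k b)) = 0"
proof -
  have deg: "cosets (at_deg m a) \<in> deg (fusion (2 * n) z B) m" if "a \<in> lt (Suc m)" for m a
  proof -
    have "at_deg m a i \<in> lt i" if "i \<noteq> m" for i using that lt_closed(4) by (simp only: at_deg_def if_False)
    then show ?thesis unfolding fusion_deg using at_deg_fam[OF that] by blast
  qed
  have ip: "ip (fusion (2 * n) z B) = B" by (simp add: fusion_def)
  show ?thesis
    using orthogonal deg[OF assms(2)] deg[OF assms(3)] assms(1) unfolding orthogonal_grading_def ip by blast
qed

definition form :: "nat \<Rightarrow> tensor \<Rightarrow> tensor \<Rightarrow> complex" where
  "form m a b = B (cosets (at_deg m a)) (cosets (at_deg m b))"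

text \<open>
  An element of the associated graded space is the finite sum of its components.
\<close>

lemma B_components:
  assumes "a \<in> fam" "c \<in> fam" "finite K" "{m. a m \<notin> lt m} \<subseteq> K"
  shows "B (cosets a) (cosets c) = (\<Sum>m\<in>K. B (cosets (at_deg m (a m))) (cosets c))"
proof -
  \<comment> \<open>truncation to the degrees in \<open>K\<close>, which loses nothing once \<open>K\<close> contains the support\<close>
  define r where "r K = (\<lambda>m. if m \<in> K then a m else 0)" for K
  have rfam: "r K \<in> fam" for K
  proof -
    have "{m. r K m \<notin> lt m} \<subseteq> {m. a m \<notin> lt m}" using lt_closed(4) by (auto simp: r_def)
    moreover have "finite {m. a m \<notin> lt m}" using assms(1) by (simp add: fam_def)
    ultimately have "finite {m. r K m \<notin> lt m}" by (rule finite_subset)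
    moreover have "r K m \<in> lt (Suc m)" for m
      using famD[OF assms(1)] lt_closed(4) by (cases "m \<in> K") (simp_all only: r_def if_True if_False)
    ultimately show ?thesis unfolding fam_def by blast
  qed
  have "B (cosets (r K)) (cosets c) = (\<Sum>m\<in>K. B (cosets (at_deg m (a m))) (cosets c))"
    using assms(3)
  proof (induction K rule: finite_induct)
    case empty
    have "r {} = (\<lambda>_. 0)" by (rule ext) (simp only: r_def empty_iff if_False)
    then show ?case using B_zero[OF assms(2)] by (simp only: sum.empty)
  next
    case (insert k K)
    have "r (insert k K) = (\<lambda>m. at_deg k (a k) m + r K m)"
    proof
      fix m
      show "r (insert k K) m = at_deg k (a k) m + r K m"
        using insert.hyps(2)
        by (cases "m = k"; cases "m \<in> K")
          (simp_all only: r_def at_deg_def insert_iff if_True if_False simp_thms add_0_left add_0_right)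
    qed
    then have "B (cosets (r (insert k K))) (cosets c) = B (cosets (at_deg k (a k))) (cosets c) + B (cosets (r K)) (cosets c)"
      using B_add[OF at_deg_fam[OF famD[OF assms(1)]] rfam assms(2)] by (simp only:)
    then show ?case unfolding insert.IH sum.insert[OF insert.hyps] .
  qed
  moreover have "cosets (r K) = cosets a"
    unfolding cosets_eq_iff
  proof
    fix m
    show "r K m - a m \<in> lt m"
    proof (cases "m \<in> K")
      case True
      then show ?thesis using lt_closed(4) by (simp only: r_def if_True diff_self)
    next
      case False
      then have "a m \<in> lt m" using assms(4) by blast
      then have "0 - a m \<in> lt m" using lt_closed(4) by (intro lt_closed(3))
      then show ?thesis using False by (simp only: r_def if_False)
    qed
  qed
  ultimately show ?thesis by simp
qed

lemma B_at_deg: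
  assumes "a \<in> fam" "b \<in> lt (Suc m)"
  shows "B (cosets a) (cosets (at_deg m b)) = form m (a m) b"
proof -
  let ?K = "insert m {m. a m \<notin> lt m}"
  have fin: "finite ?K" using assms(1) by (simp add: fam_def)
  have "B (cosets a) (cosets (at_deg m b)) = (\<Sum>k\<in>?K. B (cosets (at_deg k (a k))) (cosets (at_deg m b)))"
    using assms(1) at_deg_fam[OF assms(2)] fin by (rule B_components) blast
  also have "\<dots> = (\<Sum>k\<in>?K. if k = m then form m (a m) b else 0)"
    using B_orthogonal[OF _ famD[OF assms(1)] assms(2)] by (intro sum.cong refl) (auto simp: form_def)
  also have "\<dots> = form m (a m) b" using fin by simp
  finally show ?thesis .
qed

lemma form_herm: "a \<in> lt (Suc m) \<Longrightarrow> b \<in> lt (Suc m) \<Longrightarrow> form m b a = cnj (form m a b)"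
  unfolding form_def by (intro B_herm at_deg_fam)

lemma B_eq_sum_form:
  assumes "a \<in> fam" "c \<in> fam" "finite K" "{m. a m \<notin> lt m} \<subseteq> K"
  shows "B (cosets a) (cosets c) = (\<Sum>m\<in>K. form m (a m) (c m))"
  unfolding B_components[OF assms]
proof (intro sum.cong refl)
  fix m
  have "B (cosets (at_deg m (a m))) (cosets c) = cnj (B (cosets c) (cosets (at_deg m (a m))))"
    by (rule B_herm[OF assms(2) at_deg_fam[OF famD[OF assms(1)]]])
  also have "\<dots> = cnj (form m (c m) (a m))"
    unfolding B_at_deg[OF assms(2) famD[OF assms(1)]] ..
  also have "\<dots> = form m (a m) (c m)"
    by (rule form_herm[symmetric, OF famD[OF assms(2)] famD[OF assms(1)]])
  finally show "B (cosets (at_deg m (a m))) (cosets c) = form m (a m) (c m)" .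
qed

lemma at_deg_add: "at_deg m (a + b) = (\<lambda>k. at_deg m a k + at_deg m b k)"
proof
  fix k show "at_deg m (a + b) k = at_deg m a k + at_deg m b k"
  proof (cases "k = m")
    case True
    show ?thesis unfolding True at_deg_same ..
  next
    case False
    show ?thesis unfolding at_deg_diff[OF False] add_0_left ..
  qed
qed

lemma at_deg_linmap: "linmap F \<Longrightarrow> at_deg m (F a) = (\<lambda>k. F (at_deg m a k))"
proof
  fix k assume F: "linmap F"
  show "at_deg m (F a) k = F (at_deg m a k)"
  proof (cases "k = m")
    case True
    show ?thesis unfolding True at_deg_same ..
  next
    case False
    show ?thesis unfolding at_deg_diff[OF False] linmap_0[OF F] ..
  qed
qed

text \<open>
  Positivity and the radical are inherited from positive definiteness on the quotient.
\<close>

lemma semi_inner_form: "semi_inner (lt (Suc m)) (lt m) (form m)"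
proof
  show "cfun.subspace (lt (Suc m))" "cfun.subspace (lt m)" by (rule subspace_V_lt)+
  show "lt m \<subseteq> lt (Suc m)" using lt_Suc by blast
  show "form m (u + v) w = form m u w + form m v w"
    if "u \<in> lt (Suc m)" "v \<in> lt (Suc m)" "w \<in> lt (Suc m)" for u v w
    unfolding form_def at_deg_add using that by (intro B_add at_deg_fam)
  show "form m (cscale c v) w = c * form m v w" if "v \<in> lt (Suc m)" "w \<in> lt (Suc m)" for v w c
    unfolding form_def at_deg_linmap[OF linmap_cscale] using that by (intro B_scale at_deg_fam)
  show "form m w v = cnj (form m v w)" if "v \<in> lt (Suc m)" "w \<in> lt (Suc m)" for v w
    using that by (rule form_herm)
  show "form m u w = 0" if u: "u \<in> lt m" and w: "w \<in> lt (Suc m)" for u w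
  proof -
    have "cosets (at_deg m u) = cosets (\<lambda>_. 0)"
      unfolding cosets_eq_iff diff_zero using u lt_closed(4) by (simp only: at_deg_def split: if_split) blast
    then show ?thesis unfolding form_def using B_zero[OF at_deg_fam[OF w]] by simp
  qed
  show "0 < Re (form m w w)" if "w \<in> lt (Suc m)" "w \<notin> lt m" for w
  proof -
    have "at_deg m w m \<notin> lt m" using that by (simp add: at_deg_def)
    then show ?thesis unfolding form_def using B_pos[OF at_deg_fam[OF that(1)]] by blast
  qed
qed

lemma form_act:
  assumes "x \<in> sl2" "conj_transpose x \<in> sl2" "a \<in> lt (Suc m)" "b \<in> lt (Suc m)"
  shows "form m (act x a) b = form m a (act (conj_transpose x) b)"
  unfolding form_def at_deg_linmap[OF linmap_tensor_act]
  using assms by (intro B_act at_deg_fam)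

abbreviation X :: "nat \<Rightarrow> nat \<Rightarrow> tensor set" where
  "X m l \<equiv> level_space (2 * n) z l (Suc m)"

lemma X_lt: "w \<in> X m l \<Longrightarrow> w \<in> lt (Suc m)"
  using level_space_subset by blast

text \<open>
  Different levels are different eigenspaces of the self-adjoint operator \<open>h\<close>.
\<close>

lemma form_orthogonal_levels:
  assumes "v \<in> X m l" "w \<in> X m l'" "l \<noteq> l'"
  shows "form m v w = 0"
proof -
  interpret semi_inner "lt (Suc m)" "lt m" "form m" by (rule semi_inner_form)
  have v: "v \<in> lt (Suc m)" and w: "w \<in> lt (Suc m)" using assms X_lt by auto
  have "form m (act sl2_h v) w = form m v (act sl2_h w)"
    using form_act[of sl2_h v m w] sl2_members conj_transpose_sl2 v w by simp
  then have "(2 * of_nat l - of_nat (2 * n)) * form m v w = cnj (2 * of_nat l' - of_nat (2 * n)) * form m v w"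
    unfolding level_space_h[OF assms(1)] level_space_h[OF assms(2)] form_scale[OF v w] form_scale_right[OF w v] .
  then have "(of_nat l - of_nat l') * form m v w = 0" by (simp add: algebra_simps)
  then show ?thesis using assms(3) by simp
qed

lemma sl2_form_level: "sl2_form (lt (Suc m)) (lt m) (form m) n (X m) (act sl2_e) (act sl2_f)"
proof (intro sl2_form.intro semi_inner_form sl2_form_axioms.intro)
  fix l
  obtain g where g: "\<forall>d. level_space (2 * n) z l d = cfun.span (g ` {\<mu> \<in> nsubsets (2 * n) l. \<Sum>\<mu> < d + (l choose 2)})"
    using level_space_basis[OF inj_z, of l] by blast
  show "cfun.subspace (X m l)" by (rule subspace_level_space)
  show "X m l \<subseteq> lt (Suc m)" by (rule level_space_subset)
  show "\<exists>G. finite G \<and> X m l = cfun.span G"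
    using g by (intro exI[of _ "g ` {\<mu> \<in> nsubsets (2 * n) l. \<Sum>\<mu> < Suc m + (l choose 2)}"]) simp
  show "linmap (act sl2_e)" "linmap (act sl2_f)" by (rule linmap_tensor_act)+
  fix w
  show "act sl2_e w \<in> X m (Suc l)" if "w \<in> X m l" using that by (rule level_space_e)
  show "act sl2_f w \<in> X m l" if "w \<in> X m (Suc l)" using that by (rule level_space_f)
  show "act sl2_f w = 0" if "w \<in> X m 0" using that by (rule level_space_f_0)
  show "act sl2_f (act sl2_e w) = act sl2_e (act sl2_f w) + cscale (of_real (2 * real n - 2 * real l)) w"
    if w: "w \<in> X m l"
  proof -
    have "act sl2_f (act sl2_e w) - act sl2_e (act sl2_f w) = - cscale (2 * of_nat l - of_nat (2 * n)) w"
      unfolding tensor_act_commutator sl2_brackets tensor_act_uminus mult_1 level_space_h[OF w] ..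
    also have "\<dots> = cscale (of_real (2 * real n - 2 * real l)) w"
      by (rule ext) (simp add: cscale_def algebra_simps)
    finally show ?thesis by (simp only: diff_eq_eq add.commute)
  qed
  fix v
  show "form m (act sl2_e v) w = form m v (act sl2_f w)" if "v \<in> X m l" "w \<in> X m (Suc l)"
    using form_act[of sl2_e v m w] that X_lt sl2_members conj_transpose_sl2 by auto
  fix l'
  show "form m v w = 0" if "l \<noteq> l'" "v \<in> X m l" "w \<in> X m l'" using form_orthogonal_levels that by blast
qed

text \<open>
  The properties provided by \<open>adapted_basis\<close> in degree \<open>m\<close>.  The formulas for \<open>e\<close> and \<open>f\<close> hold modulo the preceding
  step of the filtration; at the ends \<open>j = 2k\<close> and \<open>j = 0\<close> the neighbour outside the range enters with the coefficient \<open>0\<close>.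
\<close>

definition adapted :: "nat \<Rightarrow> (nat \<times> nat \<times> tableau \<Rightarrow> tensor) \<Rightarrow> bool" where
  "adapted m b \<longleftrightarrow>
    (\<forall>k j \<tau>. k \<le> n \<and> \<tau> \<in> syt2 n k \<and> maj \<tau> = m \<longrightarrow> b (k, j, \<tau>) \<in> X m (n - k + j)) \<and>
    (\<forall>p\<in>X_index n. \<forall>q\<in>X_index n. maj (snd (snd p)) = m \<and> maj (snd (snd q)) = m \<longrightarrow>
      form m (b p) (b q) = (if p = q then 1 else 0)) \<and>
    (\<forall>l w. w \<in> X m l \<and> (\<forall>k j \<tau>. (k, j, \<tau>) \<in> X_index n \<and> maj \<tau> = m \<and> n - k + j = l \<longrightarrow> form m w (b (k, j, \<tau>)) = 0)
      \<longrightarrow> w \<in> lt m) \<and>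
    (\<forall>k j \<tau>. k \<le> n \<and> \<tau> \<in> syt2 n k \<and> maj \<tau> = m \<and> j \<le> 2 * k \<longrightarrow>
      act sl2_e (b (k, j, \<tau>)) - cscale (ladder k (Suc j)) (b (k, Suc j, \<tau>)) \<in> lt m) \<and>
    (\<forall>k j \<tau>. k \<le> n \<and> \<tau> \<in> syt2 n k \<and> maj \<tau> = m \<and> j \<le> 2 * k \<longrightarrow>
      act sl2_f (b (k, j, \<tau>)) - cscale (ladder k j) (b (k, j - 1, \<tau>)) \<in> lt m)"

lemma ladder_top: "ladder k (Suc (2 * k)) = 0"
  by (simp add: ladder_def)

text \<open>
  The dimension of level \<open>l\<close> in degree \<open>m\<close> is the number of \<open>l\<close>-subsets of sum \<open>m + (l choose 2)\<close>, and
  the tableaux have the matching cardinalities by \<open>card_syt_maj\<close>.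
\<close>

lemma ex_adapted: "\<exists>b. adapted m b"
proof -
  interpret sl2_form "lt (Suc m)" "lt m" "form m" n "X m" "act sl2_e" "act sl2_f" by (rule sl2_form_level)
  define D where "D l = card {\<mu> \<in> nsubsets (2 * n) l. \<Sum>\<mu> = m + (l choose 2)}" for l
  define A where "A k = {\<tau> \<in> syt2 n k. maj \<tau> = m}" for k
  have D: "card I = D l"
    if I: "finite I" "orthonormal I b" "complete (X m l) I b" "\<And>i. i \<in> I \<Longrightarrow> b i \<in> X m l"
    for l and I :: "(nat \<times> tensor) set" and b
  proof -
    obtain g where g: "inj_on g (nsubsets (2 * n) l)" "cfun.independent (g ` nsubsets (2 * n) l)"
      "\<And>d. level_space (2 * n) z l d = cfun.span (g ` {\<mu> \<in> nsubsets (2 * n) l. \<Sum>\<mu> < d + (l choose 2)})"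
      using level_space_basis[OF inj_z, of l] by blast
    define G where "G d = g ` {\<mu> \<in> nsubsets (2 * n) l. \<Sum>\<mu> < d + (l choose 2)}" for d
    have cardG: "card (G d) = card {\<mu> \<in> nsubsets (2 * n) l. \<Sum>\<mu> < d + (l choose 2)}" for d
      unfolding G_def by (intro card_image inj_on_subset[OF g(1)]) blast
    have "card I + card (G m) = card (G (Suc m))"
    proof (rule orthonormal_complete_card[OF I(1-3) subspace_X X_subset I(4)])
      show "finite (G (Suc m))" by (simp add: G_def)
      show "cfun.independent (G (Suc m))"
        unfolding G_def by (rule cfun.independent_mono[OF g(2)]) blast
      show "X m l = cfun.span (G (Suc m))" unfolding G_def by (rule g(3))
      show "G m \<subseteq> G (Suc m)" by (auto simp: G_def)
      have "X m l \<inter> lt m = level_space (2 * n) z l m"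
      proof (intro equalityI subsetI)
        fix w assume "w \<in> X m l \<inter> lt m"
        then show "w \<in> level_space (2 * n) z l m" using level_space_inter by blast
      next
        fix w assume w: "w \<in> level_space (2 * n) z l m"
        then have "w \<in> lt m" using level_space_subset by blast
        moreover have "w \<in> X m l" using level_space_inter[OF w lt_Suc[OF \<open>w \<in> lt m\<close>]] .
        ultimately show "w \<in> X m l \<inter> lt m" by blast
      qed
      then show "X m l \<inter> lt m = cfun.span (G m)" unfolding G_def using g(3) by simp
    qed
    moreover have "{\<mu> \<in> nsubsets (2 * n) l. \<Sum>\<mu> < Suc m + (l choose 2)}
        = {\<mu> \<in> nsubsets (2 * n) l. \<Sum>\<mu> = m + (l choose 2)} \<union> {\<mu> \<in> nsubsets (2 * n) l. \<Sum>\<mu> < m + (l choose 2)}"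
      by auto
    then have "card {\<mu> \<in> nsubsets (2 * n) l. \<Sum>\<mu> < Suc m + (l choose 2)}
        = D l + card {\<mu> \<in> nsubsets (2 * n) l. \<Sum>\<mu> < m + (l choose 2)}"
      unfolding D_def by (simp only:) (subst card_Un_disjoint; auto)
    ultimately show ?thesis using cardG by simp
  qed
  have A: "finite (A k)" "card (A k) + (if k = n then 0 else D (n - k - 1)) = D (n - k)" if k: "k \<le> n" for k
  proof -
    show "finite (A k)" by (simp add: A_def)
    have "n + k + (n - k) = 2 * n" "n - k \<le> n + k" "n - k = 0 \<longleftrightarrow> k = n" using k by auto
    then show "card (A k) + (if k = n then 0 else D (n - k - 1)) = D (n - k)"
      using card_syt_maj[of "n - k" "n + k" m] by (simp only: A_def D_def)
  qed
  show ?thesis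
  proof (rule adapted_basis[of D A])
    show "card I = D l"
      if "finite I" "orthonormal I b" "complete (X m l) I b" "\<And>i. i \<in> I \<Longrightarrow> b i \<in> X m l"
      for l and I :: "(nat \<times> tensor) set" and b
      by (rule D[OF that])
    show "finite (A k)" if "k \<le> n" for k using that by (rule A(1))
    show "card (A k) + (if k = n then 0 else D (n - k - 1)) = D (n - k)" if "k \<le> n" for k
      using that by (rule A(2))
  next
    fix b :: "nat \<times> nat \<times> tableau \<Rightarrow> tensor"
    assume b:
    "\<And>k j \<tau>. k \<le> n \<Longrightarrow> \<tau> \<in> A k \<Longrightarrow> b (k, j, \<tau>) \<in> X m (n - k + j)"
    "\<And>k j \<tau> k' j' \<tau>'. k \<le> n \<Longrightarrow> j \<le> 2 * k \<Longrightarrow> \<tau> \<in> A k \<Longrightarrow> k' \<le> n \<Longrightarrow> j' \<le> 2 * k' \<Longrightarrow> \<tau>' \<in> A k' \<Longrightarrow>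
      form m (b (k, j, \<tau>)) (b (k', j', \<tau>')) = (if (k, j, \<tau>) = (k', j', \<tau>') then 1 else 0)"
    "\<And>w l. w \<in> X m l \<Longrightarrow> (\<And>k j \<tau>. k \<le> n \<Longrightarrow> j \<le> 2 * k \<Longrightarrow> n - k + j = l \<Longrightarrow> \<tau> \<in> A k \<Longrightarrow> form m w (b (k, j, \<tau>)) = 0)
      \<Longrightarrow> w \<in> lt m"
    "\<And>k j \<tau>. k \<le> n \<Longrightarrow> j < 2 * k \<Longrightarrow> \<tau> \<in> A k \<Longrightarrow> act sl2_e (b (k, j, \<tau>)) = cscale (ladder k (Suc j)) (b (k, Suc j, \<tau>))"
    "\<And>k \<tau>. k \<le> n \<Longrightarrow> \<tau> \<in> A k \<Longrightarrow> act sl2_e (b (k, 2 * k, \<tau>)) \<in> lt m"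
    "\<And>k \<tau>. k \<le> n \<Longrightarrow> \<tau> \<in> A k \<Longrightarrow> act sl2_f (b (k, 0, \<tau>)) \<in> lt m"
    "\<And>k j \<tau>. k \<le> n \<Longrightarrow> j < 2 * k \<Longrightarrow> \<tau> \<in> A k \<Longrightarrow>
      act sl2_f (b (k, Suc j, \<tau>)) - cscale (ladder k (Suc j)) (b (k, j, \<tau>)) \<in> lt m"
    have "adapted m b"
      unfolding adapted_def
    proof (intro conjI allI ballI impI)
      fix k j \<tau> assume h: "k \<le> n \<and> \<tau> \<in> syt2 n k \<and> maj \<tau> = m"
      then show "b (k, j, \<tau>) \<in> X m (n - k + j)" by (intro b(1)) (auto simp: A_def)
    next
      fix p q assume h: "p \<in> X_index n" "q \<in> X_index n" "maj (snd (snd p)) = m \<and> maj (snd (snd q)) = m"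
      obtain k j \<tau> k' j' \<tau>' where pq: "p = (k, j, \<tau>)" "q = (k', j', \<tau>')" by (cases p; cases q)
      show "form m (b p) (b q) = (if p = q then 1 else 0)"
        unfolding pq using h by (intro b(2)) (auto simp: pq X_index_def A_def)
    next
      fix l w assume h: "w \<in> X m l \<and> (\<forall>k j \<tau>. (k, j, \<tau>) \<in> X_index n \<and> maj \<tau> = m \<and> n - k + j = l \<longrightarrow> form m w (b (k, j, \<tau>)) = 0)"
      show "w \<in> lt m"
      proof (rule b(3)[of w l])
        show "w \<in> X m l" using h by blast
        fix k j \<tau> assume "k \<le> n" "j \<le> 2 * k" "n - k + j = l" "\<tau> \<in> A k"
        then show "form m w (b (k, j, \<tau>)) = 0" using h by (auto simp: X_index_def A_def)
      qed
    next
      fix k j \<tau> assume h: "k \<le> n \<and> \<tau> \<in> syt2 n k \<and> maj \<tau> = m \<and> j \<le> 2 * k"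
      then have \<tau>: "k \<le> n" "\<tau> \<in> A k" by (auto simp: A_def)
      show "act sl2_e (b (k, j, \<tau>)) - cscale (ladder k (Suc j)) (b (k, Suc j, \<tau>)) \<in> lt m"
      proof (cases "j = 2 * k")
        case True
        show ?thesis using b(5)[OF \<tau>] unfolding True ladder_top cfun.scale_zero_left diff_zero .
      next
        case False
        then have "j < 2 * k" using h by simp
        then show ?thesis unfolding b(4)[OF \<tau>(1) \<open>j < 2 * k\<close> \<tau>(2)] diff_self by (intro lt_closed(4))
      qed
      show "act sl2_f (b (k, j, \<tau>)) - cscale (ladder k j) (b (k, j - 1, \<tau>)) \<in> lt m"
      proof (cases j)
        case 0
        show ?thesis using b(6)[OF \<tau>] unfolding 0 ladder_0 cfun.scale_zero_left diff_zero .
      next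
        case (Suc i)
        then have "i < 2 * k" using h by simp
        show ?thesis using b(7)[OF \<tau>(1) \<open>i < 2 * k\<close> \<tau>(2)] unfolding Suc diff_Suc_1 .
      qed
    qed
    then show "\<exists>b. adapted m b" by blast
  qed
qed

end


section \<open>Multiplicity spaces under isomorphisms\<close>

lemma rep_hom_comp:
  assumes "rep_hom V W S" "rep_hom W Z T"
  shows "rep_hom V Z (T \<circ> S)"
  using assms unfolding rep_hom_def by (auto simp: Pi_iff)

lemma unitary_iso_comp:
  assumes "unitary_iso V W S" "unitary_iso W Z T"
  shows "unitary_iso V Z (T \<circ> S)"
proof -
  have S: "S v \<in> carr W" if "v \<in> carr V" for v
    using assms(1) that by (auto simp: unitary_iso_def bij_betw_def)
  have "rep_hom V Z (T \<circ> S)"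
    using assms by (intro rep_hom_comp) (auto simp: unitary_iso_def)
  moreover have "bij_betw (T \<circ> S) (carr V) (carr Z)"
    using assms by (intro bij_betw_trans) (auto simp: unitary_iso_def)
  moreover have "ip Z ((T \<circ> S) v) ((T \<circ> S) w) = ip V v w" if "v \<in> carr V" "w \<in> carr V" for v w
  proof -
    have "ip Z (T (S v)) (T (S w)) = ip W (S v) (S w)"
      using assms(2) S that by (simp add: unitary_iso_def)
    also have "\<dots> = ip V v w" using assms(1) that by (simp add: unitary_iso_def)
    finally show ?thesis by simp
  qed
  ultimately show ?thesis by (simp add: unitary_iso_def)
qed

definition rep_closed :: "('v, 'p) sl2_rep_scheme \<Rightarrow> bool" where
  "rep_closed V \<longleftrightarrow>
     (\<forall>v\<in>carr V. \<forall>w\<in>carr V. vadd V v w \<in> carr V) \<and>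
     (\<forall>c. \<forall>v\<in>carr V. vscale V c v \<in> carr V) \<and>
     (\<forall>x\<in>sl2. \<forall>v\<in>carr V. vact V x v \<in> carr V)"

lemma rep_closed_irrep: "rep_closed (irrep d)"
  by (auto simp: rep_closed_def irrep_def irrep_act_def cscale_def)

text \<open>
  Closure of the carrier under the operations is needed, for the inverse is only defined on images of carrier elements.
\<close>

lemma rep_hom_inverse:
  assumes "rep_hom V W T" "bij_betw T (carr V) (carr W)" "rep_closed V"
  shows "rep_hom W V (inv_into (carr V) T)"
proof -
  let ?S = "inv_into (carr V) T"
  have S: "?S w \<in> carr V" "T (?S w) = w" if "w \<in> carr W" for w
    using that assms(2) by (auto simp: bij_betw_def inv_into_into f_inv_into_f)
  have eq: "?S w = v" if "v \<in> carr V" "T v = w" for v w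
    using that assms(2) by (auto simp: bij_betw_def)
  show ?thesis
    unfolding rep_hom_def
  proof (intro conjI ballI allI)
    show "?S \<in> carr W \<rightarrow> carr V" using S by blast
  next
    fix v w assume "v \<in> carr W" "w \<in> carr W"
    then show "?S (vadd W v w) = vadd V (?S v) (?S w)"
      using assms(1,3) S by (intro eq) (auto simp: rep_closed_def rep_hom_def)
  next
    fix c v assume "v \<in> carr W"
    then show "?S (vscale W c v) = vscale V c (?S v)"
      using assms(1,3) S by (intro eq) (auto simp: rep_closed_def rep_hom_def)
  next
    fix x v assume "x \<in> sl2" "v \<in> carr W"
    then show "?S (vact W x v) = vact V x (?S v)"
      using assms(1,3) S by (intro eq) (auto simp: rep_closed_def rep_hom_def)
  qed
qed

lemma rep_hom_restrict:
  assumes "rep_hom V W T" "rep_closed V"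
  shows "rep_hom V W (restrict T (carr V))"
  using assms unfolding rep_hom_def rep_closed_def by (auto simp: Pi_iff)

lemma compose_mult_space:
  assumes "rep_hom V W T" "\<phi> \<in> mult_space V d"
  shows "compose (carr (irrep d)) T \<phi> \<in> mult_space W d"
proof -
  have "rep_hom (irrep d) W (T \<circ> \<phi>)"
    using assms by (intro rep_hom_comp[of _ V]) (auto simp: mult_space_def)
  then have "rep_hom (irrep d) W (restrict (T \<circ> \<phi>) (carr (irrep d)))"
    using rep_closed_irrep by (rule rep_hom_restrict)
  then show ?thesis by (simp add: mult_space_def compose_def comp_def)
qed

lemma compose_mult_space_eq:
  assumes "rep_hom V W T" "bij_betw T (carr V) (carr W)" "rep_closed V"
  shows "compose (carr (irrep d)) T ` mult_space V d = mult_space W d"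
proof (intro equalityI subsetI)
  fix \<psi> assume \<psi>: "\<psi> \<in> mult_space W d"
  let ?S = "inv_into (carr V) T"
  have "compose (carr (irrep d)) ?S \<psi> \<in> mult_space V d"
    using rep_hom_inverse[OF assms] \<psi> by (rule compose_mult_space)
  moreover have "compose (carr (irrep d)) T (compose (carr (irrep d)) ?S \<psi>) = \<psi>"
  proof (rule extensionalityI)
    show "\<psi> \<in> extensional (carr (irrep d))" using \<psi> by (simp add: mult_space_def)
    fix u assume u: "u \<in> carr (irrep d)"
    then have "\<psi> u \<in> carr W" using \<psi> by (auto simp: mult_space_def rep_hom_def)
    then show "compose (carr (irrep d)) T (compose (carr (irrep d)) ?S \<psi>) u = \<psi> u"
      using u assms(2) by (auto simp: compose_def bij_betw_def f_inv_into_f)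
  qed (rule compose_extensional)
  ultimately show "\<psi> \<in> compose (carr (irrep d)) T ` mult_space V d" by (metis imageI)
qed (use compose_mult_space[OF assms(1)] in blast)

lemma compose_mult_space_deg_eq:
  assumes "rep_hom V W T" "bij_betw T (carr V) (carr W)" "rep_closed V"
    and "T ` deg V i = deg W i" "deg V i \<subseteq> carr V"
  shows "compose (carr (irrep d)) T ` mult_space_deg V d i = mult_space_deg W d i"
proof -
  have mem: "T v \<in> deg W i \<longleftrightarrow> v \<in> deg V i" if "v \<in> carr V" for v
  proof
    assume "T v \<in> deg W i"
    then obtain v' where "v' \<in> deg V i" "T v = T v'" using assms(4) by blast
    then show "v \<in> deg V i" using that assms(2,5) by (auto simp: bij_betw_def inj_on_def)
  qed (use assms(4) in blast)
  have deg: "compose (carr (irrep d)) T \<phi> \<in> mult_space_deg W d i \<longleftrightarrow> \<phi> \<in> mult_space_deg V d i"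
    if "\<phi> \<in> mult_space V d" for \<phi>
  proof -
    have "\<phi> u \<in> carr V" if "u \<in> carr (irrep d)" for u
      using \<open>\<phi> \<in> mult_space V d\<close> that by (auto simp: mult_space_def rep_hom_def)
    then show ?thesis
      using that compose_mult_space[OF assms(1) that] mem
      by (auto simp: mult_space_deg_def compose_eq)
  qed
  have "mult_space_deg W d i \<subseteq> compose (carr (irrep d)) T ` mult_space V d"
    unfolding compose_mult_space_eq[OF assms(1-3)] by (auto simp: mult_space_deg_def)
  moreover have "mult_space_deg V d i \<subseteq> mult_space V d" by (auto simp: mult_space_deg_def)
  ultimately show ?thesis using deg by blast
qed

section \<open>Schur's lemma in the direct sum of irreducibles\<close>

lemma X_space_simps:
  "carr (X_space n) = {g. \<forall>p. p \<notin> X_index n \<longrightarrow> g p = 0}"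
  "vadd (X_space n) = (+)" "vzero (X_space n) = 0" "vscale (X_space n) = cscale"
  "vact (X_space n) x g (k, j, \<tau>) = irrep_act (2 * k + 1) x (\<lambda>j'. g (k, j', \<tau>)) j"
  "ip (X_space n) g h = (\<Sum>p\<in>X_index n. g p * cnj (h p))"
  by (simp_all add: X_space_def)

lemma irrep_simps:
  "carr (irrep d) = {u. \<forall>j\<ge>d. u j = 0}" "vadd (irrep d) = (+)" "vscale (irrep d) = cscale"
  "vact (irrep d) = irrep_act d"
  by (simp_all add: irrep_def)

lemma finite_X_index [simp]: "finite (X_index n)"
proof (rule finite_subset)
  show "X_index n \<subseteq> {..n} \<times> {..2 * n} \<times> (\<Union>k\<in>{..n}. syt2 n k)"
    by (auto simp: X_index_def)
  show "finite ({..n} \<times> {..2 * n} \<times> (\<Union>k\<in>{..n}. syt2 n k))" by simp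
qed

text \<open>
  In coordinates, the homogeneous part is the set of vectors supported at the tableaux of the given
  major index.
\<close>

lemma X_deg_eq:
  "deg (X_space n) m = {g. \<forall>k j \<tau>. g (k, j, \<tau>) \<noteq> 0 \<longrightarrow> (k, j, \<tau>) \<in> X_index n \<and> maj \<tau> = m}"
proof -
  let ?G = "{pure k u (tab \<tau>) | k u \<tau>. k \<le> n \<and> u \<in> carr (irrep (2 * k + 1)) \<and> \<tau> \<in> syt2 n k \<and> maj \<tau> = m}"
  let ?R = "{g :: xvec. \<forall>k j \<tau>. g (k, j, \<tau>) \<noteq> 0 \<longrightarrow> (k, j, \<tau>) \<in> X_index n \<and> maj \<tau> = m}"
  have "cfun.span ?G \<subseteq> ?R"
  proof (rule cfun.span_minimal)
    show "?G \<subseteq> ?R"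
      by (force simp: pure_def tab_def X_index_def irrep_simps not_le split: if_splits)
    show "cfun.subspace ?R"
      unfolding cfun.subspace_def by (auto simp: cscale_def) (metis add.right_neutral)+
  qed
  moreover have "?R \<subseteq> cfun.span ?G"
  proof
    fix g assume g: "g \<in> ?R"
    have "g = (\<Sum>p\<in>X_index n. cscale (g p) (delta p))"
    proof
      fix p
      have "(\<Sum>q\<in>X_index n. cscale (g q) (delta q)) p = (\<Sum>q\<in>X_index n. if q = p then g p else 0)"
        unfolding sum_fun_apply by (intro sum.cong refl) (auto simp: cscale_def delta_def)
      also have "\<dots> = g p" using g by (cases p) auto
      finally show "g p = (\<Sum>p\<in>X_index n. cscale (g p) (delta p)) p" by simp
    qed
    also have "\<dots> \<in> cfun.span ?G"
    proof (rule cfun.span_sum)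
      fix p assume p: "p \<in> X_index n"
      obtain k j \<tau> where kj: "p = (k, j, \<tau>)" by (cases p)
      show "cscale (g p) (delta p) \<in> cfun.span ?G"
      proof (cases "g p = 0")
        case True
        show ?thesis unfolding True cfun.scale_zero_left by (rule cfun.span_zero)
      next
        case False
        have "maj \<tau> = m" using g False kj by auto
        moreover have "k \<le> n" "j < 2 * k + 1" "\<tau> \<in> syt2 n k" using p kj by (auto simp: X_index_def)
        moreover have "delta p = pure k (delta j) (tab \<tau>)"
          by (auto simp: kj pure_def delta_def tab_def)
        moreover have "delta j \<in> carr (irrep (2 * k + 1))"
          using \<open>j < 2 * k + 1\<close> by (auto simp: irrep_simps delta_def)
        ultimately have "delta p \<in> ?G" by blast
        then show ?thesis by (intro cfun.span_scale cfun.span_base)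
      qed
    qed
    finally show "g \<in> cfun.span ?G" .
  qed
  ultimately show ?thesis by (simp add: X_space_def)
qed

lemma span_tab:
  assumes "finite A"
  shows "cfun.span (tab ` A) = {w. \<forall>\<tau>. \<tau> \<notin> A \<longrightarrow> w \<tau> = 0}"
proof (intro equalityI subsetI)
  fix w assume "w \<in> cfun.span (tab ` A)"
  moreover have "cfun.span (tab ` A) \<subseteq> {w. \<forall>\<tau>. \<tau> \<notin> A \<longrightarrow> w \<tau> = 0}"
    by (rule cfun.span_minimal) (auto simp: tab_def cfun.subspace_def cscale_def)
  ultimately show "w \<in> {w. \<forall>\<tau>. \<tau> \<notin> A \<longrightarrow> w \<tau> = 0}" by blast
next
  fix w :: "tableau \<Rightarrow> complex" assume w: "w \<in> {w. \<forall>\<tau>. \<tau> \<notin> A \<longrightarrow> w \<tau> = 0}"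
  have "w = (\<Sum>\<tau>\<in>A. cscale (w \<tau>) (tab \<tau>))"
  proof
    fix \<sigma>
    have "(\<Sum>\<tau>\<in>A. cscale (w \<tau>) (tab \<tau>)) \<sigma> = (\<Sum>\<tau>\<in>A. if \<tau> = \<sigma> then w \<sigma> else 0)"
      unfolding sum_fun_apply by (intro sum.cong refl) (auto simp: cscale_def tab_def)
    also have "\<dots> = w \<sigma>" using w assms by auto
    finally show "w \<sigma> = (\<Sum>\<tau>\<in>A. cscale (w \<tau>) (tab \<tau>)) \<sigma>" by simp
  qed
  also have "\<dots> \<in> cfun.span (tab ` A)" by (intro cfun.span_sum cfun.span_scale cfun.span_base) auto
  finally show "w \<in> cfun.span (tab ` A)" .
qed

lemma irrep_act_ladder:
  assumes "j < 2 * k + 1"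
  shows "irrep_act (2 * k + 1) x u j = x $ 1 $ 1 * of_real (2 * real j - 2 * real k) * u j
     + x $ 1 $ 2 * ladder k j * u (j - 1) + x $ 2 $ 1 * ladder k (Suc j) * u (Suc j)"
proof -
  have "(real j + 1) * (real (2 * k + 1) - 1 - real j) = real (Suc j) * (real (2 * k + 1) - real (Suc j))"
    by simp
  then show ?thesis using assms by (simp add: irrep_act_def ladder_def)
qed

lemma vact_pure: "vact (X_space n) x (pure k u w) = pure k (irrep_act (2 * k + 1) x u) w"
proof
  fix p :: "nat \<times> nat \<times> tableau"
  obtain k' j \<tau> where p: "p = (k', j, \<tau>)" by (cases p)
  show "vact (X_space n) x (pure k u w) p = pure k (irrep_act (2 * k + 1) x u) w p"
    by (auto simp: p X_space_simps pure_def irrep_act_def algebra_simps)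
qed

lemma pure_rep_hom:
  assumes "k \<le> n" "\<And>\<tau>. \<tau> \<notin> syt2 n k \<Longrightarrow> w \<tau> = 0"
  shows "rep_hom (irrep (2 * k + 1)) (X_space n) (\<lambda>u. pure k u w)"
  unfolding rep_hom_def
proof (intro conjI ballI allI)
  show "(\<lambda>u. pure k u w) \<in> carr (irrep (2 * k + 1)) \<rightarrow> carr (X_space n)"
  proof
    fix u assume u: "u \<in> carr (irrep (2 * k + 1))"
    have "pure k u w (k', j, \<tau>) = 0" if "(k', j, \<tau>) \<notin> X_index n" for k' j \<tau>
    proof -
      have "k' \<noteq> k \<or> 2 * k + 1 \<le> j \<or> \<tau> \<notin> syt2 n k"
        using that assms(1) by (auto simp: X_index_def)
      then show ?thesis using u assms(2) by (auto simp: pure_def irrep_simps)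
    qed
    then show "pure k u w \<in> carr (X_space n)" by (auto simp: X_space_simps)
  qed
  fix u v
  show "pure k (vadd (irrep (2 * k + 1)) u v) w = vadd (X_space n) (pure k u w) (pure k v w)"
    by (auto simp: X_space_simps irrep_simps pure_def algebra_simps)
  fix c
  show "pure k (vscale (irrep (2 * k + 1)) c u) w = vscale (X_space n) c (pure k u w)"
    by (auto simp: X_space_simps irrep_simps pure_def cscale_def)
  fix x
  show "pure k (vact (irrep (2 * k + 1)) x u) w = vact (X_space n) x (pure k u w)"
    by (simp only: vact_pure irrep_simps)
qed

lemma irrep_act_delta:
  "j < 2 * k \<Longrightarrow> irrep_act (2 * k + 1) sl2_e (delta j) = cscale (ladder k (Suc j)) (delta (Suc j))"
  "irrep_act (2 * k + 1) sl2_f (delta 0) = (\<lambda>_. 0)"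
  "irrep_act (2 * k + 1) sl2_h (delta 0) = cscale (of_real (- 2 * real k)) (delta 0)"
proof -
  assume j: "j < 2 * k"
  show "irrep_act (2 * k + 1) sl2_e (delta j) = cscale (ladder k (Suc j)) (delta (Suc j))"
  proof
    fix i
    show "irrep_act (2 * k + 1) sl2_e (delta j) i = cscale (ladder k (Suc j)) (delta (Suc j)) i"
    proof (cases "i < 2 * k + 1")
      case True
      then show ?thesis unfolding irrep_act_ladder[OF True]
        by (cases i) (auto simp: delta_def cscale_def)
    next
      case False
      then show ?thesis using j by (auto simp: irrep_act_def delta_def cscale_def)
    qed
  qed
next
  show "irrep_act (2 * k + 1) sl2_f (delta 0) = (\<lambda>_. 0)"
    by (auto simp: irrep_act_def delta_def)
  show "irrep_act (2 * k + 1) sl2_h (delta 0) = cscale (of_real (- 2 * real k)) (delta 0)"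
    by (auto simp: irrep_act_def delta_def cscale_def)
qed

text \<open>
  The image of the lowest weight vector is killed by \<open>f\<close> and has weight \<open>-2k\<close>, so it has coordinates only at the lowest
  vectors of the summand number \<open>k\<close>.  It determines the homomorphism, since \<open>e\<close> generates \<open>M_(2k+1)\<close> from
  its lowest weight vector.
\<close>

lemma schur_X_space:
  assumes "k \<le> n" "rep_hom (irrep (2 * k + 1)) (X_space n) \<psi>"
  shows "\<exists>w. (\<forall>\<tau>. \<tau> \<notin> syt2 n k \<longrightarrow> w \<tau> = 0) \<and> (\<forall>u\<in>carr (irrep (2 * k + 1)). \<psi> u = pure k u w)"
proof -
  let ?I = "irrep (2 * k + 1)"
  have d: "delta j \<in> carr ?I" if "j \<le> 2 * k" for j
    using that by (auto simp: irrep_simps delta_def)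
  have \<psi>X: "\<psi> u \<in> carr (X_space n)" if "u \<in> carr ?I" for u
    using assms(2) that by (auto simp: rep_hom_def)
  have \<psi>add: "\<psi> (u + v) = \<psi> u + \<psi> v" if "u \<in> carr ?I" "v \<in> carr ?I" for u v
    using assms(2) that by (auto simp: rep_hom_def X_space_simps irrep_simps)
  have \<psi>scale: "\<psi> (cscale c u) = cscale c (\<psi> u)" if "u \<in> carr ?I" for u c
    using assms(2) that by (auto simp: rep_hom_def X_space_simps irrep_simps)
  have \<psi>act: "\<psi> (irrep_act (2 * k + 1) x u) = vact (X_space n) x (\<psi> u)" if "u \<in> carr ?I" "x \<in> sl2" for u x
    using assms(2) that by (auto simp: rep_hom_def irrep_simps)
  have zero: "(\<lambda>_. 0) = cscale 0 (delta 0 :: nat \<Rightarrow> complex)" by (auto simp: cscale_def)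
  define g where "g = \<psi> (delta 0)"
  define w where "w \<tau> = g (k, 0, \<tau>)" for \<tau>
  have fg: "vact (X_space n) sl2_f g = (\<lambda>_. 0)"
  proof -
    have "vact (X_space n) sl2_f g = \<psi> (irrep_act (2 * k + 1) sl2_f (delta 0))"
      unfolding g_def by (rule \<psi>act[OF d sl2_members(2), symmetric]) simp
    also have "\<dots> = \<psi> (cscale 0 (delta 0))" by (simp only: irrep_act_delta(2) zero)
    also have "\<dots> = cscale 0 (\<psi> (delta 0))" by (rule \<psi>scale[OF d]) simp
    finally show ?thesis by (simp only: cscale_def mult_zero_left)
  qed
  have hg: "vact (X_space n) sl2_h g = cscale (of_real (- 2 * real k)) g"
  proof -
    have "vact (X_space n) sl2_h g = \<psi> (irrep_act (2 * k + 1) sl2_h (delta 0))"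
      unfolding g_def by (rule \<psi>act[OF d sl2_members(3), symmetric]) simp
    also have "\<dots> = \<psi> (cscale (of_real (- 2 * real k)) (delta 0))" by (simp only: irrep_act_delta(3))
    also have "\<dots> = cscale (of_real (- 2 * real k)) g" unfolding g_def by (rule \<psi>scale[OF d]) simp
    finally show ?thesis .
  qed
  have gX: "g \<in> carr (X_space n)" unfolding g_def by (rule \<psi>X[OF d]) simp
  have supp: "g p = 0" if "p \<notin> X_index n" for p
    using gX that unfolding X_space_simps by blast
  have g0: "g (k', j, \<tau>) = 0" if "k' \<noteq> k \<or> j \<noteq> 0" for k' j \<tau>
  proof (cases "(k', j, \<tau>) \<in> X_index n")
    case True
    then have j: "j < 2 * k' + 1" by (auto simp: X_index_def)
    show ?thesis
    proof (cases j)
      case 0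
      have "irrep_act (2 * k' + 1) sl2_h (\<lambda>j'. g (k', j', \<tau>)) 0 = of_real (- 2 * real k) * g (k', 0, \<tau>)"
        using fun_cong[OF hg, of "(k', 0, \<tau>)"] by (simp only: X_space_simps cscale_def)
      moreover have "irrep_act (2 * k' + 1) sl2_h (\<lambda>j'. g (k', j', \<tau>)) 0 = of_real (- 2 * real k') * g (k', 0, \<tau>)"
        using irrep_act_ladder[of 0 k' sl2_h "\<lambda>j'. g (k', j', \<tau>)"] by simp
      ultimately have "of_real (- 2 * real k') * g (k', 0, \<tau>) = of_real (- 2 * real k) * g (k', 0, \<tau>)"
        by (simp only:)
      then have "(of_nat k' - of_nat k) * g (k', 0, \<tau>) = 0"
        by (auto simp: algebra_simps)
      then show ?thesis using that 0 by simp
    next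
      case (Suc i)
      have "irrep_act (2 * k' + 1) sl2_f (\<lambda>j'. g (k', j', \<tau>)) i = 0"
        using fun_cong[OF fg, of "(k', i, \<tau>)"] by (simp only: X_space_simps)
      moreover have "i < 2 * k' + 1" "ladder k' (Suc i) \<noteq> 0"
        using j Suc by (simp, intro ladder_nonzero) simp_all
      ultimately show ?thesis
        using irrep_act_ladder[of i k' sl2_f "\<lambda>j'. g (k', j', \<tau>)"] by (simp add: Suc)
    qed
  qed (rule supp)
  have g: "g = pure k (delta 0) w"
  proof
    fix p :: "nat \<times> nat \<times> tableau"
    obtain k' j \<tau> where p: "p = (k', j, \<tau>)" by (cases p)
    show "g p = pure k (delta 0) w p"
      using g0[of k' j \<tau>] by (cases "k' = k \<and> j = 0") (auto simp: p pure_def delta_def w_def)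
  qed
  have basis: "\<psi> (delta j) = pure k (delta j) w" if "j \<le> 2 * k" for j
    using that
  proof (induction j)
    case 0
    then show ?case using g by (simp add: g_def)
  next
    case (Suc j)
    let ?c = "ladder k (Suc j)"
    have nz: "?c \<noteq> 0" using Suc.prems by (intro ladder_nonzero) auto
    have "cscale ?c (\<psi> (delta (Suc j))) = \<psi> (irrep_act (2 * k + 1) sl2_e (delta j))"
      using Suc.prems by (simp only: irrep_act_delta(1) \<psi>scale[OF d] Suc_le_eq)
    also have "\<dots> = vact (X_space n) sl2_e (pure k (delta j) w)"
      using Suc \<psi>act[OF d sl2_members(1), of j] by simp
    also have "\<dots> = pure k (cscale ?c (delta (Suc j))) w"
      using Suc.prems unfolding vact_pure by (simp only: irrep_act_delta(1) Suc_le_eq)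
    also have "\<dots> = cscale ?c (pure k (delta (Suc j)) w)"
      by (auto simp: pure_def cscale_def)
    finally show ?case using nz by (rule cfun.scale_left_imp_eq[rotated])
  qed
  have "\<psi> u = pure k u w" if u: "u \<in> carr ?I" for u
  proof -
    \<comment> \<open>truncations of \<open>u\<close>, to proceed along the weight basis by additivity\<close>
    define t where "t m = (\<lambda>j. if j < m then u j else 0)" for m :: nat
    have tI: "t m \<in> carr ?I" for m using u by (auto simp: t_def irrep_simps)
    have "\<psi> (t m) = pure k (t m) w" if "m \<le> 2 * k + 1" for m
      using that
    proof (induction m)
      case 0
      have t0: "t 0 = cscale 0 (delta 0)" by (auto simp: t_def cscale_def)
      have "\<psi> (t 0) = cscale 0 (\<psi> (delta 0))" unfolding t0 by (rule \<psi>scale[OF d]) simp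
      also have "\<dots> = pure k (t 0) w" by (auto simp: pure_def t_def cscale_def)
      finally show ?case .
    next
      case (Suc m)
      have dm: "delta m \<in> carr ?I" using Suc.prems by (intro d) simp
      have sm: "cscale (u m) (delta m) \<in> carr ?I"
        using dm by (auto simp: irrep_simps cscale_def)
      have t: "t (Suc m) = t m + cscale (u m) (delta m)"
        by (rule ext) (auto simp: t_def cscale_def delta_def less_Suc_eq)
      have "\<psi> (t (Suc m)) = pure k (t m) w + cscale (u m) (pure k (delta m) w)"
        unfolding t \<psi>add[OF tI sm] \<psi>scale[OF dm] using Suc basis[of m] by simp
      also have "\<dots> = pure k (t (Suc m)) w"
        unfolding t by (rule ext) (auto simp: pure_def cscale_def algebra_simps)
      finally show ?case .
    qed
    moreover have "t (2 * k + 1) = u" using u by (auto simp: t_def irrep_simps)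
    ultimately show ?thesis by (metis order_refl)
  qed
  moreover have "w \<tau> = 0" if "\<tau> \<notin> syt2 n k" for \<tau>
    unfolding w_def using that by (intro supp) (auto simp: X_index_def)
  ultimately show ?thesis by blast
qed

lemma mult_space_X_space:
  assumes "k \<le> n"
  shows "mult_space (X_space n) (2 * k + 1)
    = (\<lambda>w. \<lambda>u\<in>carr (irrep (2 * k + 1)). pure k u w) ` cfun.span (tab ` syt2 n k)"
proof (intro equalityI subsetI)
  fix \<psi> assume \<psi>: "\<psi> \<in> mult_space (X_space n) (2 * k + 1)"
  then obtain w where w: "\<forall>\<tau>. \<tau> \<notin> syt2 n k \<longrightarrow> w \<tau> = 0" "\<forall>u\<in>carr (irrep (2 * k + 1)). \<psi> u = pure k u w"
    using schur_X_space[OF assms, of \<psi>] by (auto simp: mult_space_def)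
  have "w \<in> cfun.span (tab ` syt2 n k)" using w(1) by (simp add: span_tab)
  moreover have "\<psi> = (\<lambda>u\<in>carr (irrep (2 * k + 1)). pure k u w)"
  proof (rule extensionalityI)
    show "\<psi> \<in> extensional (carr (irrep (2 * k + 1)))" using \<psi> by (simp add: mult_space_def)
  qed (use w(2) in auto)
  ultimately show "\<psi> \<in> (\<lambda>w. \<lambda>u\<in>carr (irrep (2 * k + 1)). pure k u w) ` cfun.span (tab ` syt2 n k)"
    by blast
next
  fix \<psi> assume "\<psi> \<in> (\<lambda>w. \<lambda>u\<in>carr (irrep (2 * k + 1)). pure k u w) ` cfun.span (tab ` syt2 n k)"
  then obtain w where w: "\<psi> = (\<lambda>u\<in>carr (irrep (2 * k + 1)). pure k u w)" "w \<in> cfun.span (tab ` syt2 n k)"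
    by blast
  have "rep_hom (irrep (2 * k + 1)) (X_space n) (\<lambda>u. pure k u w)"
    using assms w(2) by (intro pure_rep_hom) (simp_all add: span_tab)
  then show "\<psi> \<in> mult_space (X_space n) (2 * k + 1)"
    unfolding w(1) mult_space_def using rep_hom_restrict[OF _ rep_closed_irrep] by blast
qed

lemma mult_space_deg_X_space:
  assumes "k \<le> n"
  shows "mult_space_deg (X_space n) (2 * k + 1) i
    = (\<lambda>w. \<lambda>u\<in>carr (irrep (2 * k + 1)). pure k u w) ` cfun.span (tab ` {\<tau> \<in> syt2 n k. maj \<tau> = i})"
proof -
  let ?R = "\<lambda>w. \<lambda>u\<in>carr (irrep (2 * k + 1)). pure k u w"
  have deg: "?R w \<in> mult_space_deg (X_space n) (2 * k + 1) i \<longleftrightarrow> w \<in> cfun.span (tab ` {\<tau> \<in> syt2 n k. maj \<tau> = i})"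
    if w: "w \<in> cfun.span (tab ` syt2 n k)" for w
  proof -
    have ws: "w \<tau> = 0" if "\<tau> \<notin> syt2 n k" for \<tau> using w that by (simp add: span_tab)
    have "?R w \<in> mult_space (X_space n) (2 * k + 1)" unfolding mult_space_X_space[OF assms] using w by blast
    then have "?R w \<in> mult_space_deg (X_space n) (2 * k + 1) i \<longleftrightarrow>
        (\<forall>u\<in>carr (irrep (2 * k + 1)). pure k u w \<in> deg (X_space n) i)"
      by (simp add: mult_space_deg_def)
    also have "\<dots> \<longleftrightarrow> (\<forall>\<tau>. w \<tau> \<noteq> 0 \<longrightarrow> maj \<tau> = i)"
    proof
      assume l: "\<forall>u\<in>carr (irrep (2 * k + 1)). pure k u w \<in> deg (X_space n) i"
      have "delta 0 \<in> carr (irrep (2 * k + 1))" by (auto simp: irrep_simps delta_def)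
      then have "pure k (delta 0) w \<in> deg (X_space n) i" using l by blast
      moreover have "pure k (delta 0) w (k, 0, \<tau>) = w \<tau>" for \<tau> by (simp add: pure_def delta_def)
      ultimately show "\<forall>\<tau>. w \<tau> \<noteq> 0 \<longrightarrow> maj \<tau> = i" unfolding X_deg_eq by (metis (mono_tags, lifting) mem_Collect_eq)
    next
      assume r: "\<forall>\<tau>. w \<tau> \<noteq> 0 \<longrightarrow> maj \<tau> = i"
      show "\<forall>u\<in>carr (irrep (2 * k + 1)). pure k u w \<in> deg (X_space n) i"
        unfolding X_deg_eq
      proof (intro ballI CollectI allI impI)
        fix u k' j \<tau> assume u: "u \<in> carr (irrep (2 * k + 1))" and nz: "pure k u w (k', j, \<tau>) \<noteq> 0"
        then have "k' = k" "u j \<noteq> 0" "w \<tau> \<noteq> 0" by (auto simp: pure_def split: if_splits)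
        moreover have "j < 2 * k + 1" using u \<open>u j \<noteq> 0\<close> by (force simp: irrep_simps not_le[symmetric])
        ultimately show "(k', j, \<tau>) \<in> X_index n \<and> maj \<tau> = i"
          using assms ws r by (auto simp: X_index_def)
      qed
    qed
    also have "\<dots> \<longleftrightarrow> w \<in> cfun.span (tab ` {\<tau> \<in> syt2 n k. maj \<tau> = i})"
      using ws by (subst span_tab) auto
    finally show ?thesis .
  qed
  have sub: "cfun.span (tab ` {\<tau> \<in> syt2 n k. maj \<tau> = i}) \<subseteq> cfun.span (tab ` syt2 n k)"
    by (intro cfun.span_mono) auto
  have "mult_space_deg (X_space n) (2 * k + 1) i \<subseteq> ?R ` cfun.span (tab ` syt2 n k)"
    unfolding mult_space_X_space[OF assms, symmetric] by (auto simp: mult_space_deg_def)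
  then show ?thesis using deg sub by blast
qed


section \<open>The unitary isomorphism\<close>

context fusion_form
begin

definition basis :: "nat \<Rightarrow> nat \<times> nat \<times> tableau \<Rightarrow> tensor" where
  "basis m = (SOME b. adapted m b)"

lemma adapted_basis_m: "adapted m (basis m)"
  unfolding basis_def by (rule someI_ex[OF ex_adapted])

definition index_maj :: "nat \<times> nat \<times> tableau \<Rightarrow> nat" where
  "index_maj p = maj (snd (snd p))"

definition bvec :: "nat \<times> nat \<times> tableau \<Rightarrow> tensor" where
  "bvec p = basis (index_maj p) p"

lemma bvec_X:
  assumes "k \<le> n" "\<tau> \<in> syt2 n k"
  shows "bvec (k, j, \<tau>) \<in> X (maj \<tau>) (n - k + j)"
  using adapted_basis_m[of "maj \<tau>"] assms unfolding adapted_def bvec_def index_maj_def snd_conv by blast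

lemma bvec_lt:
  assumes "p \<in> X_index n"
  shows "bvec p \<in> lt (Suc (index_maj p))"
proof -
  obtain k j \<tau> where p: "p = (k, j, \<tau>)" by (cases p)
  have "k \<le> n" "\<tau> \<in> syt2 n k" using assms by (auto simp: p X_index_def)
  then have "bvec p \<in> X (maj \<tau>) (n - k + j)" unfolding p by (rule bvec_X)
  then show ?thesis unfolding p index_maj_def snd_conv by (rule X_lt)
qed

definition idx :: "nat \<Rightarrow> (nat \<times> nat \<times> tableau) set" where
  "idx m = {p \<in> X_index n. index_maj p = m}"

lemma finite_idx [simp]: "finite (idx m)"
  by (simp add: idx_def)

lemma bvec_lt_idx: "p \<in> idx m \<Longrightarrow> bvec p \<in> lt (Suc m)"
  using bvec_lt[of p] by (simp add: idx_def)

lemma bvec_orthonormal: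
  assumes "p \<in> X_index n" "q \<in> X_index n" "index_maj p = m" "index_maj q = m"
  shows "form m (bvec p) (bvec q) = (if p = q then 1 else 0)"
proof -
  have b: "bvec p = basis m p" "bvec q = basis m q" using assms(3,4) by (simp_all only: bvec_def)
  show ?thesis
    using adapted_basis_m[of m] assms unfolding adapted_def b index_maj_def by blast
qed

lemma bvec_complete_level:
  assumes "w \<in> X m l" "\<And>k j \<tau>. (k, j, \<tau>) \<in> X_index n \<Longrightarrow> maj \<tau> = m \<Longrightarrow> n - k + j = l \<Longrightarrow> form m w (bvec (k, j, \<tau>)) = 0"
  shows "w \<in> lt m"
proof -
  have "\<forall>k j \<tau>. (k, j, \<tau>) \<in> X_index n \<and> maj \<tau> = m \<and> n - k + j = l \<longrightarrow> form m w (basis m (k, j, \<tau>)) = 0"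
  proof (intro allI impI)
    fix k j \<tau> assume h: "(k, j, \<tau>) \<in> X_index n \<and> maj \<tau> = m \<and> n - k + j = l"
    then have "bvec (k, j, \<tau>) = basis m (k, j, \<tau>)" by (simp add: bvec_def index_maj_def)
    then show "form m w (basis m (k, j, \<tau>)) = 0" using assms(2)[of k j \<tau>] h by simp
  qed
  then show ?thesis using adapted_basis_m[of m] assms(1) unfolding adapted_def by blast
qed

lemma bvec_e:
  assumes "(k, j, \<tau>) \<in> X_index n"
  shows "act sl2_e (bvec (k, j, \<tau>)) - cscale (ladder k (Suc j)) (bvec (k, Suc j, \<tau>)) \<in> lt (maj \<tau>)"
proof -
  have "k \<le> n \<and> \<tau> \<in> syt2 n k \<and> maj \<tau> = maj \<tau> \<and> j \<le> 2 * k" using assms by (simp add: X_index_def)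
  then show ?thesis using adapted_basis_m[of "maj \<tau>"] unfolding adapted_def bvec_def index_maj_def snd_conv by blast
qed

lemma bvec_f:
  assumes "(k, j, \<tau>) \<in> X_index n"
  shows "act sl2_f (bvec (k, j, \<tau>)) - cscale (ladder k j) (bvec (k, j - 1, \<tau>)) \<in> lt (maj \<tau>)"
proof -
  have "k \<le> n \<and> \<tau> \<in> syt2 n k \<and> maj \<tau> = maj \<tau> \<and> j \<le> 2 * k" using assms by (simp add: X_index_def)
  then show ?thesis using adapted_basis_m[of "maj \<tau>"] unfolding adapted_def bvec_def index_maj_def snd_conv by blast
qed

text \<open>
  The level components of \<open>w\<close> are tested separately, by the orthogonality of levels.
\<close>

lemma bvec_complete:
  assumes w: "w \<in> lt (Suc m)" and 0: "\<And>p. p \<in> X_index n \<Longrightarrow> index_maj p = m \<Longrightarrow> form m w (bvec p) = 0"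
  shows "w \<in> lt m"
proof -
  interpret semi_inner "lt (Suc m)" "lt m" "form m" by (rule semi_inner_form)
  have level_part: "level_part l w \<in> X m l" for l using w by (rule level_part_in_level_space)
  have levU: "level_part l w \<in> lt m" for l
  proof (rule bvec_complete_level[OF level_part])
    fix k j \<tau> assume p: "(k, j, \<tau>) \<in> X_index n" "maj \<tau> = m" and l: "n - k + j = l"
    have b: "bvec (k, j, \<tau>) \<in> X m l" using bvec_X[of k \<tau> j] p l by (auto simp: X_index_def)
    have bW: "bvec (k, j, \<tau>) \<in> lt (Suc m)" using b by (rule X_lt)
    have "l \<le> 2 * n" using p l by (auto simp: X_index_def)
    have "form m w (bvec (k, j, \<tau>)) = form m (\<Sum>i\<le>2 * n. level_part i w) (bvec (k, j, \<tau>))"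
      by (rule arg_cong[where f = "\<lambda>v. form m v (bvec (k, j, \<tau>))"]) (rule sum_level_part[OF w])
    also have "\<dots> = (\<Sum>i\<le>2 * n. form m (level_part i w) (bvec (k, j, \<tau>)))"
      by (rule form_sum[OF X_lt[OF level_part] bW])
    also have "\<dots> = (\<Sum>i\<le>2 * n. if i = l then form m (level_part l w) (bvec (k, j, \<tau>)) else 0)"
      using form_orthogonal_levels[OF level_part b] by (intro sum.cong refl) auto
    also have "\<dots> = form m (level_part l w) (bvec (k, j, \<tau>))" using \<open>l \<le> 2 * n\<close> by simp
    finally show "form m (level_part l w) (bvec (k, j, \<tau>)) = 0" using 0[OF p(1)] p(2) by (simp add: index_maj_def)
  qed
  have "(\<Sum>i\<le>2 * n. level_part i w) \<in> lt m" by (rule cfun.subspace_sum[OF subspace_V_lt levU])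
  then show ?thesis using sum_level_part[OF w] by metis
qed

lemma form_expansion:
  assumes "v \<in> lt (Suc m)" "w \<in> lt (Suc m)"
  shows "form m v w = (\<Sum>p\<in>idx m. form m v (bvec p) * cnj (form m w (bvec p)))"
proof -
  interpret semi_inner "lt (Suc m)" "lt m" "form m" by (rule semi_inner_form)
  have bW: "bvec p \<in> lt (Suc m)" if "p \<in> idx m" for p using that by (rule bvec_lt_idx)
  have on: "orthonormal (idx m) bvec"
    unfolding orthonormal_def using bW bvec_orthonormal by (auto simp: idx_def)
  have co: "complete (lt (Suc m)) (idx m) bvec"
    unfolding complete_def using bvec_complete by (auto simp: idx_def)
  let ?s = "\<Sum>p\<in>idx m. cscale (form m v (bvec p)) (bvec p)"
  have sW: "?s \<in> lt (Suc m)" using bW by (intro cfun.subspace_sum cfun.subspace_scale subspace_V_lt)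
  have "v - ?s \<in> lt m"
    using finite_idx on co subspace_V_lt subset_refl bW assms(1) by (rule expansion)
  then have "form m v w = form m ?s w"
    using assms sW by (intro form_cong)
  also have "\<dots> = (\<Sum>p\<in>idx m. form m (cscale (form m v (bvec p)) (bvec p)) w)"
    using bW assms(2) by (intro form_sum W_closed) auto
  also have "\<dots> = (\<Sum>p\<in>idx m. form m v (bvec p) * cnj (form m w (bvec p)))"
    using form_scale[OF bW assms(2)] form_herm[OF assms(2) bW] by (intro sum.cong refl) simp
  finally show ?thesis .
qed

text \<open>
  The coordinates with respect to the adapted basis.
\<close>

definition T :: "(nat \<Rightarrow> tensor set) \<Rightarrow> xvec" where
  "T v = (\<lambda>p. if p \<in> X_index n then B v (cosets (at_deg (index_maj p) (bvec p))) else 0)"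

lemma T_cosets:
  assumes "a \<in> fam" "p \<in> X_index n"
  shows "T (cosets a) p = form (index_maj p) (a (index_maj p)) (bvec p)"
  unfolding T_def if_P[OF assms(2)] by (rule B_at_deg[OF assms(1) bvec_lt[OF assms(2)]])

lemma T_outside: "p \<notin> X_index n \<Longrightarrow> T v p = 0"
  by (simp add: T_def)

text \<open>
  The operators are moved to the basis vectors, on which they act by the coefficients of \<open>irrep_act\<close>; passing to the
  adjoint interchanges \<open>e\<close> and \<open>f\<close>.
\<close>

lemma T_act:
  assumes x: "x \<in> sl2" and a: "a \<in> fam"
  shows "T (cosets (\<lambda>m. act x (a m))) = vact (X_space n) x (T (cosets a))"
proof
  fix p :: "nat \<times> nat \<times> tableau"
  obtain k j \<tau> where p: "p = (k, j, \<tau>)" by (cases p)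
  show "T (cosets (\<lambda>m. act x (a m))) p = vact (X_space n) x (T (cosets a)) p"
  proof (cases "p \<in> X_index n")
    case False
    then have 0: "T (cosets a) (k, j', \<tau>) = 0" if "j < 2 * k + 1" for j'
      using that by (intro T_outside) (auto simp: p X_index_def)
    have "vact (X_space n) x (T (cosets a)) p = 0"
      unfolding p X_space_simps irrep_act_def using 0 by auto
    then show ?thesis unfolding T_outside[OF False] by simp
  next
    case True
    define m where "m = maj \<tau>"
    interpret semi_inner "lt (Suc m)" "lt m" "form m" by (rule semi_inner_form)
    have k: "k \<le> n" "\<tau> \<in> syt2 n k" "j < 2 * k + 1" using True by (auto simp: p X_index_def)
    define g where "g i = T (cosets a) (k, i, \<tau>)" for i
    have bW: "bvec (k, i, \<tau>) \<in> lt (Suc m)" for i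
      using bvec_X[OF k(1,2)] X_lt by (auto simp: m_def)
    have am: "a m \<in> lt (Suc m)" using a by (rule famD)
    have mem: "act y v \<in> lt (Suc m)" if "y \<in> sl2" "v \<in> lt (Suc m)" for y v
      using that by (rule V_lt_sl2)
    have g: "form m (a m) (bvec (k, i, \<tau>)) = g i" if "i < 2 * k + 1" for i
      unfolding g_def using that k by (subst T_cosets[OF a]) (auto simp: X_index_def index_maj_def m_def)
    have gS: "ladder k (Suc j) * form m (a m) (bvec (k, Suc j, \<tau>)) = ladder k (Suc j) * g (Suc j)"
      using g[of "Suc j"] ladder_top k(3) by (cases "j = 2 * k") auto
    have H: "form m (act sl2_h (a m)) (bvec p) = of_real (2 * real j - 2 * real k) * g j"
    proof -
      have "form m (act sl2_h (a m)) (bvec p) = form m (a m) (act sl2_h (bvec p))"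
        using form_act[of sl2_h "a m" m "bvec p"] sl2_members conj_transpose_sl2 am bW p by simp
      also have "act sl2_h (bvec p) = cscale (2 * of_nat (n - k + j) - of_nat (2 * n)) (bvec p)"
        using bvec_X[OF k(1,2)] unfolding p by (rule level_space_h)
      also have "2 * of_nat (n - k + j) - of_nat (2 * n) = (of_real (2 * real j - 2 * real k) :: complex)"
        using k(1) by (simp add: of_nat_diff)
      also have "form m (a m) (cscale (of_real (2 * real j - 2 * real k)) (bvec p))
          = cnj (of_real (2 * real j - 2 * real k)) * form m (a m) (bvec p)"
        using bW am unfolding p by (intro form_scale_right)
      finally show ?thesis using g[OF k(3)] p by (simp only: complex_cnj_complex_of_real)
    qed
    have E: "form m (act sl2_e (a m)) (bvec p) = ladder k j * g (j - 1)"
    proof -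
      have "form m (act sl2_e (a m)) (bvec p) = form m (a m) (act sl2_f (bvec p))"
        using form_act[of sl2_e "a m" m "bvec p"] sl2_members conj_transpose_sl2 am bW p by simp
      also have "\<dots> = form m (a m) (cscale (ladder k j) (bvec (k, j - 1, \<tau>)))"
        using bvec_f[of k j \<tau>] True am bW sl2_members unfolding p m_def[symmetric]
        by (intro form_cong_right mem W_closed) auto
      also have "\<dots> = ladder k j * form m (a m) (bvec (k, j - 1, \<tau>))"
        using form_scale_right[OF bW am] by simp
      finally show ?thesis using g[of "j - 1"] k(3) by simp
    qed
    have F: "form m (act sl2_f (a m)) (bvec p) = ladder k (Suc j) * g (Suc j)"
    proof -
      have "form m (act sl2_f (a m)) (bvec p) = form m (a m) (act sl2_e (bvec p))"
        using form_act[of sl2_f "a m" m "bvec p"] sl2_members conj_transpose_sl2 am bW p by simp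
      also have "\<dots> = form m (a m) (cscale (ladder k (Suc j)) (bvec (k, Suc j, \<tau>)))"
        using bvec_e[of k j \<tau>] True am bW sl2_members unfolding p m_def[symmetric]
        by (intro form_cong_right mem W_closed) auto
      also have "\<dots> = ladder k (Suc j) * form m (a m) (bvec (k, Suc j, \<tau>))"
        using form_scale_right[OF bW am] by simp
      finally show ?thesis using gS by simp
    qed
    have bp: "bvec p \<in> lt (Suc m)" unfolding p by (rule bW)
    have "T (cosets (\<lambda>m. act x (a m))) p = form m (act x (a m)) (bvec p)"
      using T_cosets[OF fam_act[OF x a] True] by (simp add: p index_maj_def m_def)
    also have "\<dots> = x $ 1 $ 1 * form m (act sl2_h (a m)) (bvec p)
        + x $ 1 $ 2 * form m (act sl2_e (a m)) (bvec p) + x $ 2 $ 1 * form m (act sl2_f (a m)) (bvec p)"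
      unfolding tensor_act_sl2[OF x]
      by (simp only: form_add form_scale W_closed mem sl2_members am bp)
    also have "\<dots> = irrep_act (2 * k + 1) x g j"
      unfolding H E F irrep_act_ladder[OF k(3)] by simp
    also have "\<dots> = vact (X_space n) x (T (cosets a)) p"
      unfolding p X_space_simps g_def ..
    finally show ?thesis .
  qed
qed

text \<open>
  The vector with given coordinates, as a family of representatives; it provides the inverse of \<open>T\<close>.
\<close>

definition synth :: "xvec \<Rightarrow> nat \<Rightarrow> tensor" where
  "synth g = (\<lambda>m. \<Sum>p\<in>idx m. cscale (g p) (bvec p))"

lemma synth_lt: "synth g m \<in> lt (Suc m)"
  unfolding synth_def
proof (intro cfun.subspace_sum cfun.subspace_scale subspace_V_lt)
  fix p assume "p \<in> idx m"
  then show "bvec p \<in> lt (Suc m)" by (rule bvec_lt_idx)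
qed

lemma synth_0:
  assumes "\<And>p. p \<in> X_index n \<Longrightarrow> index_maj p = m \<Longrightarrow> g p = 0"
  shows "synth g m \<in> lt m"
  unfolding synth_def
proof (intro cfun.subspace_sum subspace_V_lt)
  fix p assume "p \<in> idx m"
  then have "g p = 0" using assms by (auto simp: idx_def)
  show "cscale (g p) (bvec p) \<in> lt m" unfolding \<open>g p = 0\<close> cfun.scale_zero_left by (rule lt_closed(4))
qed

lemma synth_fam: "synth g \<in> fam"
proof -
  have "{m. synth g m \<notin> lt m} \<subseteq> index_maj ` X_index n"
  proof
    fix m assume m: "m \<in> {m. synth g m \<notin> lt m}"
    show "m \<in> index_maj ` X_index n"
    proof (rule ccontr)
      assume "m \<notin> index_maj ` X_index n"
      then have "synth g m \<in> lt m" by (intro synth_0) blast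
      then show False using m by blast
    qed
  qed
  then have "finite {m. synth g m \<notin> lt m}" by (rule finite_subset) simp
  then show ?thesis by (simp only: fam_def mem_Collect_eq synth_lt simp_thms)
qed

lemma T_synth:
  assumes "\<And>p. p \<notin> X_index n \<Longrightarrow> g p = 0"
  shows "T (cosets (synth g)) = g"
proof
  fix p
  show "T (cosets (synth g)) p = g p"
  proof (cases "p \<in> X_index n")
    case False
    then show ?thesis using assms T_outside by simp
  next
    case True
    interpret semi_inner "lt (Suc (index_maj p))" "lt (index_maj p)" "form (index_maj p)" by (rule semi_inner_form)
    have bW: "bvec q \<in> lt (Suc (index_maj p))" if "q \<in> idx (index_maj p)" for q using that by (rule bvec_lt_idx)
    have p: "p \<in> idx (index_maj p)" using True by (simp add: idx_def)
    have "T (cosets (synth g)) p = (\<Sum>q\<in>idx (index_maj p). form (index_maj p) (cscale (g q) (bvec q)) (bvec p))"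
      unfolding T_cosets[OF synth_fam True] unfolding synth_def
      by (rule form_sum[OF W_closed(2)[OF bW] bW[OF p]])
    also have "\<dots> = (\<Sum>q\<in>idx (index_maj p). if q = p then g p else 0)"
    proof (intro sum.cong refl)
      fix q assume q: "q \<in> idx (index_maj p)"
      have "form (index_maj p) (bvec q) (bvec p) = (if q = p then 1 else 0)"
        using q True by (intro bvec_orthonormal) (auto simp: idx_def)
      then show "form (index_maj p) (cscale (g q) (bvec q)) (bvec p) = (if q = p then g p else 0)"
        using form_scale[OF bW[OF q] bW[OF p]] by simp
    qed
    also have "\<dots> = g p" using p by simp
    finally show ?thesis .
  qed
qed

lemma T_inj:
  assumes "a \<in> fam" "b \<in> fam" "T (cosets a) = T (cosets b)"
  shows "cosets a = cosets b"
  unfolding cosets_eq_iff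
proof
  fix m
  interpret semi_inner "lt (Suc m)" "lt m" "form m" by (rule semi_inner_form)
  show "a m - b m \<in> lt m"
  proof (rule bvec_complete)
    show "a m - b m \<in> lt (Suc m)" using famD[OF assms(1)] famD[OF assms(2)] by (rule lt_closed)
    fix p assume p: "p \<in> X_index n" "index_maj p = m"
    have "form m (a m) (bvec p) = form m (b m) (bvec p)"
      using T_cosets[OF assms(1) p(1)] T_cosets[OF assms(2) p(1)] assms(3) p(2) by simp
    then show "form m (a m - b m) (bvec p) = 0"
      using form_diff[OF famD[OF assms(1)] famD[OF assms(2)], of "bvec p"] bvec_lt[OF p(1)] p(2) by simp
  qed
qed

lemma T_isometry:
  assumes a: "a \<in> fam" and c: "c \<in> fam"
  shows "(\<Sum>p\<in>X_index n. T (cosets a) p * cnj (T (cosets c) p)) = B (cosets a) (cosets c)"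
proof -
  define K where "K = {m. a m \<notin> lt m} \<union> index_maj ` X_index n"
  have K: "finite K" using a by (simp add: K_def fam_def)
  have "B (cosets a) (cosets c) = (\<Sum>m\<in>K. form m (a m) (c m))"
    using a c K by (rule B_eq_sum_form) (simp add: K_def)
  also have "\<dots> = (\<Sum>m\<in>K. \<Sum>p\<in>{p. p \<in> X_index n \<and> index_maj p = m}. T (cosets a) p * cnj (T (cosets c) p))"
  proof (intro sum.cong refl)
    fix m
    show "form m (a m) (c m) = (\<Sum>p\<in>{p. p \<in> X_index n \<and> index_maj p = m}. T (cosets a) p * cnj (T (cosets c) p))"
      unfolding form_expansion[OF famD[OF a] famD[OF c]] idx_def
      using T_cosets[OF a] T_cosets[OF c] by (intro sum.cong refl) auto
  qed
  also have "\<dots> = (\<Sum>p\<in>X_index n. T (cosets a) p * cnj (T (cosets c) p))"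
    using K by (intro sum.group) (auto simp: K_def)
  finally show ?thesis by simp
qed

lemma T_carr: "T v \<in> carr (X_space n)"
  unfolding X_space_simps using T_outside by blast

lemma T_rep_hom: "rep_hom (fusion (2 * n) z B) (X_space n) T"
  unfolding rep_hom_def
proof (intro conjI ballI allI)
  show "T \<in> carr (fusion (2 * n) z B) \<rightarrow> carr (X_space n)" using T_carr by blast
next
  fix v w assume "v \<in> carr (fusion (2 * n) z B)" "w \<in> carr (fusion (2 * n) z B)"
  then obtain a b where a: "v = cosets a" "a \<in> fam" and b: "w = cosets b" "b \<in> fam"
    unfolding fusion_carr by blast
  show "T (vadd (fusion (2 * n) z B) v w) = vadd (X_space n) (T v) (T w)"
    unfolding a(1) b(1) fusion_add X_space_simps
  proof
    fix p
    show "T (cosets (\<lambda>m. a m + b m)) p = (T (cosets a) + T (cosets b)) p"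
    proof (cases "p \<in> X_index n")
      case True
      show ?thesis
        unfolding plus_fun_def[of "T (cosets a)"] unfolding T_def if_P[OF True] by (rule B_add[OF a(2) b(2) at_deg_fam[OF bvec_lt[OF True]]])
    next
      case False
      show ?thesis unfolding plus_fun_def[of "T (cosets a)"] unfolding T_outside[OF False] by simp
    qed
  qed
next
  fix c v assume "v \<in> carr (fusion (2 * n) z B)"
  then obtain a where a: "v = cosets a" "a \<in> fam" unfolding fusion_carr by blast
  show "T (vscale (fusion (2 * n) z B) c v) = vscale (X_space n) c (T v)"
    unfolding a(1) fusion_scale X_space_simps
  proof
    fix p
    show "T (cosets (\<lambda>m. cscale c (a m))) p = cscale c (T (cosets a)) p"
    proof (cases "p \<in> X_index n")
      case True
      show ?thesis
        unfolding cscale_def[of c "T (cosets a)"] unfolding T_def if_P[OF True]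
        by (rule B_scale[OF a(2) at_deg_fam[OF bvec_lt[OF True]]])
    next
      case False
      show ?thesis unfolding cscale_def[of c "T (cosets a)"] T_outside[OF False] by simp
    qed
  qed
next
  fix x v assume x: "x \<in> sl2" and "v \<in> carr (fusion (2 * n) z B)"
  then obtain a where a: "v = cosets a" "a \<in> fam" unfolding fusion_carr by blast
  show "T (vact (fusion (2 * n) z B) x v) = vact (X_space n) x (T v)"
    unfolding a(1) fusion_act[OF x] by (rule T_act[OF x a(2)])
qed

lemma T_bij: "bij_betw T (carr (fusion (2 * n) z B)) (carr (X_space n))"
  unfolding bij_betw_def
proof
  show "inj_on T (carr (fusion (2 * n) z B))"
    unfolding fusion_carr by (rule inj_onI) (use T_inj in blast)
  show "T ` carr (fusion (2 * n) z B) = carr (X_space n)"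
  proof (intro equalityI subsetI)
    fix g assume "g \<in> carr (X_space n)"
    then have "g = T (cosets (synth g))" unfolding X_space_simps by (intro T_synth[symmetric]) blast
    moreover have "cosets (synth g) \<in> carr (fusion (2 * n) z B)"
      unfolding fusion_carr using synth_fam by (rule imageI)
    ultimately show "g \<in> T ` carr (fusion (2 * n) z B)" by (rule image_eqI)
  qed (use T_carr in blast)
qed

lemma T_unitary_iso: "unitary_iso (fusion (2 * n) z B) (X_space n) T"
  unfolding unitary_iso_def
proof (intro conjI ballI T_rep_hom T_bij)
  fix v w assume "v \<in> carr (fusion (2 * n) z B)" "w \<in> carr (fusion (2 * n) z B)"
  then obtain a b where a: "v = cosets a" "a \<in> fam" and b: "w = cosets b" "b \<in> fam"
    unfolding fusion_carr by blast
  have "ip (fusion (2 * n) z B) = B" by (simp add: fusion_def)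
  then show "ip (X_space n) (T v) (T w) = ip (fusion (2 * n) z B) v w"
    unfolding a(1) b(1) X_space_simps T_isometry[OF a(2) b(2)] by simp
qed

lemma T_grading: "T ` deg (fusion (2 * n) z B) m = deg (X_space n) m"
proof (intro equalityI subsetI)
  fix g assume "g \<in> T ` deg (fusion (2 * n) z B) m"
  then obtain a where a: "a \<in> fam" "\<And>k. k \<noteq> m \<Longrightarrow> a k \<in> lt k" "g = T (cosets a)"
    unfolding fusion_deg by blast
  have wrong_degree: "g p = 0" if p: "p \<in> X_index n" "index_maj p \<noteq> m" for p
  proof -
    interpret semi_inner "lt (Suc (index_maj p))" "lt (index_maj p)" "form (index_maj p)" by (rule semi_inner_form)
    show ?thesis unfolding a(3) T_cosets[OF a(1) p(1)] by (rule form_null[OF a(2)[OF p(2)] bvec_lt[OF p(1)]])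
  qed
  have outside: "g p = 0" if "p \<notin> X_index n" for p unfolding a(3) using that by (rule T_outside)
  show "g \<in> deg (X_space n) m"
    unfolding X_deg_eq
  proof (intro CollectI allI impI)
    fix k j \<tau> assume nz: "g (k, j, \<tau>) \<noteq> 0"
    have "(k, j, \<tau>) \<in> X_index n" using nz outside by blast
    moreover from this have "index_maj (k, j, \<tau>) = m" using nz wrong_degree by blast
    ultimately show "(k, j, \<tau>) \<in> X_index n \<and> maj \<tau> = m" by (simp add: index_maj_def)
  qed
next
  fix g assume g: "g \<in> deg (X_space n) m"
  have outside: "g p = 0" if "p \<notin> X_index n \<or> index_maj p \<noteq> m" for p
  proof -
    obtain k j \<tau> where p: "p = (k, j, \<tau>)" by (cases p)
    have "g (k, j, \<tau>) \<noteq> 0 \<longrightarrow> (k, j, \<tau>) \<in> X_index n \<and> maj \<tau> = m"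
      using g unfolding X_deg_eq by blast
    then show ?thesis using that unfolding p index_maj_def snd_conv by blast
  qed
  have "g = T (cosets (synth g))" by (rule T_synth[symmetric]) (rule outside, blast)
  moreover have "synth g k \<in> lt k" if "k \<noteq> m" for k
    by (rule synth_0) (rule outside, use that in blast)
  then have "cosets (synth g) \<in> deg (fusion (2 * n) z B) m"
    unfolding fusion_deg using synth_fam by blast
  ultimately show "g \<in> T ` deg (fusion (2 * n) z B) m" by (rule image_eqI)
qed

lemma rep_closed_fusion: "rep_closed (fusion (2 * n) z B)"
  unfolding rep_closed_def fusion_carr
proof (intro conjI ballI allI)
  fix v w assume "v \<in> cosets ` fam" "w \<in> cosets ` fam"
  then show "vadd (fusion (2 * n) z B) v w \<in> cosets ` fam" using fam_add by (force simp: fusion_add)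
next
  fix c v assume "v \<in> cosets ` fam"
  then show "vscale (fusion (2 * n) z B) c v \<in> cosets ` fam" using fam_scale by (force simp: fusion_scale)
next
  fix x v assume "x \<in> sl2" "v \<in> cosets ` fam"
  then show "vact (fusion (2 * n) z B) x v \<in> cosets ` fam" using fam_act by (force simp: fusion_act)
qed

lemma fusion_deg_carr: "deg (fusion (2 * n) z B) m \<subseteq> carr (fusion (2 * n) z B)"
  unfolding fusion_deg fusion_carr by blast

end

theorem theorem1:
  fixes n :: nat and z :: "nat \<Rightarrow> complex"
    and B :: "(nat \<Rightarrow> tensor set) \<Rightarrow> (nat \<Rightarrow> tensor set) \<Rightarrow> complex"
  assumes "inj_on z {..<2 * n}"
    and "unitary_rep (fusion (2 * n) z B)"
    and "orthogonal_grading (fusion (2 * n) z B)"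
  shows "\<exists>T.
    unitary_iso (fusion (2 * n) z B) (X_space n) T \<and>
    grading_preserving (fusion (2 * n) z B) (X_space n) T \<and>
    (\<forall>\<Phi>. schur_weyl n \<Phi> \<longrightarrow>
       unitary_iso (fusion (2 * n) z B) (X_tensor n \<Phi>) (\<Phi> \<circ> T) \<and>
       grading_preserving (fusion (2 * n) z B) (X_tensor n \<Phi>) (\<Phi> \<circ> T)) \<and>
    (\<forall>k\<le>n.
       compose (carr (irrep (2 * k + 1))) T ` mult_space (fusion (2 * n) z B) (2 * k + 1) =
         (\<lambda>w. \<lambda>u\<in>carr (irrep (2 * k + 1)). pure k u w) ` cfun.span (tab ` syt2 n k) \<and>
       (\<forall>i. compose (carr (irrep (2 * k + 1))) T ` mult_space_deg (fusion (2 * n) z B) (2 * k + 1) i =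
         (\<lambda>w. \<lambda>u\<in>carr (irrep (2 * k + 1)). pure k u w) ` cfun.span (tab ` {\<tau> \<in> syt2 n k. maj \<tau> = i})))"
proof -
  interpret fusion_form n z B using assms by unfold_locales
  show ?thesis
  proof (intro exI[of _ T] conjI allI impI)
    show "unitary_iso (fusion (2 * n) z B) (X_space n) T" by (rule T_unitary_iso)
    show "grading_preserving (fusion (2 * n) z B) (X_space n) T"
      unfolding grading_preserving_def using T_grading by blast
  next
    fix \<Phi> assume "schur_weyl n \<Phi>"
    then have "unitary_iso (X_space n) (X_tensor n \<Phi>) \<Phi>" by (simp only: schur_weyl_def)
    with T_unitary_iso show "unitary_iso (fusion (2 * n) z B) (X_tensor n \<Phi>) (\<Phi> \<circ> T)"
      by (rule unitary_iso_comp)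
    have "deg (X_tensor n \<Phi>) m = \<Phi> ` deg (X_space n) m" for m by (simp add: X_tensor_def)
    then show "grading_preserving (fusion (2 * n) z B) (X_tensor n \<Phi>) (\<Phi> \<circ> T)"
      unfolding grading_preserving_def image_comp[symmetric] T_grading by simp
  next
    fix k assume k: "k \<le> n"
    show "compose (carr (irrep (2 * k + 1))) T ` mult_space (fusion (2 * n) z B) (2 * k + 1) =
         (\<lambda>w. \<lambda>u\<in>carr (irrep (2 * k + 1)). pure k u w) ` cfun.span (tab ` syt2 n k)"
      unfolding compose_mult_space_eq[OF T_rep_hom T_bij rep_closed_fusion] by (rule mult_space_X_space[OF k])
    fix i
    show "compose (carr (irrep (2 * k + 1))) T ` mult_space_deg (fusion (2 * n) z B) (2 * k + 1) i =
         (\<lambda>w. \<lambda>u\<in>carr (irrep (2 * k + 1)). pure k u w) ` cfun.span (tab ` {\<tau> \<in> syt2 n k. maj \<tau> = i})"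
      unfolding compose_mult_space_deg_eq[OF T_rep_hom T_bij rep_closed_fusion T_grading fusion_deg_carr]
      by (rule mult_space_deg_X_space[OF k])
  qed
qed

end
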